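(* Let $A$ be the preprojective algebra of type $\mathrm{A}_n$ ($n\geq3$) over a field $\mathbb{F}$, and let $m=\lfloor\frac{n-1}{2}\rfloor$. Consider the basis of $\mathrm{HK}^\bullet(A)$ consisting of $z_\ell$ ($0\leq\ell\leq m$) in degree $0$, $\overline{\zeta}_\ell$ ($0\leq\ell\leq n-m-2$) in degree $1$, and $\overline{h}_i$ ($0\leq i\leq n-1$) in degree $2$. Up to graded commutativity, the non zero Koszul cup products of elements of this basis are given by $$z_0\smile\overline{f}=\overline{f}\quad\text{for all }\overline{f}\in\mathrm{HK}^\bullet(A),$$ $$z_{\ell_1}\smile z_{\ell_2}=z_{\ell_1+\ell_2}\quad\text{if }\ell_1+\ell_2\leq m,$$ $$z_{\ell_1}\smile\overline{\zeta}_{\ell_2}=\overline{\zeta}_{\ell_1+\ell_2}\quad\text{if }\ell_1+\ell_2\leq n-m-2.$$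
   Context: The algebra. $\overline{Q}$ is the quiver with vertices $0,1,\ldots,n-1$ and arrows $a_i:i\to i+1$, $a_i^*:i+1\to i$ for $0\leq i\leq n-2$; paths are written from right to left. $k=\bigoplus_i\mathbb{F}e_i$, $V=\mathbb{F}\overline{Q}_1$, $k^e=k\otimes_{\mathbb{F}}k$, and $A=\mathbb{F}\overline{Q}/(R)$ where $R\subseteq V\otimes_kV$ is spanned by $\sigma_0=-a_0^*a_0$, $\sigma_i=a_{i-1}a_{i-1}^*-a_i^*a_i$ ($1\leq i\leq n-2$), $\sigma_{n-1}=a_{n-2}a_{n-2}^*$. Koszul cohomology. $W_0=k$, $W_1=V$, $W_p=\bigcap_{i+2+j=p}V^{\otimes_k i}\otimes_kR\otimes_kV^{\otimes_k j}$ for $p\geq2$ (so $W_2=R$); elements of $W_p$ are written $x_1\ldots x_p$ (a sum is understood). $\mathrm{HK}^\bullet(A)=H^\bullet(\mathrm{Hom}_{k^e}(W_\bullet,A),b_K)$ with $b_K(f)(x_1\ldots x_{p+1})=f(x_1\ldots x_p)x_{p+1}-(-1)^px_1f(x_2\ldots x_{p+1})$ for $f:W_p\to A$. The Koszul cup product is induced by $(f\smile g)(x_1\ldots x_{p+q})=(-1)^{pq}f(x_1\ldots x_p)g(x_{p+1}\ldots x_{p+q})$ for $f:W_p\to A$, $g:W_q\to A$. $\mathrm{HK}^0(A)$ is identified with the centre of $A$. $\overline{f}$ denotes the class of a cocycle $f$; a cochain takes the value $0$ on arrows or relations where no value is specified. Basis elements. $z_0=1$, $z_\ell=\sum_{i=1}^{n-2}(a_i^*a_i)^\ell$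 for $1\leq\ell\leq m$; $\zeta_\ell\in\mathrm{Hom}_{k^e}(V,A)$, $\zeta_\ell(a_i)=a_i(a_i^*a_i)^\ell$ for all $i$; $h_i\in\mathrm{Hom}_{k^e}(R,A)$, $h_i(\sigma_j)=\delta_{ij}e_i$. "Up to graded commutativity, the non zero cup products are" means that the cup product is graded commutative and that every cup product of two basis elements which is not listed, possibly after exchanging the factors, is zero. *)

theory Defs
  imports
    "HOL-Algebra.QuotRing"
    "Jordan_Normal_Form.VS_Connect"
begin

section \<open>Quotient modules\<close>

text \<open>The library quotient \<open>M Quot N\<close>, extended by the induced scalar multiplication. It serves both
  for quotient algebras (\<open>N\<close> a two-sided ideal) and for quotient vector spaces; in the latter case
  the fields \<open>mult\<close> and \<open>one\<close> carry no meaning.\<close>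

definition quot_module :: "('a, 'b) module \<Rightarrow> 'b set \<Rightarrow> ('a, 'b set) module" where
  "quot_module M N =
     ring.extend (M Quot N) (module.fields (\<lambda>c X. \<Union>x\<in>X. N +>\<^bsub>M\<^esub> (c \<odot>\<^bsub>M\<^esub> x)))"


section \<open>The path algebra of the double quiver\<close>

text \<open>\<open>Arr i\<close> is the arrow $a_i : i \to i+1$ and \<open>Star i\<close> the arrow $a_i^* : i+1 \to i$.\<close>

datatype arrow = Arr nat | Star nat

fun src :: "arrow \<Rightarrow> nat" where
  "src (Arr i) = i"
| "src (Star i) = Suc i"

fun tgt :: "arrow \<Rightarrow> nat" where
  "tgt (Arr i) = Suc i"
| "tgt (Star i) = i"

definition arrows :: "nat \<Rightarrow> arrow set" where
  "arrows n = {Arr i | i. Suc i < n} \<union> {Star i | i. Suc i < n}"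

text \<open>A path is a triple \<open>(j, xs, i)\<close> consisting of its target, its arrows and its source. Paths are
  written from right to left: the last arrow of the list \<open>xs\<close> starts at \<open>i\<close>, the first one ends
  at \<open>j\<close>. The trivial path at \<open>i\<close> is \<open>(i, [], i)\<close>.\<close>

type_synonym path = "nat \<times> arrow list \<times> nat"

fun is_path :: "nat \<Rightarrow> nat \<Rightarrow> arrow list \<Rightarrow> nat \<Rightarrow> bool" where
  "is_path n j [] i \<longleftrightarrow> j < n \<and> i = j"
| "is_path n j (x # xs) i \<longleftrightarrow> x \<in> arrows n \<and> tgt x = j \<and> is_path n (src x) xs i"

definition paths :: "nat \<Rightarrow> path set" where
  "paths n = {(j, xs, i). is_path n j xs i}"

type_synonym 'f pvec = "path \<Rightarrow> 'f"

text \<open>The multiplication sums over all factorizations of a path.\<close>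

definition path_algebra :: "nat \<Rightarrow> ('f::field, 'f pvec) module" where
  "path_algebra n =
     \<lparr> carrier = {f. finite {p. f p \<noteq> 0} \<and> {p. f p \<noteq> 0} \<subseteq> paths n},
       monoid.mult = (\<lambda>f g (j, xs, i).
          \<Sum>k\<le>length xs. \<Sum>v<n. f (j, take k xs, v) * g (v, drop k xs, i)),
       one = (\<lambda>(j, xs, i). if xs = [] \<and> i = j \<and> j < n then 1 else 0),
       zero = (\<lambda>p. 0),
       add = (\<lambda>f g p. f p + g p),
       smult = (\<lambda>c f p. c * f p) \<rparr>"

definition path_vec :: "path \<Rightarrow> 'f::field pvec" where
  "path_vec p = (\<lambda>q. if q = p then 1 else 0)"

definition vertex :: "nat \<Rightarrow> 'f::field pvec" where
  "vertex i = path_vec (i, [], i)"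

definition arrow_vec :: "arrow \<Rightarrow> 'f::field pvec" where
  "arrow_vec x = path_vec (tgt x, [x], src x)"

text \<open>The path algebra is the tensor algebra of $V$ over $k$; its component spanned by the paths of
  length $p$ is $V^{\otimes_k p}$. In particular \<open>tensor_power n 0\<close> is $k = \bigoplus_i \mathbb{F} e_i$
  and \<open>tensor_power n 1\<close> is $V$.\<close>

definition tensor_power :: "nat \<Rightarrow> nat \<Rightarrow> 'f::field pvec set" where
  "tensor_power n p =
     {f \<in> carrier (path_algebra n). \<forall>j xs i. f (j, xs, i) \<noteq> 0 \<longrightarrow> length xs = p}"

text \<open>$X \otimes_k Y$ inside the tensor algebra, for sub-bimodules $X \subseteq V^{\otimes_k p}$ and
  $Y \subseteq V^{\otimes_k q}$.\<close>

definition tensor :: "nat \<Rightarrow> 'f::field pvec set \<Rightarrow> 'f pvec set \<Rightarrow> 'f pvec set" where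
  "tensor n X Y = LinearCombinations.module.span class_ring (path_algebra n)
     {x \<otimes>\<^bsub>path_algebra n\<^esub> y | x y. x \<in> X \<and> y \<in> Y}"


section \<open>The preprojective algebra\<close>

definition sigma :: "nat \<Rightarrow> nat \<Rightarrow> 'f::field pvec" where
  "sigma n i =
     (if i = 0 then
        \<ominus>\<^bsub>path_algebra n\<^esub> (arrow_vec (Star 0) \<otimes>\<^bsub>path_algebra n\<^esub> arrow_vec (Arr 0))
      else if i = n - 1 then
        arrow_vec (Arr (n - 2)) \<otimes>\<^bsub>path_algebra n\<^esub> arrow_vec (Star (n - 2))
      else
        arrow_vec (Arr (i - 1)) \<otimes>\<^bsub>path_algebra n\<^esub> arrow_vec (Star (i - 1))
        \<ominus>\<^bsub>path_algebra n\<^esub> arrow_vec (Star i) \<otimes>\<^bsub>path_algebra n\<^esub> arrow_vec (Arr i))"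

definition relations :: "nat \<Rightarrow> 'f::field pvec set" where
  "relations n = LinearCombinations.module.span class_ring (path_algebra n) (sigma n ` {..<n})"

definition preprojective :: "nat \<Rightarrow> ('f::field, 'f pvec set) module" where
  "preprojective n = quot_module (path_algebra n) (Idl\<^bsub>path_algebra n\<^esub> (relations n))"

definition proj :: "nat \<Rightarrow> 'f::field pvec \<Rightarrow> 'f pvec set" where
  "proj n x = (Idl\<^bsub>path_algebra n\<^esub> (relations n)) +>\<^bsub>path_algebra n\<^esub> x"


section \<open>The Koszul cochain complex\<close>

definition W :: "nat \<Rightarrow> nat \<Rightarrow> 'f::field pvec set" where
  "W n p =
     (if p < 2 then tensor_power n p
      else \<Inter>{tensor n (tensor_power n i) (tensor n (relations n) (tensor_power n j)) | i j.
               i + 2 + j = p})"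

type_synonym 'f cochain = "'f pvec \<Rightarrow> 'f pvec set"

text \<open>$\mathrm{Hom}_{k^e}(W_p, A)$, whose elements are made extensional outside $W_p$. Linearity over
  $\mathbb{F}$ is part of the $k$-bilinearity, as $\mathbb{F}$ acts through $\mathbb{F} \cdot 1 \subseteq k$.\<close>

definition Hom_ke :: "nat \<Rightarrow> nat \<Rightarrow> 'f::field cochain set" where
  "Hom_ke n p =
     {f \<in> W n p \<rightarrow>\<^sub>E carrier (preprojective n).
        (\<forall>w\<in>W n p. \<forall>w'\<in>W n p. f (w \<oplus>\<^bsub>path_algebra n\<^esub> w') = f w \<oplus>\<^bsub>preprojective n\<^esub> f w') \<and>
        (\<forall>w\<in>W n p. \<forall>u\<in>tensor_power n 0. \<forall>v\<in>tensor_power n 0.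
           f (u \<otimes>\<^bsub>path_algebra n\<^esub> w \<otimes>\<^bsub>path_algebra n\<^esub> v)
           = proj n u \<otimes>\<^bsub>preprojective n\<^esub> f w \<otimes>\<^bsub>preprojective n\<^esub> proj n v)}"

definition cochains :: "nat \<Rightarrow> nat \<Rightarrow> ('f::field, 'f cochain) module" where
  "cochains n p =
     \<lparr> carrier = Hom_ke n p,
       monoid.mult = undefined,
       one = undefined,
       zero = (\<lambda>w\<in>W n p. \<zero>\<^bsub>preprojective n\<^esub>),
       add = (\<lambda>f g. \<lambda>w\<in>W n p. f w \<oplus>\<^bsub>preprojective n\<^esub> g w),
       smult = (\<lambda>c f. \<lambda>w\<in>W n p. c \<odot>\<^bsub>preprojective n\<^esub> f w) \<rparr>"

text \<open>$x_1 \ldots x_{p+q} \mapsto f(x_1 \ldots x_p)\, g(x_{p+1} \ldots x_{p+q})$, a sum being understood: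
  the element \<open>w\<close> of $W_{p+q} \subseteq W_p \otimes_k W_q$ is written as a finite sum of products
  \<open>u t \<otimes> v t\<close>, and the value is the sum of the \<open>f (u t) \<otimes> g (v t)\<close>, which does not depend on the
  decomposition.\<close>

definition conv :: "nat \<Rightarrow> nat \<Rightarrow> nat \<Rightarrow> 'f::field cochain \<Rightarrow> 'f cochain \<Rightarrow> 'f cochain" where
  "conv n p q f g = (\<lambda>w\<in>W n (p + q). THE y. \<exists>(N::nat) u v.
     (\<forall>t<N. u t \<in> W n p \<and> v t \<in> W n q) \<and>
     w = (\<Oplus>\<^bsub>path_algebra n\<^esub>t\<in>{..<N}. u t \<otimes>\<^bsub>path_algebra n\<^esub> v t) \<and>
     y = (\<Oplus>\<^bsub>preprojective n\<^esub>t\<in>{..<N}. f (u t) \<otimes>\<^bsub>preprojective n\<^esub> g (v t)))"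

text \<open>The inclusion $V \to A$, through which the factors $x_{p+1}$ and $x_1$ of the differential
  are multiplied in $A$.\<close>

definition incl :: "nat \<Rightarrow> 'f::field cochain" where
  "incl n = (\<lambda>w\<in>W n 1. proj n w)"

definition bK :: "nat \<Rightarrow> nat \<Rightarrow> 'f::field cochain \<Rightarrow> 'f cochain" where
  "bK n p f = (\<lambda>w\<in>W n (p + 1).
     conv n p 1 f (incl n) w
     \<ominus>\<^bsub>preprojective n\<^esub> ((- 1) ^ p) \<odot>\<^bsub>preprojective n\<^esub> conv n 1 p (incl n) f w)"

definition cup_cochain :: "nat \<Rightarrow> nat \<Rightarrow> nat \<Rightarrow> 'f::field cochain \<Rightarrow> 'f cochain \<Rightarrow> 'f cochain" where
  "cup_cochain n p q f g = (\<lambda>w\<in>W n (p + q).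
     ((- 1) ^ (p * q)) \<odot>\<^bsub>preprojective n\<^esub> conv n p q f g w)"


section \<open>Koszul cohomology\<close>

definition cocycles :: "nat \<Rightarrow> nat \<Rightarrow> 'f::field cochain set" where
  "cocycles n p = {f \<in> Hom_ke n p. bK n p f = \<zero>\<^bsub>cochains n (p + 1)\<^esub>}"

definition coboundaries :: "nat \<Rightarrow> nat \<Rightarrow> 'f::field cochain set" where
  "coboundaries n p = (if p = 0 then {\<zero>\<^bsub>cochains n 0\<^esub>} else bK n (p - 1) ` Hom_ke n (p - 1))"

definition HK_deg :: "nat \<Rightarrow> nat \<Rightarrow> ('f::field, 'f cochain set) module" where
  "HK_deg n p = quot_module ((cochains n p)\<lparr>carrier := cocycles n p\<rparr>) (coboundaries n p)"

definition cup :: "nat \<Rightarrow> nat \<Rightarrow> nat \<Rightarrow> 'f::field cochain set \<Rightarrow> 'f cochain set \<Rightarrow> 'f cochain set" where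
  "cup n p q X Y =
     (\<Union>f\<in>X. \<Union>g\<in>Y. coboundaries n (p + q) +>\<^bsub>cochains n (p + q)\<^esub> cup_cochain n p q f g)"

text \<open>An element of a single degree, as an element of the direct sum of all degrees.\<close>

definition in_degree :: "nat \<Rightarrow> nat \<Rightarrow> 'f::field cochain set \<Rightarrow> nat \<Rightarrow> 'f cochain set" where
  "in_degree n p X = (\<lambda>q. if q = p then X else \<zero>\<^bsub>HK_deg n q\<^esub>)"

definition coh_class :: "nat \<Rightarrow> nat \<Rightarrow> 'f::field cochain \<Rightarrow> nat \<Rightarrow> 'f cochain set" where
  "coh_class n p f = in_degree n p (coboundaries n p +>\<^bsub>cochains n p\<^esub> f)"

text \<open>A central element \<open>z\<close> of $A$ corresponds to the class of the 0-cocycle $f : k \to A$ with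
  $f(1) = z$.\<close>

definition central_class :: "nat \<Rightarrow> 'f::field pvec set \<Rightarrow> nat \<Rightarrow> 'f cochain set" where
  "central_class n z = coh_class n 0 (\<lambda>u\<in>W n 0. proj n u \<otimes>\<^bsub>preprojective n\<^esub> z)"

text \<open>$\mathrm{HK}^\bullet(A)$: the direct sum of all degrees, with the cup product as \<open>mult\<close>.\<close>

definition HK :: "nat \<Rightarrow> ('f::field, nat \<Rightarrow> 'f cochain set) module" where
  "HK n =
     \<lparr> carrier = {X. (\<forall>p. X p \<in> carrier (HK_deg n p)) \<and> finite {p. X p \<noteq> \<zero>\<^bsub>HK_deg n p\<^esub>}},
       monoid.mult = (\<lambda>X Y r. \<Oplus>\<^bsub>HK_deg n r\<^esub>p\<in>{..r}. cup n p (r - p) (X p) (Y (r - p))),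
       one = central_class n \<one>\<^bsub>preprojective n\<^esub>,
       zero = (\<lambda>p. \<zero>\<^bsub>HK_deg n p\<^esub>),
       add = (\<lambda>X Y p. X p \<oplus>\<^bsub>HK_deg n p\<^esub> Y p),
       smult = (\<lambda>c X p. c \<odot>\<^bsub>HK_deg n p\<^esub> X p) \<rparr>"

definition homogeneous :: "nat \<Rightarrow> nat \<Rightarrow> (nat \<Rightarrow> 'f::field cochain set) set" where
  "homogeneous n p = in_degree n p ` carrier (HK_deg n p)"


section \<open>The basis elements\<close>

definition a :: "nat \<Rightarrow> nat \<Rightarrow> 'f::field pvec set" where
  "a n i = proj n (arrow_vec (Arr i))"

definition a_star :: "nat \<Rightarrow> nat \<Rightarrow> 'f::field pvec set" where
  "a_star n i = proj n (arrow_vec (Star i))"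

definition z :: "nat \<Rightarrow> nat \<Rightarrow> 'f::field pvec set" where
  "z n l =
     (if l = 0 then \<one>\<^bsub>preprojective n\<^esub>
      else \<Oplus>\<^bsub>preprojective n\<^esub>i\<in>{1..n - 2}.
             (a_star n i \<otimes>\<^bsub>preprojective n\<^esub> a n i) [^]\<^bsub>preprojective n\<^esub> l)"

definition zeta :: "nat \<Rightarrow> nat \<Rightarrow> 'f::field cochain" where
  "zeta n l = (THE f. f \<in> Hom_ke n 1 \<and>
     (\<forall>i<n - 1.
        f (arrow_vec (Arr i)) =
          a n i \<otimes>\<^bsub>preprojective n\<^esub>
          (a_star n i \<otimes>\<^bsub>preprojective n\<^esub> a n i) [^]\<^bsub>preprojective n\<^esub> l \<and>
        f (arrow_vec (Star i)) = \<zero>\<^bsub>preprojective n\<^esub>))"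

definition h :: "nat \<Rightarrow> nat \<Rightarrow> 'f::field cochain" where
  "h n i = (THE f. f \<in> Hom_ke n 2 \<and>
     (\<forall>j<n. f (sigma n j) = (if i = j then proj n (vertex i) else \<zero>\<^bsub>preprojective n\<^esub>)))"

text \<open>Labels for the basis elements, so that the basis is an indexed family.\<close>

datatype label = Z nat | Zeta nat | H nat

definition labels :: "nat \<Rightarrow> nat \<Rightarrow> label set" where
  "labels n m = Z ` {0..m} \<union> Zeta ` {0..n - m - 2} \<union> H ` {0..n - 1}"

fun basis_elt :: "nat \<Rightarrow> label \<Rightarrow> nat \<Rightarrow> 'f::field cochain set" where
  "basis_elt n (Z l) = central_class n (z n l)"
| "basis_elt n (Zeta l) = coh_class n 1 (zeta n l)"
| "basis_elt n (H i) = coh_class n 2 (h n i)"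

definition listed :: "nat \<Rightarrow> nat \<Rightarrow> label \<Rightarrow> label \<Rightarrow> bool" where
  "listed n m x y \<longleftrightarrow>
     x = Z 0 \<or>
     (\<exists>l1 l2. x = Z l1 \<and> y = Z l2 \<and> l1 + l2 \<le> m) \<or>
     (\<exists>l1 l2. x = Z l1 \<and> y = Zeta l2 \<and> l1 + l2 \<le> n - m - 2)"

end

theory Submission
  imports Defs
begin

text \<open>Summing the coefficients of the paths with given source, target and length gives faithful
  coordinates on $A$: modulo the relations, parallel paths of equal length coincide, and a path of
  length $L$ from $i$ to $j$ vanishes unless $L \le \min(i+j,\, 2(n-1)-i-j)$. Multiplication adds
  lengths, so that cochains, the differential and the cup product become explicit formulas in these
  coordinates. Since $n \ge 3$, the intersection $R \otimes V \cap V \otimes R$ is zero, hence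
  $W_p = 0$ for $p \ge 3$. In each degree there are linear functionals that vanish on a cocycle
  exactly when it is a coboundary and that are dual to the given basis; in terms of them the cup
  product is a convolution.\<close>

subsection \<open>The path algebra\<close>

text \<open>The definitions speak of ideals, cosets and unique descriptions, whereas the mathematics
  is bookkeeping of lengths; most of the effort goes into the bridge, namely that the ideal of
  relations is exactly the common kernel of the coefficient sums at admissible triples. The two
  length bounds come from the two ends of the quiver: an interior relation trades a peak of a path
  (up, then down) for a dip (down, then up), and a path dies once a dip below 0 or a peak above n-1
  would be needed. Length also explains the multiplication table. A class of degree 0 or 1 is a
  combination of lengths 2l or 2l+1, and such a length occurs only if it fits at vertex l or at the
  arrows between l and l+1; this is the origin of m and n-m-2. In degree 2 every value of positive
  length is a coboundary, so only length 0 survives. Two classes of degree 1 multiply to length at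
  least 2, and z_l with l > 0 raises the length, so such products vanish in degree 2. Since odd
  times odd is zero, the sign of graded commutativity never matters.\<close>

lemma carrier_path_algebra:
  "x \<in> carrier (path_algebra n) \<longleftrightarrow> finite {p. x p \<noteq> 0} \<and> {p. x p \<noteq> 0} \<subseteq> paths n"
  by (simp add: path_algebra_def)

lemma path_algebra_simps [simp]:
  "x \<oplus>\<^bsub>path_algebra n\<^esub> y = (\<lambda>p. x p + y p)"
  "\<zero>\<^bsub>path_algebra n\<^esub> = (\<lambda>p. 0)"
  "c \<odot>\<^bsub>path_algebra n\<^esub> x = (\<lambda>p. c * x p)"
  by (simp_all add: path_algebra_def)

lemma path_mult_apply:
  "(x \<otimes>\<^bsub>path_algebra n\<^esub> y) (j, xs, i) =
     (\<Sum>k\<le>length xs. \<Sum>v<n. x (j, take k xs, v) * y (v, drop k xs, i))"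
  by (simp add: path_algebra_def)

lemma path_one_apply:
  "\<one>\<^bsub>path_algebra n\<^esub> (j, xs, i) = (if xs = [] \<and> i = j \<and> j < n then 1 else 0)"
  by (simp add: path_algebra_def)

lemma is_path_arrows: "is_path n j xs i \<Longrightarrow> set xs \<subseteq> arrows n \<and> j < n \<and> i < n"
proof (induction xs arbitrary: j)
  case (Cons x xs)
  then have "src x < n" "x \<in> arrows n" "tgt x = j" "set xs \<subseteq> arrows n" "i < n" by auto
  then show ?case by (auto simp: arrows_def)
qed auto

lemma is_path_append:
  "is_path n j (xs @ ys) i \<longleftrightarrow> (\<exists>v. is_path n j xs v \<and> is_path n v ys i)"
  by (induction xs arbitrary: j) (use is_path_arrows in \<open>auto simp: arrows_def\<close>)

lemma carrier_path_algebraD: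
  "x \<in> carrier (path_algebra n) \<Longrightarrow> x (j, xs, i) \<noteq> 0 \<Longrightarrow> is_path n j xs i"
  by (auto simp: carrier_path_algebra paths_def)

lemma path_mult_nonzeroE:
  assumes "(x \<otimes>\<^bsub>path_algebra n\<^esub> y) (j, xs, i) \<noteq> 0"
  obtains k v where "k \<le> length xs" "v < n" "x (j, take k xs, v) \<noteq> 0" "y (v, drop k xs, i) \<noteq> 0"
proof -
  obtain k where k: "k \<le> length xs" "(\<Sum>v<n. x (j, take k xs, v) * y (v, drop k xs, i)) \<noteq> 0"
    using assms unfolding path_mult_apply by (meson atMost_iff sum.neutral)
  then obtain v where "v < n" "x (j, take k xs, v) * y (v, drop k xs, i) \<noteq> 0"
    by (meson lessThan_iff sum.neutral)
  with k show thesis by (intro that) auto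
qed

lemma path_mult_closed:
  assumes x: "x \<in> carrier (path_algebra n)" and y: "y \<in> carrier (path_algebra n)"
  shows "x \<otimes>\<^bsub>path_algebra n\<^esub> y \<in> carrier (path_algebra n)"
proof -
  let ?S = "{p. (x \<otimes>\<^bsub>path_algebra n\<^esub> y) p \<noteq> 0}"
  let ?T = "(\<lambda>((j, xs, v), (w, ys, i)). (j, xs @ ys, i)) ` ({p. x p \<noteq> 0} \<times> {p. y p \<noteq> 0})"
  have sub: "?S \<subseteq> ?T \<inter> paths n"
  proof
    fix p assume p: "p \<in> ?S"
    obtain j xs i where [simp]: "p = (j, xs, i)" by (cases p)
    from p obtain k v where kv: "k \<le> length xs" "v < n" "x (j, take k xs, v) \<noteq> 0" "y (v, drop k xs, i) \<noteq> 0"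
      by (auto elim: path_mult_nonzeroE)
    have "p \<in> ?T"
      by (rule image_eqI[where x = "((j, take k xs, v), (v, drop k xs, i))"]) (use kv in auto)
    moreover have "is_path n j (take k xs @ drop k xs) i"
      unfolding is_path_append using kv carrier_path_algebraD[OF x] carrier_path_algebraD[OF y] by blast
    ultimately show "p \<in> ?T \<inter> paths n" by (simp add: paths_def)
  qed
  have "finite ?T" using x y by (auto simp: carrier_path_algebra)
  with sub show ?thesis by (auto simp: carrier_path_algebra dest: finite_subset)
qed

text \<open>Both sides sum over the ways to cut the word into three pieces. The left side cuts
  inside the first piece, so its double sum runs over a triangle, which is reindexed by the lengths
  of the first two pieces.\<close>

lemma path_mult_assoc:
  "x \<otimes>\<^bsub>path_algebra n\<^esub> y \<otimes>\<^bsub>path_algebra n\<^esub> w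
   = x \<otimes>\<^bsub>path_algebra n\<^esub> (y \<otimes>\<^bsub>path_algebra n\<^esub> w)"
proof (rule ext, clarify)
  fix j xs i
  let ?T = "\<lambda>k k'. \<Sum>v<n. \<Sum>u<n. x (j, take k xs, u) * y (u, take k' (drop k xs), v) * w (v, drop (k + k') xs, i)"
  have "(x \<otimes>\<^bsub>path_algebra n\<^esub> y \<otimes>\<^bsub>path_algebra n\<^esub> w) (j, xs, i) =
    (\<Sum>k\<le>length xs. \<Sum>k'\<le>k. ?T k' (k - k'))"
    unfolding path_mult_apply sum_distrib_right
    by (rule sum.cong[OF refl], subst sum.swap) (auto simp: min_def drop_take intro!: sum.cong)
  also have "\<dots> = (\<Sum>(k, k')\<in>{(k, k'). k + k' \<le> length xs}. ?T k k')"
    by (rule sum.triangle_reindex_eq[symmetric])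
  also have "{(k, k'). k + k' \<le> length xs} = (SIGMA k:{..length xs}. {..length xs - k})" by auto
  also have "(\<Sum>(k, k')\<in>(SIGMA k:{..length xs}. {..length xs - k}). ?T k k')
     = (\<Sum>k\<le>length xs. \<Sum>k'\<le>length xs - k. ?T k k')"
    by (rule sum.Sigma[symmetric]) auto
  also have "\<dots> = (\<Sum>k\<le>length xs. \<Sum>k'\<le>length xs - k. \<Sum>u<n. \<Sum>v<n.
      x (j, take k xs, u) * y (u, take k' (drop k xs), v) * w (v, drop (k + k') xs, i))"
    by (rule sum.cong[OF refl], rule sum.cong[OF refl], rule sum.swap)
  also have "\<dots> = (\<Sum>k\<le>length xs. \<Sum>u<n. \<Sum>k'\<le>length xs - k. \<Sum>v<n.
      x (j, take k xs, u) * y (u, take k' (drop k xs), v) * w (v, drop (k + k') xs, i))"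
    by (rule sum.cong[OF refl], rule sum.swap)
  also have "\<dots> = (x \<otimes>\<^bsub>path_algebra n\<^esub> (y \<otimes>\<^bsub>path_algebra n\<^esub> w)) (j, xs, i)"
    by (auto simp: path_mult_apply sum_distrib_left mult.assoc add.commute intro!: sum.cong)
  finally show "(x \<otimes>\<^bsub>path_algebra n\<^esub> y \<otimes>\<^bsub>path_algebra n\<^esub> w) (j, xs, i) =
     (x \<otimes>\<^bsub>path_algebra n\<^esub> (y \<otimes>\<^bsub>path_algebra n\<^esub> w)) (j, xs, i)" .
qed

lemma sum_delta_mult:
  fixes g :: "nat \<Rightarrow> 'f::semiring_1"
  assumes "i < n"
  shows "(\<Sum>v<n. (if v = i then 1 else 0) * g v) = g i" "(\<Sum>v<n. (if i = v then 1 else 0) * g v) = g i"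
    "(\<Sum>v<n. g v * (if v = i then 1 else 0)) = g i" "(\<Sum>v<n. g v * (if i = v then 1 else 0)) = g i"
  using assms by (simp_all add: if_distrib[of "\<lambda>c. c * _"] if_distrib[of "\<lambda>c. _ * c"] cong: if_cong)

lemma path_one_mult:
  assumes "x \<in> carrier (path_algebra n)"
  shows "\<one>\<^bsub>path_algebra n\<^esub> \<otimes>\<^bsub>path_algebra n\<^esub> x = x"
proof (rule ext, clarify)
  fix j xs i
  have "(\<one>\<^bsub>path_algebra n\<^esub> \<otimes>\<^bsub>path_algebra n\<^esub> x) (j, xs, i) =
     (\<Sum>k\<le>length xs. if k = 0 then (\<Sum>v<n. if v = j then x (j, xs, i) else 0) else 0)"
    unfolding path_mult_apply by (intro sum.cong refl) (auto simp: path_one_apply sum_delta_mult intro!: sum.neutral)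
  also have "\<dots> = x (j, xs, i)"
    using carrier_path_algebraD[OF assms, of j xs i] is_path_arrows[of n j xs i] by (auto simp: sum.delta)
  finally show "(\<one>\<^bsub>path_algebra n\<^esub> \<otimes>\<^bsub>path_algebra n\<^esub> x) (j, xs, i) = x (j, xs, i)" .
qed

lemma path_mult_one:
  assumes "x \<in> carrier (path_algebra n)"
  shows "x \<otimes>\<^bsub>path_algebra n\<^esub> \<one>\<^bsub>path_algebra n\<^esub> = x"
proof (rule ext, clarify)
  fix j xs i
  have "(x \<otimes>\<^bsub>path_algebra n\<^esub> \<one>\<^bsub>path_algebra n\<^esub>) (j, xs, i) =
     (\<Sum>k\<le>length xs. if k = length xs then (\<Sum>v<n. if v = i then x (j, xs, i) else 0) else 0)"
    unfolding path_mult_apply by (intro sum.cong refl) (auto simp: path_one_apply sum_delta_mult intro!: sum.neutral)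
  also have "\<dots> = x (j, xs, i)"
    using carrier_path_algebraD[OF assms, of j xs i] is_path_arrows[of n j xs i] by (auto simp: sum.delta)
  finally show "(x \<otimes>\<^bsub>path_algebra n\<^esub> \<one>\<^bsub>path_algebra n\<^esub>) (j, xs, i) = x (j, xs, i)" .
qed

lemma path_add_closed:
  assumes "x \<in> carrier (path_algebra n)" "y \<in> carrier (path_algebra n)"
  shows "(\<lambda>p. x p + y p) \<in> carrier (path_algebra n)"
proof -
  have "{p. x p + y p \<noteq> 0} \<subseteq> {p. x p \<noteq> 0} \<union> {p. y p \<noteq> 0}" by auto
  then show ?thesis using assms unfolding carrier_path_algebra
    by (meson finite_UnI finite_subset le_sup_iff subset_trans)
qed

lemma path_smult_closed:
  assumes "x \<in> carrier (path_algebra n)"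
  shows "(\<lambda>p. c * x p) \<in> carrier (path_algebra n)"
proof -
  have "{p. c * x p \<noteq> 0} \<subseteq> {p. x p \<noteq> 0}" by auto
  then show ?thesis using assms unfolding carrier_path_algebra
    by (meson finite_subset subset_trans)
qed

lemma path_zero_closed: "(\<lambda>p. 0) \<in> carrier (path_algebra n)"
  by (simp add: carrier_path_algebra)

lemma path_one_closed: "\<one>\<^bsub>path_algebra n\<^esub> \<in> carrier (path_algebra n)"
proof -
  have "{p. \<one>\<^bsub>path_algebra n\<^esub> p \<noteq> (0 :: 'a)} \<subseteq> (\<lambda>i. (i, [], i)) ` {..<n}"
    by (auto simp: path_one_apply split: if_splits)
  moreover have "(\<lambda>i. (i, [], i)) ` {..<n} \<subseteq> paths n" by (auto simp: paths_def)
  ultimately show ?thesis unfolding carrier_path_algebra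
    by (meson finite_imageI finite_lessThan finite_subset subset_trans)
qed

lemma path_ring: "ring (path_algebra n)"
proof (rule ringI)
  show "abelian_group (path_algebra n)"
  proof (rule abelian_groupI)
    fix x assume x: "x \<in> carrier (path_algebra n)"
    show "\<exists>y\<in>carrier (path_algebra n). y \<oplus>\<^bsub>path_algebra n\<^esub> x = \<zero>\<^bsub>path_algebra n\<^esub>"
      using path_smult_closed[OF x, of "-1"] by (intro bexI[of _ "\<lambda>p. (-1) * x p"]) auto
  qed (auto simp: path_add_closed path_zero_closed algebra_simps)
  show "Group.monoid (path_algebra n)"
    by (rule monoidI) (auto simp: path_mult_closed path_one_closed path_mult_assoc path_one_mult path_mult_one)
qed (auto simp: path_mult_apply algebra_simps sum.distrib)

interpretation PA: ring "path_algebra n" for n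
  by (rule path_ring)

lemma path_module: "Module.module class_ring (path_algebra n)"
  by (rule moduleI[OF class_cring.is_cring PA.abelian_group_axioms])
    (simp_all add: path_smult_closed distrib_left distrib_right mult.assoc)

interpretation PAm: Module.module class_ring "path_algebra n" for n
  by (rule path_module)

lemma path_uminus:
  assumes "x \<in> carrier (path_algebra n)"
  shows "\<ominus>\<^bsub>path_algebra n\<^esub> x = (\<lambda>p. - x p)"
proof -
  have "(\<lambda>p. - x p) \<in> carrier (path_algebra n)" using path_smult_closed[OF assms, of "-1"] by simp
  then show ?thesis using PA.minus_equality[of n "\<lambda>p. - x p" x] assms by simp
qed

lemma path_minus:
  "x \<in> carrier (path_algebra n) \<Longrightarrow> y \<in> carrier (path_algebra n) \<Longrightarrow>
   x \<ominus>\<^bsub>path_algebra n\<^esub> y = (\<lambda>p. x p - y p)"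
  by (simp add: a_minus_def path_uminus)

lemma path_finsum_apply:
  "x \<in> A \<rightarrow> carrier (path_algebra n) \<Longrightarrow>
   (\<Oplus>\<^bsub>path_algebra n\<^esub>t\<in>A. x t) p = (\<Sum>t\<in>A. x t p)"
proof (induction A rule: infinite_finite_induct)
  case (insert t A)
  then have "(\<Oplus>\<^bsub>path_algebra n\<^esub>t\<in>insert t A. x t) =
      x t \<oplus>\<^bsub>path_algebra n\<^esub> (\<Oplus>\<^bsub>path_algebra n\<^esub>t\<in>A. x t)"
    by (intro PA.finsum_insert) auto
  moreover have "x \<in> A \<rightarrow> carrier (path_algebra n)" using insert.prems by blast
  ultimately show ?case using insert.IH insert.hyps by simp
qed simp_all

lemma path_vec_closed: "is_path n j xs i \<Longrightarrow> path_vec (j, xs, i) \<in> carrier (path_algebra n)"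
  by (auto simp: carrier_path_algebra path_vec_def paths_def)

lemma path_vec_mult:
  assumes "v < n"
  shows "(path_vec (j, xs, v) :: 'f::field pvec) \<otimes>\<^bsub>path_algebra n\<^esub> path_vec (v, ys, i) = path_vec (j, xs @ ys, i)"
proof (rule ext, clarify)
  fix j' zs i'
  \<comment> \<open>Stated for abstract propositions, so that the equivalence about cutting
    \<open>zs\<close> is the only fact on words that enters.\<close>
  have indicator_mult: "(P \<and> Q \<longleftrightarrow> R \<and> S) \<Longrightarrow>
      (if j' = j \<and> P \<and> v' = v then 1 else 0) * (if v' = v \<and> Q \<and> i' = i then 1 else 0) =
      (if v' = v then if R then if j' = j \<and> S \<and> i' = i then 1 else 0 else 0 else (0::'f))" for P Q R S v'
    by auto
  have "((path_vec (j, xs, v) :: 'f pvec) \<otimes>\<^bsub>path_algebra n\<^esub> path_vec (v, ys, i)) (j', zs, i') =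
     (\<Sum>k\<le>length zs. \<Sum>v'<n. if v' = v then (if k = length xs then path_vec (j, xs @ ys, i) (j', zs, i') else 0) else 0)"
    unfolding path_mult_apply path_vec_def
  proof (intro sum.cong refl)
    fix k v' assume "k \<in> {..length zs}"
    then have "take k zs = xs \<and> drop k zs = ys \<longleftrightarrow> k = length xs \<and> zs = xs @ ys"
      by (metis append_eq_conv_conj append_take_drop_id atMost_iff length_take min.absorb2)
    then show "(if (j', take k zs, v') = (j, xs, v) then 1 else 0) * (if (v', drop k zs, i') = (v, ys, i) then 1 else 0)
      = (if v' = v then if k = length xs then if (j', zs, i') = (j, xs @ ys, i) then 1 else 0 else 0 else (0::'f))"
      unfolding prod.inject by (rule indicator_mult)
  qed
  also have "\<dots> = path_vec (j, xs @ ys, i) (j', zs, i')"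
    using assms by (auto simp: sum.delta path_vec_def)
  finally show "((path_vec (j, xs, v) :: 'f pvec) \<otimes>\<^bsub>path_algebra n\<^esub> path_vec (v, ys, i)) (j', zs, i') =
    path_vec (j, xs @ ys, i) (j', zs, i')" .
qed

subsection \<open>Coefficient sums over paths of a given length\<close>

lemma finite_arrows [simp]: "finite (arrows n)"
proof -
  have "arrows n = Arr ` {i. Suc i < n} \<union> Star ` {i. Suc i < n}" by (auto simp: arrows_def)
  moreover have "finite {i. Suc i < n}" by (rule finite_subset[of _ "{..<n}"]) auto
  ultimately show ?thesis by simp
qed

definition words :: "nat \<Rightarrow> nat \<Rightarrow> arrow list set" where
  "words n L = {xs. length xs = L \<and> set xs \<subseteq> arrows n}"

lemma finite_words [simp]: "finite (words n L)"
  using finite_lists_length_eq[OF finite_arrows[of n], of L] by (simp add: words_def conj_commute)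

lemma words_0 [simp]: "words n 0 = {[]}"
  by (auto simp: words_def)

lemma sum_words_split:
  assumes "k \<le> L"
  shows "(\<Sum>xs\<in>words n L. g (take k xs) (drop k xs)) = (\<Sum>ys\<in>words n k. \<Sum>zs\<in>words n (L - k). g ys zs)"
proof -
  have "(\<Sum>xs\<in>words n L. g (take k xs) (drop k xs)) =
      (\<Sum>(ys, zs)\<in>words n k \<times> words n (L - k). g ys zs)"
    by (rule sum.reindex_bij_witness[where i = "\<lambda>(ys, zs). ys @ zs" and j = "\<lambda>xs. (take k xs, drop k xs)"])
      (use assms in \<open>auto simp: words_def dest: in_set_takeD in_set_dropD\<close>)
  then show ?thesis by (simp add: sum.cartesian_product)
qed

text \<open>The sum runs over all words, not only over paths from \<open>i\<close> to
  \<open>j\<close>; the other words have coefficient 0 in elements of the carrier. The index set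
  thus depends on the length alone, which makes sums easy to swap and to split.\<close>

definition path_coeff :: "nat \<Rightarrow> 'f::field pvec \<Rightarrow> nat \<Rightarrow> nat \<Rightarrow> nat \<Rightarrow> 'f" where
  "path_coeff n x j i L = (\<Sum>xs\<in>words n L. x (j, xs, i))"

lemma path_coeff_add [simp]:
  "path_coeff n (\<lambda>p. x p + y p) j i L = path_coeff n x j i L + path_coeff n y j i L"
  by (simp add: path_coeff_def sum.distrib)

lemma path_coeff_diff [simp]:
  "path_coeff n (\<lambda>p. x p - y p) j i L = path_coeff n x j i L - path_coeff n y j i L"
  by (simp add: path_coeff_def sum_subtractf)

lemma path_coeff_smult [simp]:
  "path_coeff n (\<lambda>p. c * x p) j i L = c * path_coeff n x j i L"
  by (simp add: path_coeff_def sum_distrib_left)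

lemma path_coeff_uminus [simp]: "path_coeff n (\<lambda>p. - x p) j i L = - path_coeff n x j i L"
  by (simp add: path_coeff_def sum_negf)

lemma path_coeff_0 [simp]: "path_coeff n (\<lambda>p. 0) j i L = 0"
  by (simp add: path_coeff_def)

text \<open>Summing over parallel paths of equal length is a homomorphism to matrices with
  polynomial entries, a path of length \<open>L\<close> from \<open>i\<close> to \<open>j\<close>
  going to the \<open>L\<close>-th power of the variable in position \<open>(j, i)\<close>. The sum
  over \<open>v\<close> is the matrix product, the sum over \<open>k\<close> the product of
  polynomials.\<close>

lemma path_coeff_mult:
  "path_coeff n (x \<otimes>\<^bsub>path_algebra n\<^esub> y) j i L =
     (\<Sum>k\<le>L. \<Sum>v<n. path_coeff n x j v k * path_coeff n y v i (L - k))"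
proof -
  have "path_coeff n (x \<otimes>\<^bsub>path_algebra n\<^esub> y) j i L =
     (\<Sum>xs\<in>words n L. \<Sum>k\<le>L. \<Sum>v<n. x (j, take k xs, v) * y (v, drop k xs, i))"
    unfolding path_coeff_def path_mult_apply by (intro sum.cong refl) (auto simp: words_def)
  also have "\<dots> = (\<Sum>k\<le>L. \<Sum>xs\<in>words n L. \<Sum>v<n. x (j, take k xs, v) * y (v, drop k xs, i))"
    by (rule sum.swap)
  also have "\<dots> = (\<Sum>k\<le>L. \<Sum>ys\<in>words n k. \<Sum>zs\<in>words n (L - k). \<Sum>v<n. x (j, ys, v) * y (v, zs, i))"
    by (intro sum.cong refl sum_words_split) auto
  also have "\<dots> = (\<Sum>k\<le>L. \<Sum>v<n. path_coeff n x j v k * path_coeff n y v i (L - k))"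
  proof (intro sum.cong refl)
    fix k
    have "(\<Sum>ys\<in>words n k. \<Sum>zs\<in>words n (L - k). \<Sum>v<n. x (j, ys, v) * y (v, zs, i)) =
        (\<Sum>ys\<in>words n k. \<Sum>v<n. \<Sum>zs\<in>words n (L - k). x (j, ys, v) * y (v, zs, i))"
      by (intro sum.cong refl sum.swap)
    also have "\<dots> = (\<Sum>v<n. \<Sum>ys\<in>words n k. \<Sum>zs\<in>words n (L - k). x (j, ys, v) * y (v, zs, i))"
      by (rule sum.swap)
    finally show "(\<Sum>ys\<in>words n k. \<Sum>zs\<in>words n (L - k). \<Sum>v<n. x (j, ys, v) * y (v, zs, i)) =
        (\<Sum>v<n. path_coeff n x j v k * path_coeff n y v i (L - k))"
      by (simp add: path_coeff_def sum_product)
  qed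
  finally show ?thesis .
qed

lemma path_coeff_path_vec:
  "is_path n j xs i \<Longrightarrow>
   path_coeff n (path_vec (j, xs, i)) j' i' L = (if j' = j \<and> i' = i \<and> L = length xs then 1 else 0)"
  using is_path_arrows[of n j xs i]
  by (auto simp: path_coeff_def path_vec_def words_def intro!: sum.neutral)
    (auto simp: sum.delta' sum.delta finite_words[unfolded words_def])

text \<open>Each arrow moves the vertex by exactly one.\<close>

lemma is_path_length:
  "is_path n j xs i \<Longrightarrow> even (length xs + j + i) \<and> j \<le> i + length xs \<and> i \<le> j + length xs"
proof (induction xs arbitrary: j)
  case (Cons x xs)
  then show ?case by (cases x) fastforce+
qed auto

lemma path_coeff_nonzero:
  assumes "x \<in> carrier (path_algebra n)" "path_coeff n x j i L \<noteq> 0"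
  shows "even (L + j + i) \<and> j \<le> i + L \<and> i \<le> j + L \<and> j < n \<and> i < n"
proof -
  obtain xs where "xs \<in> words n L" "x (j, xs, i) \<noteq> 0"
    using assms(2) unfolding path_coeff_def by (meson sum.neutral)
  with carrier_path_algebraD[OF assms(1)] have "is_path n j xs i" "length xs = L" by (auto simp: words_def)
  with is_path_length is_path_arrows show ?thesis by blast
qed

text \<open>Modulo the relations all paths from \<open>i\<close> to \<open>j\<close> of length \<open>L\<close> coincide, and they are nonzero
  exactly for the following triples.\<close>

definition admissible :: "nat \<Rightarrow> nat \<Rightarrow> nat \<Rightarrow> nat \<Rightarrow> bool" where
  "admissible n j i L \<longleftrightarrow>
     even (L + j + i) \<and> j \<le> i + L \<and> i \<le> j + L \<and> L \<le> i + j \<and> L + i + j \<le> 2 * (n - 1)"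

text \<open>Candidate for a linear description of the ideal of relations; equality is
  \<open>rel_ideal_eq_coeff_kernel\<close>.\<close>

definition coeff_kernel :: "nat \<Rightarrow> 'f::field pvec set" where
  "coeff_kernel n = {x \<in> carrier (path_algebra n). \<forall>j i L. admissible n j i L \<longrightarrow> path_coeff n x j i L = 0}"

text \<open>If the product has an admissible triple and both factors have nonzero coefficient sums
  at the pieces, the triangle inequalities for one piece turn the two length bounds for the whole
  into those for the other piece. So both pieces are admissible, and the factor in the kernel
  contributes 0.\<close>

lemma coeff_kernel_mult:
  assumes x: "x \<in> carrier (path_algebra n)" and y: "y \<in> carrier (path_algebra n)"
    and or: "x \<in> coeff_kernel n \<or> y \<in> coeff_kernel n"
  shows "x \<otimes>\<^bsub>path_algebra n\<^esub> y \<in> coeff_kernel n"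
  unfolding coeff_kernel_def
proof (intro CollectI conjI allI impI path_mult_closed[OF x y])
  fix j i L assume adm: "admissible n j i L"
  show "path_coeff n (x \<otimes>\<^bsub>path_algebra n\<^esub> y) j i L = 0"
    unfolding path_coeff_mult
  proof (intro sum.neutral ballI)
    fix k v assume k: "k \<in> {..L}" and v: "v \<in> {..<n}"
    show "path_coeff n x j v k * path_coeff n y v i (L - k) = 0"
    proof (rule ccontr)
      assume nz: "\<not> ?thesis"
      then have 1: "path_coeff n x j v k \<noteq> 0" and 2: "path_coeff n y v i (L - k) \<noteq> 0" by auto
      note x1 = path_coeff_nonzero[OF x 1] and y2 = path_coeff_nonzero[OF y 2]
      have "admissible n j v k" "admissible n v i (L - k)"
        using x1 y2 adm k unfolding admissible_def by auto
      with 1 2 or show False by (auto simp: coeff_kernel_def)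
    qed
  qed
qed

lemma ideal_coeff_kernel: "ideal (coeff_kernel n :: 'f::field pvec set) (path_algebra n)"
proof (rule idealI)
  show "subgroup (coeff_kernel n :: 'f pvec set) (add_monoid (path_algebra n))"
  proof (rule group.subgroupI[OF PA.a_group])
    show "coeff_kernel n \<noteq> ({} :: 'f pvec set)" using path_zero_closed by (auto simp: coeff_kernel_def)
  next
    fix x :: "'f pvec" assume "x \<in> coeff_kernel n"
    then have x: "x \<in> carrier (path_algebra n)" and c: "\<And>j i L. admissible n j i L \<Longrightarrow> path_coeff n x j i L = 0"
      by (auto simp: coeff_kernel_def)
    have e: "inv\<^bsub>add_monoid (path_algebra n)\<^esub> x = (\<lambda>p. - x p)"
      using path_uminus[OF x] by (simp add: a_inv_def)
    show "inv\<^bsub>add_monoid (path_algebra n)\<^esub> x \<in> coeff_kernel n"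
      unfolding e coeff_kernel_def using path_smult_closed[OF x, of "-1"] c by simp
  qed (auto simp: coeff_kernel_def path_add_closed)
next
  fix x y :: "'f pvec" assume "x \<in> coeff_kernel n" "y \<in> carrier (path_algebra n)"
  moreover from this have "x \<in> carrier (path_algebra n)" by (simp add: coeff_kernel_def)
  ultimately show "y \<otimes>\<^bsub>path_algebra n\<^esub> x \<in> coeff_kernel n" "x \<otimes>\<^bsub>path_algebra n\<^esub> y \<in> coeff_kernel n"
    by (simp_all add: coeff_kernel_mult)
qed (rule path_ring)

subsection \<open>The ideal of relations\<close>

text \<open>The end cases become instances of the interior formula in which the term leaving the
  quiver is dropped.\<close>

lemma sigma_eq:
  assumes "2 \<le> n" "i < n"
  shows "sigma n i = (\<lambda>p. (if 0 < i then path_vec (i, [Arr (i - 1), Star (i - 1)], i) p else 0)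
     - (if i < n - 1 then path_vec (i, [Star i, Arr i], i) p else 0))"
proof -
  have closed: "is_path n i xs i' \<Longrightarrow> path_vec (i, xs, i') \<in> carrier (path_algebra n)" for xs i'
    by (rule path_vec_closed)
  consider "i = 0" | "0 < i" "i = n - 1" | "0 < i" "i < n - 1" using assms by linarith
  then show ?thesis
  proof cases
    case 1
    with assms show ?thesis
      by (simp add: sigma_def arrow_vec_def path_vec_mult path_uminus path_vec_closed arrows_def)
  next
    case 2
    with assms have "Suc (n - 2) = n - 1" "n - Suc 0 - 1 = n - 2" by auto
    with 2 assms show ?thesis
      by (simp add: sigma_def arrow_vec_def path_vec_mult)
  next
    case 3
    with assms have "Suc (i - 1) = i" by simp
    with 3 assms show ?thesis
      by (simp add: sigma_def arrow_vec_def path_vec_mult path_minus path_vec_closed arrows_def)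
  qed
qed

lemma sigma_closed:
  assumes "2 \<le> n" "i < n"
  shows "sigma n i \<in> carrier (path_algebra n)"
proof -
  have u: "(\<lambda>p. if 0 < i then path_vec (i, [Arr (i - 1), Star (i - 1)], i) p else 0) \<in> carrier (path_algebra n)"
    using assms path_zero_closed[of n]
    by (cases "0 < i") (auto intro!: path_vec_closed simp: arrows_def)
  have v: "(\<lambda>p. if i < n - 1 then path_vec (i, [Star i, Arr i], i) p else 0) \<in> carrier (path_algebra n)"
    using assms path_zero_closed[of n]
    by (cases "i < n - 1") (auto intro!: path_vec_closed simp: arrows_def less_diff_conv)
  show ?thesis
    unfolding sigma_eq[OF assms] path_minus[OF u v, symmetric] by (rule PA.minus_closed[OF u v])
qed

lemma relations_eq:
  assumes "2 \<le> n"
  shows "relations n = {\<lambda>p. \<Sum>i<n. c i * sigma n i p | c. True}"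
proof -
  let ?S = "sigma n ` {..<n} :: 'a pvec set"
  \<comment> \<open>The span is taken over a set of vectors; injectivity allows its linear
    combinations to be indexed by vertices.\<close>
  have inj: "inj_on (sigma n :: nat \<Rightarrow> 'a pvec) {..<n}"
  proof (rule inj_onI)
    fix i i' assume "i \<in> {..<n}" "i' \<in> {..<n}" and eq: "(sigma n i :: 'a pvec) = sigma n i'"
    then have i: "i < n" "i' < n" by auto
    show "i = i'"
    \<comment> \<open>Only \<open>sigma n i\<close> contains the dip at \<open>i\<close>; vertex 0
      has no dip, and its peak serves instead.\<close>
    proof (cases "0 < i")
      case True
      show ?thesis
        using fun_cong[OF eq, of "(i, [Arr (i - 1), Star (i - 1)], i)"] i assms True
        by (auto simp: sigma_eq path_vec_def split: if_splits)
    next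
      case False
      then show ?thesis
        using fun_cong[OF eq, of "(i, [Star i, Arr i], i)"] i assms
        by (auto simp: sigma_eq path_vec_def split: if_splits)
    qed
  qed
  have S: "?S \<subseteq> carrier (path_algebra n)" using assms by (auto intro: sigma_closed)
  have lc: "PAm.lincomb n b ?S = (\<lambda>p. \<Sum>i<n. b (sigma n i) * sigma n i p)" for b
  proof -
    have "PAm.lincomb n b ?S p = (\<Sum>v\<in>?S. b v * v p)" for p
      unfolding PAm.lincomb_def
      by (subst path_finsum_apply) (use S in \<open>auto simp: path_smult_closed\<close>)
    then show ?thesis by (simp add: sum.reindex[OF inj] fun_eq_iff)
  qed
  have "relations n = {PAm.lincomb n b ?S | b. b \<in> ?S \<rightarrow> carrier class_ring}"
    unfolding relations_def by (rule PAm.finite_span) (use S in auto)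
  also have "\<dots> = {\<lambda>p. \<Sum>i<n. c i * sigma n i p | c. True}"
    unfolding lc
  proof (intro equalityI subsetI)
    fix x assume "x \<in> {\<lambda>p. \<Sum>i<n. c i * sigma n i p | c. True}"
    then obtain c where c: "x = (\<lambda>p. \<Sum>i<n. c i * sigma n i p)" by blast
    let ?b = "\<lambda>s. c (the_inv_into {..<n} (sigma n :: nat \<Rightarrow> 'a pvec) s)"
    have "x = (\<lambda>p. \<Sum>i<n. ?b (sigma n i) * sigma n i p)"
      unfolding c by (intro ext sum.cong refl) (simp add: the_inv_into_f_f[OF inj])
    then show "x \<in> {\<lambda>p. \<Sum>i<n. b (sigma n i :: 'a pvec) * sigma n i p | b. b \<in> ?S \<rightarrow> carrier class_ring}"
      by (intro CollectI exI conjI) simp_all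
  next
    fix x assume "x \<in> {\<lambda>p. \<Sum>i<n. b (sigma n i :: 'a pvec) * sigma n i p | b. b \<in> ?S \<rightarrow> carrier class_ring}"
    then obtain b where "x = (\<lambda>p. \<Sum>i<n. b (sigma n i :: 'a pvec) * sigma n i p)" by blast
    then show "x \<in> {\<lambda>p. \<Sum>i<n. c i * sigma n i p | c. True}"
      by (intro CollectI exI[of _ "\<lambda>i. b (sigma n i :: 'a pvec)"]) simp
  qed
  finally show ?thesis .
qed

lemma sigma_in_relations:
  assumes "2 \<le> n" "i < n"
  shows "sigma n i \<in> relations n"
proof -
  have "sigma n i = (\<lambda>p. \<Sum>i'<n. (if i' = i then 1 else 0) * sigma n i' p)"
    by (simp add: sum_delta_mult(1)[OF assms(2)])
  then show ?thesis unfolding relations_eq[OF assms(1)] by (intro CollectI exI[of _ "\<lambda>i'. if i' = i then 1 else 0"]) simp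
qed

lemma relations_closed: "2 \<le> n \<Longrightarrow> relations n \<subseteq> carrier (path_algebra n)"
  unfolding relations_def by (rule PAm.span_is_subset2) (auto intro: sigma_closed)

lemma ideal_relations: "2 \<le> n \<Longrightarrow> ideal (Idl\<^bsub>path_algebra n\<^esub> (relations n)) (path_algebra n)"
  by (rule PA.genideal_ideal[OF relations_closed])

lemma path_coeff_sigma:
  assumes "2 \<le> n" "l < n"
  shows "path_coeff n (sigma n l) j i L =
    (if j = l \<and> i = l \<and> L = 2 then (if 0 < l then 1 else 0) - (if l < n - 1 then 1 else 0) else 0)"
  using assms unfolding sigma_eq[OF assms]
  by (auto simp: path_coeff_path_vec arrows_def)

text \<open>At an interior vertex the two terms of the relation cancel in the coefficient sum. At
  either end a single term survives, but there a loop of length 2 is not admissible.\<close>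

lemma relations_subset_kernel:
  assumes "2 \<le> n"
  shows "relations n \<subseteq> coeff_kernel n"
proof
  fix x :: "'f::field pvec" assume x: "x \<in> relations n"
  then obtain c where c: "x = (\<lambda>p. \<Sum>i<n. c i * sigma n i p)" unfolding relations_eq[OF assms] by blast
  have "path_coeff n x j i L = 0" if "admissible n j i L" for j i L
  proof -
    have "path_coeff n x j i L = (\<Sum>xs\<in>words n L. \<Sum>l<n. c l * sigma n l (j, xs, i))"
      by (simp only: c path_coeff_def)
    also have "\<dots> = (\<Sum>l<n. \<Sum>xs\<in>words n L. c l * sigma n l (j, xs, i))"
      by (rule sum.swap)
    also have "\<dots> = (\<Sum>l<n. c l * path_coeff n (sigma n l) j i L)"
      by (simp only: path_coeff_def sum_distrib_left)
    also have "\<dots> = 0"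
    proof (intro sum.neutral ballI)
      fix l assume "l \<in> {..<n}"
      then have l: "l < n" by simp
      have "path_coeff n (sigma n l) j i L = (0 :: 'f)"
      proof (cases "j = l \<and> i = l \<and> L = 2")
        case True
        then have "0 < l" "l < n - 1" using that by (auto simp: admissible_def)
        with True show ?thesis by (simp add: path_coeff_sigma[OF assms l])
      qed (auto simp: path_coeff_sigma[OF assms l])
      then show "c l * path_coeff n (sigma n l) j i L = 0" by simp
    qed
    finally show ?thesis .
  qed
  then show "x \<in> coeff_kernel n" using x relations_closed[OF assms] by (auto simp: coeff_kernel_def)
qed

lemma Idl_subset_kernel: "2 \<le> n \<Longrightarrow> Idl\<^bsub>path_algebra n\<^esub> (relations n) \<subseteq> coeff_kernel n"
  by (rule PA.genideal_minimal[OF ideal_coeff_kernel relations_subset_kernel])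

abbreviation rel_ideal :: "nat \<Rightarrow> 'f::field pvec set" where
  "rel_ideal n \<equiv> Idl\<^bsub>path_algebra n\<^esub> (relations n)"

lemma rel_ideal_closed: "2 \<le> n \<Longrightarrow> x \<in> rel_ideal n \<Longrightarrow> x \<in> carrier (path_algebra n)"
  using ideal.Icarr[OF ideal_relations] by blast

lemma rel_ideal_add: "2 \<le> n \<Longrightarrow> x \<in> rel_ideal n \<Longrightarrow> y \<in> rel_ideal n \<Longrightarrow> (\<lambda>p. x p + y p) \<in> rel_ideal n"
  using additive_subgroup.a_closed[OF ideal.axioms(1)[OF ideal_relations], of n x y] by simp

lemma rel_ideal_mult:
  assumes "2 \<le> n" "x \<in> rel_ideal n" "y \<in> carrier (path_algebra n)"
  shows "x \<otimes>\<^bsub>path_algebra n\<^esub> y \<in> rel_ideal n" "y \<otimes>\<^bsub>path_algebra n\<^esub> x \<in> rel_ideal n"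
  using ideal.I_l_closed[OF ideal_relations] ideal.I_r_closed[OF ideal_relations] assms by blast+

text \<open>\<open>Idl\<close> yields a ring ideal only; its closure under scalars follows because
  scalars act through multiples of the unit.\<close>

lemma smult_one_mult:
  assumes "x \<in> carrier (path_algebra n)"
  shows "(\<lambda>p. c * \<one>\<^bsub>path_algebra n\<^esub> p) \<otimes>\<^bsub>path_algebra n\<^esub> x = (\<lambda>p. c * x p)"
    "x \<otimes>\<^bsub>path_algebra n\<^esub> (\<lambda>p. c * \<one>\<^bsub>path_algebra n\<^esub> p) = (\<lambda>p. c * x p)"
proof -
  have "((\<lambda>p. c * \<one>\<^bsub>path_algebra n\<^esub> p) \<otimes>\<^bsub>path_algebra n\<^esub> x) q =
      c * (\<one>\<^bsub>path_algebra n\<^esub> \<otimes>\<^bsub>path_algebra n\<^esub> x) q"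
    and "(x \<otimes>\<^bsub>path_algebra n\<^esub> (\<lambda>p. c * \<one>\<^bsub>path_algebra n\<^esub> p)) q =
      c * (x \<otimes>\<^bsub>path_algebra n\<^esub> \<one>\<^bsub>path_algebra n\<^esub>) q" for q
    by (cases q; simp add: path_mult_apply sum_distrib_left mult.assoc mult.left_commute)+
  then show "(\<lambda>p. c * \<one>\<^bsub>path_algebra n\<^esub> p) \<otimes>\<^bsub>path_algebra n\<^esub> x = (\<lambda>p. c * x p)"
    "x \<otimes>\<^bsub>path_algebra n\<^esub> (\<lambda>p. c * \<one>\<^bsub>path_algebra n\<^esub> p) = (\<lambda>p. c * x p)"
    using path_one_mult[OF assms] path_mult_one[OF assms] by (auto simp: fun_eq_iff)
qed

lemma rel_ideal_smult:
  assumes "2 \<le> n" "x \<in> rel_ideal n"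
  shows "(\<lambda>p. c * x p) \<in> rel_ideal n"
  using rel_ideal_mult(2)[OF assms path_smult_closed[OF path_one_closed]]
    smult_one_mult(1)[OF rel_ideal_closed[OF assms]] by metis

lemma rel_ideal_diff:
  assumes "2 \<le> n" "x \<in> rel_ideal n" "y \<in> rel_ideal n"
  shows "(\<lambda>p. x p - y p) \<in> rel_ideal n"
  using rel_ideal_add[OF assms(1,2) rel_ideal_smult[OF assms(1,3), of "-1"]] by simp

lemma sigma_in_rel_ideal: "2 \<le> n \<Longrightarrow> i < n \<Longrightarrow> sigma n i \<in> rel_ideal n"
  using PA.genideal_self[OF relations_closed] sigma_in_relations by blast

section \<open>Congruence of paths modulo the relations\<close>

text \<open>The field is passed as a type argument since it does not occur in the paths.\<close>

definition path_cong :: "'f::field itself \<Rightarrow> nat \<Rightarrow> nat \<Rightarrow> arrow list \<Rightarrow> arrow list \<Rightarrow> nat \<Rightarrow> bool" where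
  "path_cong F n j xs ys i \<longleftrightarrow> is_path n j xs i \<and> is_path n j ys i \<and>
     (\<lambda>p. path_vec (j, xs, i) p - path_vec (j, ys, i) p :: 'f) \<in> rel_ideal n"

definition path_null :: "'f::field itself \<Rightarrow> nat \<Rightarrow> nat \<Rightarrow> arrow list \<Rightarrow> nat \<Rightarrow> bool" where
  "path_null F n j xs i \<longleftrightarrow> is_path n j xs i \<and> (path_vec (j, xs, i) :: 'f pvec) \<in> rel_ideal n"

lemma path_cong_refl:
  assumes "2 \<le> n" "is_path n j xs i"
  shows "path_cong F n j xs xs i"
  unfolding path_cong_def using assms(2) additive_subgroup.zero_closed[OF ideal.axioms(1)[OF ideal_relations[OF assms(1)]]]
  by simp

lemma path_cong_sym: "2 \<le> n \<Longrightarrow> path_cong F n j xs ys i \<Longrightarrow> path_cong F n j ys xs i"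
  unfolding path_cong_def using rel_ideal_smult[of n _ "-1"] by fastforce

lemma path_cong_trans:
  "2 \<le> n \<Longrightarrow> path_cong F n j xs ys i \<Longrightarrow> path_cong F n j ys zs i \<Longrightarrow> path_cong F n j xs zs i"
  unfolding path_cong_def using rel_ideal_add by fastforce

lemma path_null_cong:
  "2 \<le> n \<Longrightarrow> path_cong F n j xs ys i \<Longrightarrow> path_null F n j ys i \<Longrightarrow> path_null F n j xs i"
  unfolding path_cong_def path_null_def using rel_ideal_add by fastforce

lemma path_cong_null:
  "2 \<le> n \<Longrightarrow> path_null F n j xs i \<Longrightarrow> path_null F n j ys i \<Longrightarrow> path_cong F n j xs ys i"
  unfolding path_cong_def path_null_def using rel_ideal_diff by blast

lemma path_vec_mult_diff:
  fixes F :: "'f::field itself"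
  assumes "is_path n j xs i" "is_path n j ys i"
  shows "is_path n k zs j \<Longrightarrow>
      path_vec (k, zs, j) \<otimes>\<^bsub>path_algebra n\<^esub> (\<lambda>p. path_vec (j, xs, i) p - path_vec (j, ys, i) p :: 'f)
      = (\<lambda>p. path_vec (k, zs @ xs, i) p - path_vec (k, zs @ ys, i) p)"
    and "is_path n i zs k \<Longrightarrow>
      (\<lambda>p. path_vec (j, xs, i) p - path_vec (j, ys, i) p :: 'f) \<otimes>\<^bsub>path_algebra n\<^esub> path_vec (i, zs, k)
      = (\<lambda>p. path_vec (j, xs @ zs, k) p - path_vec (j, ys @ zs, k) p)"
proof -
  note vecs = path_vec_closed[OF assms(1), where 'a = 'f] path_vec_closed[OF assms(2), where 'a = 'f]
  have ji: "j < n" "i < n" using is_path_arrows[OF assms(1)] by auto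
  note d = path_minus[OF vecs, symmetric]
  {
    assume zs: "is_path n k zs j"
    have "path_vec (k, zs, j) \<otimes>\<^bsub>path_algebra n\<^esub> (path_vec (j, xs, i) \<ominus>\<^bsub>path_algebra n\<^esub> (path_vec (j, ys, i) :: 'f pvec))
      = path_vec (k, zs @ xs, i) \<ominus>\<^bsub>path_algebra n\<^esub> path_vec (k, zs @ ys, i)"
      using ji vecs path_vec_closed[OF zs, where 'a = 'f] unfolding a_minus_def
      by (simp add: PA.r_distr PA.r_minus path_vec_mult del: path_algebra_simps)
    then show "path_vec (k, zs, j) \<otimes>\<^bsub>path_algebra n\<^esub> (\<lambda>p. path_vec (j, xs, i) p - path_vec (j, ys, i) p :: 'f)
      = (\<lambda>p. path_vec (k, zs @ xs, i) p - path_vec (k, zs @ ys, i) p)"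
      unfolding d by (subst (asm) (2) path_minus) (use assms zs in \<open>auto intro!: path_vec_closed simp: is_path_append\<close>)
  next
    assume zs: "is_path n i zs k"
    have "(path_vec (j, xs, i) \<ominus>\<^bsub>path_algebra n\<^esub> (path_vec (j, ys, i) :: 'f pvec)) \<otimes>\<^bsub>path_algebra n\<^esub> path_vec (i, zs, k)
      = path_vec (j, xs @ zs, k) \<ominus>\<^bsub>path_algebra n\<^esub> path_vec (j, ys @ zs, k)"
      using ji vecs path_vec_closed[OF zs, where 'a = 'f] unfolding a_minus_def
      by (simp add: PA.l_distr PA.l_minus path_vec_mult del: path_algebra_simps)
    then show "(\<lambda>p. path_vec (j, xs, i) p - path_vec (j, ys, i) p :: 'f) \<otimes>\<^bsub>path_algebra n\<^esub> path_vec (i, zs, k)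
      = (\<lambda>p. path_vec (j, xs @ zs, k) p - path_vec (j, ys @ zs, k) p)"
      unfolding d by (subst (asm) (2) path_minus) (use assms zs in \<open>auto intro!: path_vec_closed simp: is_path_append\<close>)
  }
qed

lemma path_cong_append:
  assumes "2 \<le> n" "path_cong F n j xs ys i"
  shows "is_path n k zs j \<Longrightarrow> path_cong F n k (zs @ xs) (zs @ ys) i"
    and "is_path n i zs k \<Longrightarrow> path_cong F n j (xs @ zs) (ys @ zs) k"
proof -
  note c = assms(2)[unfolded path_cong_def]
  note xs = conjunct1[OF c] and ys = conjunct1[OF conjunct2[OF c]]
    and d = conjunct2[OF conjunct2[OF c]]
  show "path_cong F n k (zs @ xs) (zs @ ys) i" if zs: "is_path n k zs j"
    using rel_ideal_mult(2)[OF assms(1) d path_vec_closed[OF zs]] xs ys zs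
    unfolding path_vec_mult_diff(1)[OF xs ys zs] path_cong_def is_path_append by blast
  show "path_cong F n j (xs @ zs) (ys @ zs) k" if zs: "is_path n i zs k"
    using rel_ideal_mult(1)[OF assms(1) d path_vec_closed[OF zs]] xs ys zs
    unfolding path_vec_mult_diff(2)[OF xs ys zs] path_cong_def is_path_append by blast
qed

lemma path_null_append:
  fixes F :: "'f::field itself"
  assumes "2 \<le> n" "path_null F n j xs i"
  shows "is_path n k zs j \<Longrightarrow> path_null F n k (zs @ xs) i"
    and "is_path n i zs k \<Longrightarrow> path_null F n j (xs @ zs) k"
proof -
  have xs: "is_path n j xs i" and d: "(path_vec (j, xs, i) :: 'f pvec) \<in> rel_ideal n"
    using assms(2) by (auto simp: path_null_def)
  have ji: "j < n" "i < n" using is_path_arrows[OF xs] by auto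
  show "path_null F n k (zs @ xs) i" if zs: "is_path n k zs j"
    using rel_ideal_mult(2)[OF assms(1) d path_vec_closed[OF zs]] xs zs ji
    unfolding path_null_def is_path_append by (auto simp: path_vec_mult)
  show "path_null F n j (xs @ zs) k" if zs: "is_path n i zs k"
    using rel_ideal_mult(1)[OF assms(1) d path_vec_closed[OF zs]] xs zs ji
    unfolding path_null_def is_path_append by (auto simp: path_vec_mult)
qed

text \<open>The relations read as rewriting rules: at an interior vertex a peak equals a dip, at
  vertex 0 the peak is zero since no dip exists, and at vertex \<open>n - 1\<close> the dip is zero
  since no peak exists.\<close>

lemma sigma_path_cong:
  fixes F :: "'f::field itself"
  shows "Suc (Suc i) < n \<Longrightarrow> path_cong F n (Suc i) [Star (Suc i), Arr (Suc i)] [Arr i, Star i] (Suc i)"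
    and "2 \<le> n \<Longrightarrow> path_null F n 0 [Star 0, Arr 0] 0"
    and "2 \<le> n \<Longrightarrow> path_null F n (n - 1) [Arr (n - 2), Star (n - 2)] (n - 1)"
proof -
  assume i: "Suc (Suc i) < n"
  then have "2 \<le> n" by simp
  from rel_ideal_smult[OF this sigma_in_rel_ideal[OF this Suc_lessD[OF i]], where c = "-1 :: 'f"] i
  show "path_cong F n (Suc i) [Star (Suc i), Arr (Suc i)] [Arr i, Star i] (Suc i)"
    by (auto simp: path_cong_def sigma_eq arrows_def less_diff_conv)
next
  assume n: "2 \<le> n"
  then have "0 < n" by simp
  from rel_ideal_smult[OF n sigma_in_rel_ideal[OF n this], where c = "-1 :: 'f"] n
  show "path_null F n 0 [Star 0, Arr 0] 0"
    by (auto simp: path_null_def sigma_eq arrows_def less_diff_conv)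
next
  assume n: "2 \<le> n"
  then have "n - Suc 0 - Suc 0 = n - 2" "Suc (n - 2) = n - 1" "0 < n - Suc 0" by auto
  with sigma_in_rel_ideal[OF n, of "n - 1", where 'a = 'f] n
  show "path_null F n (n - 1) [Arr (n - 2), Star (n - 2)] (n - 1)"
    by (simp add: path_null_def sigma_eq arrows_def)
qed

text \<open>Normal form of paths modulo the relations: descend from \<open>i\<close> to \<open>v\<close>, then ascend to \<open>j\<close>.\<close>

definition valley :: "nat \<Rightarrow> nat \<Rightarrow> nat \<Rightarrow> arrow list" where
  "valley j v i = map Arr (rev [v..<j]) @ map Star [v..<i]"

lemma valley_up: "v \<le> j \<Longrightarrow> valley (Suc j) v i = Arr j # valley j v i"
  by (simp add: valley_def)

lemma valley_down: "v < i \<Longrightarrow> Star v # valley (Suc v) (Suc v) i = valley v v i"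
  by (simp add: valley_def upt_conv_Cons)

lemma length_valley: "v \<le> j \<Longrightarrow> v \<le> i \<Longrightarrow> length (valley j v i) + 2 * v = i + j"
  by (simp add: valley_def)

lemma is_path_down: "v \<le> i \<Longrightarrow> i < n \<Longrightarrow> is_path n v (map Star [v..<i]) i"
proof (induction "i - v" arbitrary: v)
  case (Suc d)
  then show ?case by (simp add: upt_conv_Cons arrows_def)
qed auto

lemma is_path_valley: "v \<le> j \<Longrightarrow> v \<le> i \<Longrightarrow> j < n \<Longrightarrow> i < n \<Longrightarrow> is_path n j (valley j v i) i"
proof (induction "j - v" arbitrary: j)
  case 0
  then show ?case by (simp add: valley_def is_path_down)
next
  case (Suc d)
  then obtain j' where "j = Suc j'" by (cases j) auto
  with Suc show ?case by (simp add: valley_up arrows_def)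
qed

text \<open>A step down after the ascent creates a peak at its top. The interior relations push this
  peak down along the ascent until it reaches the bottom, where it deepens the valley by one; if the
  bottom is 0, the relation at vertex 0 kills it.\<close>

lemma star_valley:
  assumes "v \<le> j" "Suc j < n" "v \<le> i" "i < n"
  shows "if v = 0 then path_null F n j (Star j # valley (Suc j) v i) i
    else path_cong F n j (Star j # valley (Suc j) v i) (valley j (v - 1) i) i"
  using assms
proof (induction j)
  case 0
  then have n: "2 \<le> n" by simp
  have "path_null F n 0 ([Star 0, Arr 0] @ valley 0 0 i) i"
    by (rule path_null_append(2)[OF n sigma_path_cong(2)[OF n]]) (use 0 in \<open>auto intro: is_path_valley\<close>)
  with 0 show ?case by (simp add: valley_up)
next
  case (Suc j)
  then have n: "2 \<le> n" by simp
  have vp: "is_path n (Suc j) (valley (Suc j) v i) i" using Suc by (auto intro: is_path_valley)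
  have "path_cong F n (Suc j) ([Star (Suc j), Arr (Suc j)] @ valley (Suc j) v i) ([Arr j, Star j] @ valley (Suc j) v i) i"
    by (rule path_cong_append(2)[OF n sigma_path_cong(1) vp]) (use Suc in auto)
  then have step: "path_cong F n (Suc j) (Star (Suc j) # valley (Suc (Suc j)) v i) (Arr j # Star j # valley (Suc j) v i) i"
    using Suc.prems by (simp add: valley_up)
  have arr: "is_path n (Suc j) [Arr j] j" using Suc.prems by (simp add: arrows_def)
  show ?case
  proof (cases "v = Suc j")
    case True
    then have "Arr j # Star j # valley (Suc j) v i = valley (Suc j) (v - 1) i"
      using Suc.prems by (simp add: valley_down valley_up)
    with step True show ?thesis by simp
  next
    case False
    with Suc have IH: "if v = 0 then path_null F n j (Star j # valley (Suc j) v i) i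
      else path_cong F n j (Star j # valley (Suc j) v i) (valley j (v - 1) i) i" by auto
    show ?thesis
    proof (cases "v = 0")
      case True
      with path_null_append(1)[OF n _ arr] IH have "path_null F n (Suc j) (Arr j # Star j # valley (Suc j) v i) i"
        by fastforce
      with True path_null_cong[OF n step] show ?thesis by simp
    next
      case v: False
      with path_cong_append(1)[OF n _ arr] IH
      have "path_cong F n (Suc j) (Arr j # Star j # valley (Suc j) v i) (Arr j # valley j (v - 1) i) i"
        by fastforce
      moreover have "Arr j # valley j (v - 1) i = valley (Suc j) (v - 1) i"
        using Suc.prems False by (simp add: valley_up)
      ultimately show ?thesis using v path_cong_trans[OF n step] by simp
    qed
  qed
qed

text \<open>Induction on the word, adding its final step: a step up prolongs the ascent, a step down
  is absorbed by \<open>star_valley\<close>. The bottom \<open>v\<close> is forced by the length,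
  and the second alternative is the case in which it would be negative.\<close>

lemma path_cong_valley:
  assumes "2 \<le> n" "is_path n j xs i"
  shows "(\<exists>v. v \<le> j \<and> v \<le> i \<and> path_cong F n j xs (valley j v i) i \<and> length xs + 2 * v = i + j) \<or>
    (path_null F n j xs i \<and> i + j < length xs)"
  using assms(2)
proof (induction xs arbitrary: j)
  case Nil
  then show ?case using path_cong_refl[OF assms(1), of i "[]" i F] by (intro disjI1 exI[of _ i]) (auto simp: valley_def)
next
  case (Cons x xs)
  then have x: "x \<in> arrows n" "tgt x = j" and xs: "is_path n (src x) xs i" by auto
  have xp: "is_path n j [x] (src x)" and i: "i < n" and jn: "src x < n"
    using x is_path_arrows[OF xs] is_path_arrows[OF Cons.prems] by auto
  have len: "src x \<le> Suc j" "j \<le> Suc (src x)" using x by (cases x; auto)+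
  from Cons.IH[OF xs] show ?case
  proof (elim disjE exE conjE)
    assume nl: "path_null F n (src x) xs i" "i + src x < length xs"
    then have "path_null F n j (x # xs) i" using path_null_append(1)[OF assms(1) nl(1) xp] by simp
    with nl(2) len show ?thesis by auto
  next
    fix v assume v: "v \<le> src x" "v \<le> i" "path_cong F n (src x) xs (valley (src x) v i) i" "length xs + 2 * v = i + src x"
    then have c: "path_cong F n j (x # xs) (x # valley (src x) v i) i"
      using path_cong_append(1)[OF assms(1) v(3) xp] by simp
    show ?thesis
    proof (cases x)
      case (Arr k)
      with x c v have "path_cong F n j (x # xs) (valley j v i) i" "length (x # xs) + 2 * v = i + j" "v \<le> j"
        by (auto simp: valley_up)
      with v show ?thesis by blast
    next
      case (Star k)
      with x have k[simp]: "k = j" by simp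
      show ?thesis
      \<comment> \<open>Here the bottom is the source of \<open>x\<close>, so there is no ascent yet
        and the step down prolongs the descent.\<close>
      proof (cases "v = Suc j")
        case True
        have "x # valley (src x) v i = valley j j i" using Star v True valley_down[of j i] by simp
        moreover have "length (x # xs) + 2 * j = i + j" using v Star True by simp
        ultimately show ?thesis using c True v by (intro disjI1 exI[of _ j]) auto
      next
        case False
        then have vj: "v \<le> j" using v Star by simp
        have sv: "if v = 0 then path_null F n j (x # valley (src x) v i) i
          else path_cong F n j (x # valley (src x) v i) (valley j (v - 1) i) i"
          using star_valley[OF vj _ v(2) i, of F] jn Star by (cases "v = 0") simp_all
        show ?thesis
        proof (cases "v = 0")
          case True
          then have "path_null F n j (x # xs) i" using sv path_null_cong[OF assms(1) c] by simp
          moreover have "i + j < length (x # xs)" using v True Star by simp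
          ultimately show ?thesis by blast
        next
          case v0: False
          then have "path_cong F n j (x # xs) (valley j (v - 1) i) i" using sv path_cong_trans[OF assms(1) c] by simp
          moreover have "length (x # xs) + 2 * (v - 1) = i + j" using v v0 Star by simp
          ultimately show ?thesis using vj v(2) by (intro disjI1 exI[of _ "v - 1"]) auto
        qed
      qed
    qed
  qed
qed

text \<open>The mirror image of the death at vertex 0; the last hypothesis says that the valley is
  longer than \<open>2 * (n - 1) - i - j\<close>. Reading \<open>star_valley\<close> backwards
  raises both \<open>j\<close> and the bottom by one, which preserves the hypothesis, until
  \<open>j\<close> is the top vertex, where the relation kills a dip.\<close>

lemma valley_null:
  assumes "2 \<le> n" "v \<le> j" "v \<le> i" "j < n" "i < n" "n + v \<le> i + j"
  shows "path_null F n j (valley j v i) i"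
  using assms
proof (induction "n - j" arbitrary: j v rule: less_induct)
  case less
  show ?case
  proof (cases "Suc j < n")
    case True
    have vi: "v < i" "v < j" using less.prems by auto
    have "path_null F n (Suc j) (valley (Suc j) (Suc v) i) i"
      by (rule less.hyps) (use less.prems True vi in auto)
    moreover have st: "is_path n j [Star j] (Suc j)" using True by (simp add: arrows_def)
    ultimately have "path_null F n j (Star j # valley (Suc j) (Suc v) i) i"
      using path_null_append(1)[OF less.prems(1)] by fastforce
    moreover have "path_cong F n j (Star j # valley (Suc j) (Suc v) i) (valley j v i) i"
      using star_valley[of "Suc v" j n i F] vi True less.prems by simp
    ultimately show ?thesis using path_null_cong path_cong_sym less.prems(1) by blast
  next
    case False
    then have j: "j = n - 1" "Suc (n - 2) = j" using less.prems by auto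
    have vi: "v < i" "v < j" using less.prems by auto
    have up: "valley j v i = Arr (n - 2) # valley (n - 2) v i" using valley_up[of v "n - 2" i] j vi by simp
    show ?thesis
    \<comment> \<open>At the top vertex the valley either is the dip itself, or its last step up
      follows a valley that can be rewritten to end with a step down from \<open>n - 1\<close>, so
      that a dip appears.\<close>
    proof (cases "v = n - 2")
      case True
      then have "i = n - 1" using vi less.prems by simp
      with True j have "valley j v i = [Arr (n - 2), Star (n - 2)]" unfolding up by (auto simp: valley_def upt_conv_Cons)
      with sigma_path_cong(3)[OF less.prems(1)] j \<open>i = n - 1\<close> show ?thesis by simp
    next
      case v: False
      have "path_cong F n (n - 2) (Star (n - 2) # valley (Suc (n - 2)) (Suc v) i) (valley (n - 2) v i) i"
        using star_valley[of "Suc v" "n - 2" n i F] vi v less.prems j by simp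
      moreover have ar: "is_path n j [Arr (n - 2)] (n - 2)" using j less.prems by (simp add: arrows_def)
      ultimately have 1: "path_cong F n j (Arr (n - 2) # Star (n - 2) # valley (Suc (n - 2)) (Suc v) i) (valley j v i) i"
        using path_cong_append(1)[OF less.prems(1) _ ar] unfolding up by fastforce
      have "path_null F n j ([Arr (n - 2), Star (n - 2)] @ valley j (Suc v) i) i"
        using path_null_append(2)[OF less.prems(1) sigma_path_cong(3)[OF less.prems(1)]] j
          is_path_valley[of "Suc v" j i n] vi less.prems by simp
      then have "path_null F n j (Arr (n - 2) # Star (n - 2) # valley (Suc (n - 2)) (Suc v) i) i" using j by simp
      with 1 show ?thesis using path_null_cong path_cong_sym less.prems(1) by blast
    qed
  qed
qed

text \<open>A path satisfies the parity and distance conditions anyway, so one of the two upper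
  bounds on the length fails; \<open>path_cong_valley\<close> handles the first and
  \<open>valley_null\<close> the second.\<close>

lemma not_admissible_path_null:
  assumes "2 \<le> n" "is_path n j xs i" "\<not> admissible n j i (length xs)"
  shows "path_null F n j xs i"
  using path_cong_valley[OF assms(1,2), of F]
proof (elim disjE exE conjE)
  fix v assume v: "v \<le> j" "v \<le> i" "path_cong F n j xs (valley j v i) i" "length xs + 2 * v = i + j"
  have "n + v \<le> i + j"
    using assms(3) is_path_length[OF assms(2)] v(4) assms(1) unfolding admissible_def by auto
  then have "path_null F n j (valley j v i) i"
    using valley_null[OF assms(1) v(1,2)] is_path_arrows[OF assms(2)] by blast
  with path_null_cong[OF assms(1) v(3)] show ?thesis .
qed

text \<open>Length and end points determine the bottom of the valley, hence the normal form.\<close>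

lemma parallel_paths_cong:
  assumes "2 \<le> n" "is_path n j xs i" "is_path n j ys i" "length xs = length ys"
  shows "path_cong F n j xs ys i"
proof -
  note xs = path_cong_valley[OF assms(1,2), of F] and ys = path_cong_valley[OF assms(1,3), of F]
  show ?thesis
  proof (cases "i + j < length xs")
    case True
    with xs ys assms(4) show ?thesis by (auto intro: path_cong_null[OF assms(1)])
  next
    case False
    with xs obtain v where v: "path_cong F n j xs (valley j v i) i" "length xs + 2 * v = i + j" by auto
    from False ys assms(4) obtain w where w: "path_cong F n j ys (valley j w i) i" "length ys + 2 * w = i + j" by auto
    from v w assms(4) have "w = v" by simp
    with path_cong_trans[OF assms(1) v(1) path_cong_sym[OF assms(1) w(1)[unfolded \<open>w = v\<close>]]]
    show ?thesis by simp
  qed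
qed

text \<open>For the inclusion from right to left, induction on the size of the support. A path in
  the support with an inadmissible triple lies in the ideal and is subtracted off. If the triple is
  admissible, the vanishing coefficient sum forces a second parallel path of equal length into the
  support, and a multiple of the difference of the two is subtracted.\<close>

lemma rel_ideal_eq_coeff_kernel:
  fixes n :: nat
  assumes n: "2 \<le> n"
  shows "(rel_ideal n :: 'f::field pvec set) = coeff_kernel n"
proof (rule antisym[OF Idl_subset_kernel[OF n]], rule subsetI)
  fix x :: "'f pvec" assume "x \<in> coeff_kernel n"
  then show "x \<in> rel_ideal n"
  proof (induction "card {p. x p \<noteq> 0}" arbitrary: x rule: less_induct)
    case less
    then have x: "x \<in> carrier (path_algebra n)" and fin: "finite {p. x p \<noteq> 0}"
      and ker: "\<And>j i L. admissible n j i L \<Longrightarrow> path_coeff n x j i L = 0"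
      by (auto simp: coeff_kernel_def carrier_path_algebra)
    \<comment> \<open>The induction step: \<open>y\<close> removes \<open>p\<close> from the support
      and is supported inside that of \<open>x\<close>, so nothing new appears.\<close>
    have reduce: "x \<in> rel_ideal n"
      if y: "y \<in> rel_ideal n" and p: "x p \<noteq> 0" "x p = y p" and sub: "\<And>q. y q \<noteq> 0 \<Longrightarrow> x q \<noteq> 0" for y p
    proof -
      let ?d = "\<lambda>q. x q - y q"
      have "{q. ?d q \<noteq> 0} \<subseteq> {q. x q \<noteq> 0} - {p}" using p sub by auto
      then have "card {q. ?d q \<noteq> 0} < card {q. x q \<noteq> 0}"
        using p by (intro psubset_card_mono[OF fin]) auto
      moreover have "?d \<in> coeff_kernel n"
      proof -
        have "(\<lambda>q. (-1) * y q) \<in> coeff_kernel n"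
          using Idl_subset_kernel[OF n] rel_ideal_smult[OF n y, of "-1"] by blast
        from additive_subgroup.a_closed[OF ideal.axioms(1)[OF ideal_coeff_kernel] less.prems this]
        show ?thesis by simp
      qed
      ultimately have "?d \<in> rel_ideal n" by (rule less.hyps)
      from rel_ideal_add[OF n this y] show ?thesis by simp
    qed
    show ?case
    proof (cases "{p. x p \<noteq> 0} = {}")
      case True
      then have "x = (\<lambda>p. 0)" by auto
      then show ?thesis using additive_subgroup.zero_closed[OF ideal.axioms(1)[OF ideal_relations[OF n]]] by simp
    next
      case False
      then obtain j xs i where p: "x (j, xs, i) \<noteq> 0" by auto
      have path: "is_path n j xs i" using carrier_path_algebraD[OF x p] .
      show ?thesis
      proof (cases "admissible n j i (length xs)")
        case False
        then have "(path_vec (j, xs, i) :: 'f pvec) \<in> rel_ideal n"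
          using not_admissible_path_null[OF n path, of "TYPE('f)"] by (simp add: path_null_def)
        from rel_ideal_smult[OF n this, of "x (j, xs, i)"] show ?thesis
          by (rule reduce[of _ "(j, xs, i)"]) (use p in \<open>auto simp: path_vec_def split: if_splits\<close>)
      next
        case True
        have "xs \<in> words n (length xs)" using is_path_arrows[OF path] by (simp add: words_def)
        have "\<exists>ys\<in>words n (length xs). ys \<noteq> xs \<and> x (j, ys, i) \<noteq> 0"
        proof (rule ccontr)
          assume no: "\<not> ?thesis"
          have "path_coeff n x j i (length xs) = (\<Sum>ys\<in>words n (length xs). if ys = xs then x (j, xs, i) else 0)"
            unfolding path_coeff_def by (rule sum.cong) (use no in auto)
          with ker[OF True] p \<open>xs \<in> words n (length xs)\<close> show False by simp
        qed
        then obtain ys where ys: "length ys = length xs" "ys \<noteq> xs" "x (j, ys, i) \<noteq> 0" by (auto simp: words_def)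
        have "(\<lambda>p. path_vec (j, xs, i) p - path_vec (j, ys, i) p :: 'f) \<in> rel_ideal n"
          using parallel_paths_cong[OF n path carrier_path_algebraD[OF x ys(3)], of "TYPE('f)"] ys(1)
          by (simp add: path_cong_def)
        from rel_ideal_smult[OF n this, of "x (j, xs, i)"] show ?thesis
          by (rule reduce[of _ "(j, xs, i)"]) (use p ys in \<open>auto simp: path_vec_def split: if_splits\<close>)
      qed
    qed
  qed
qed

subsection \<open>Quotient modules\<close>

context
  fixes R :: "('r, 'q) ring_scheme" and M :: "('r, 'b) module" and N :: "'b set"
  assumes M: "Module.module R M" and N: "submodule R N M"
begin

interpretation M: Module.module R M by (rule M)

lemma submodule_abelian_subgroup: "abelian_subgroup N M"
proof (rule abelian_subgroupI3)
  show "additive_subgroup N M"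
  proof (rule additive_subgroup.intro, rule group.subgroupI)
    show "group (add_monoid M)" by (rule M.a_group)
    show "N \<subseteq> carrier (add_monoid M)" using submodule.subset[OF N] by simp
    show "N \<noteq> {}" using submodule.zero_closed[OF N] by blast
    fix x assume x: "x \<in> N"
    then have "x \<in> carrier M" using submodule.subset[OF N] by blast
    then have "inv\<^bsub>add_monoid M\<^esub> x = (\<ominus>\<^bsub>R\<^esub> \<one>\<^bsub>R\<^esub>) \<odot>\<^bsub>M\<^esub> x"
      using M.smult_l_minus[of "\<one>\<^bsub>R\<^esub>" x] by (simp add: a_inv_def[symmetric])
    then show "inv\<^bsub>add_monoid M\<^esub> x \<in> N" using submodule.smult_closed[OF N _ x] by simp
  qed (use submodule.m_closed[OF N] in auto)
  show "abelian_group M" by (rule M.abelian_group_axioms)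
qed

interpretation N: abelian_subgroup N M by (rule submodule_abelian_subgroup)

lemma quot_coset_eq_iff:
  assumes "x \<in> carrier M" "y \<in> carrier M"
  shows "N +>\<^bsub>M\<^esub> x = N +>\<^bsub>M\<^esub> y \<longleftrightarrow> x \<ominus>\<^bsub>M\<^esub> y \<in> N"
proof
  assume "N +>\<^bsub>M\<^esub> x = N +>\<^bsub>M\<^esub> y"
  then have "x \<in> N +>\<^bsub>M\<^esub> y" using N.a_rcos_self[OF assms(1)] by simp
  then show "x \<ominus>\<^bsub>M\<^esub> y \<in> N" using N.a_rcos_module_imp[OF assms(2)] by (simp add: a_minus_def)
next
  assume "x \<ominus>\<^bsub>M\<^esub> y \<in> N"
  then have "x \<in> N +>\<^bsub>M\<^esub> y" using N.a_rcos_module_rev[OF assms(2,1)] by (simp add: a_minus_def)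
  then show "N +>\<^bsub>M\<^esub> x = N +>\<^bsub>M\<^esub> y" using M.a_repr_independence[OF _ assms(2) N.a_subgroup] by simp
qed

lemma mem_quot_coset_iff:
  "x \<in> carrier M \<Longrightarrow> y \<in> N +>\<^bsub>M\<^esub> x \<longleftrightarrow> y \<in> carrier M \<and> N +>\<^bsub>M\<^esub> y = N +>\<^bsub>M\<^esub> x"
  using N.a_rcos_self[of y] N.a_elemrcos_carrier[of x y] M.a_repr_independence[OF _ _ N.a_subgroup, of y x] by auto

lemma quot_carrier: "carrier (quot_module M N) = (\<lambda>x. N +>\<^bsub>M\<^esub> x) ` carrier M"
proof -
  have "carrier (quot_module M N) = a_rcosets\<^bsub>M\<^esub> N"
    by (simp add: quot_module_def ring.defs module.defs FactRing_def)
  then show ?thesis unfolding A_RCOSETS_def' by blast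
qed

lemma quot_zero: "\<zero>\<^bsub>quot_module M N\<^esub> = N"
  by (simp add: quot_module_def ring.defs module.defs FactRing_def)

lemma quot_add:
  "x \<in> carrier M \<Longrightarrow> y \<in> carrier M \<Longrightarrow>
   (N +>\<^bsub>M\<^esub> x) \<oplus>\<^bsub>quot_module M N\<^esub> (N +>\<^bsub>M\<^esub> y) = N +>\<^bsub>M\<^esub> (x \<oplus>\<^bsub>M\<^esub> y)"
  by (simp add: quot_module_def ring.defs module.defs FactRing_def N.a_rcos_sum)

text \<open>The scalar action on cosets is a union over all representatives; closure of
  \<open>N\<close> under scalars makes all members of this union the same coset.\<close>

lemma quot_smult:
  assumes c: "c \<in> carrier R" and x: "x \<in> carrier M"
  shows "c \<odot>\<^bsub>quot_module M N\<^esub> (N +>\<^bsub>M\<^esub> x) = N +>\<^bsub>M\<^esub> (c \<odot>\<^bsub>M\<^esub> x)"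
proof -
  have "N +>\<^bsub>M\<^esub> (c \<odot>\<^bsub>M\<^esub> y) = N +>\<^bsub>M\<^esub> (c \<odot>\<^bsub>M\<^esub> x)" if "y \<in> N +>\<^bsub>M\<^esub> x" for y
  proof -
    have y: "y \<in> carrier M" by (rule N.a_elemrcos_carrier[OF x that])
    have d: "y \<ominus>\<^bsub>M\<^esub> x \<in> N" using N.a_rcos_module_imp[OF x that] by (simp add: a_minus_def)
    have "c \<odot>\<^bsub>M\<^esub> y \<ominus>\<^bsub>M\<^esub> c \<odot>\<^bsub>M\<^esub> x = c \<odot>\<^bsub>M\<^esub> (y \<ominus>\<^bsub>M\<^esub> x)"
      using c x y by (simp add: a_minus_def M.smult_r_distr M.smult_r_minus)
    then have "c \<odot>\<^bsub>M\<^esub> y \<ominus>\<^bsub>M\<^esub> c \<odot>\<^bsub>M\<^esub> x \<in> N" using submodule.smult_closed[OF N c d] by simp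
    with quot_coset_eq_iff[OF M.smult_closed[OF c y] M.smult_closed[OF c x]] show ?thesis by blast
  qed
  note const = this
  have "x \<in> N +>\<^bsub>M\<^esub> x" by (rule N.a_rcos_self[OF x])
  then have "(\<Union>y\<in>N +>\<^bsub>M\<^esub> x. N +>\<^bsub>M\<^esub> (c \<odot>\<^bsub>M\<^esub> y)) = N +>\<^bsub>M\<^esub> (c \<odot>\<^bsub>M\<^esub> x)"
    by (rule UN_constant_eq) (use const in blast)
  then show ?thesis by (simp add: quot_module_def ring.defs module.defs)
qed

lemma quot_module_module: "Module.module R (quot_module M N)"
proof (rule moduleI)
  have z: "\<zero>\<^bsub>quot_module M N\<^esub> = N +>\<^bsub>M\<^esub> \<zero>\<^bsub>M\<^esub>"
    unfolding quot_zero by (rule N.a_rcos_const[symmetric]) simp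
  show "cring R" by (rule M.R.is_cring)
  have rep: "\<exists>x\<in>carrier M. X = N +>\<^bsub>M\<^esub> x" if "X \<in> carrier (quot_module M N)" for X
    using that unfolding quot_carrier by blast
  have cl: "x \<in> carrier M \<Longrightarrow> N +>\<^bsub>M\<^esub> x \<in> carrier (quot_module M N)" for x
    unfolding quot_carrier by blast
  show "abelian_group (quot_module M N)"
  proof (rule abelian_groupI)
    fix X assume "X \<in> carrier (quot_module M N)"
    then obtain x where x: "X = N +>\<^bsub>M\<^esub> x" "x \<in> carrier M" using rep by blast
    then show "\<exists>Y\<in>carrier (quot_module M N). Y \<oplus>\<^bsub>quot_module M N\<^esub> X = \<zero>\<^bsub>quot_module M N\<^esub>"
      by (intro bexI[of _ "N +>\<^bsub>M\<^esub> (\<ominus>\<^bsub>M\<^esub> x)"]) (simp_all add: cl quot_add z M.l_neg)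
    show "\<zero>\<^bsub>quot_module M N\<^esub> \<oplus>\<^bsub>quot_module M N\<^esub> X = X" using x by (simp add: z quot_add)
    fix Y assume "Y \<in> carrier (quot_module M N)"
    then obtain y where y: "Y = N +>\<^bsub>M\<^esub> y" "y \<in> carrier M" using rep by blast
    show "X \<oplus>\<^bsub>quot_module M N\<^esub> Y \<in> carrier (quot_module M N)" using x y by (simp add: cl quot_add)
    show "X \<oplus>\<^bsub>quot_module M N\<^esub> Y = Y \<oplus>\<^bsub>quot_module M N\<^esub> X"
      using x y by (simp add: quot_add M.add.m_comm)
    fix V assume "V \<in> carrier (quot_module M N)"
    then obtain v where "V = N +>\<^bsub>M\<^esub> v" "v \<in> carrier M" using rep by blast
    then show "X \<oplus>\<^bsub>quot_module M N\<^esub> Y \<oplus>\<^bsub>quot_module M N\<^esub> V = X \<oplus>\<^bsub>quot_module M N\<^esub> (Y \<oplus>\<^bsub>quot_module M N\<^esub> V)"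
      using x y by (simp add: quot_add M.add.m_assoc)
  qed (simp add: z cl)
  fix c X assume c: "c \<in> carrier R" and "X \<in> carrier (quot_module M N)"
  then obtain x where x: "X = N +>\<^bsub>M\<^esub> x" "x \<in> carrier M" using rep by blast
  show "c \<odot>\<^bsub>quot_module M N\<^esub> X \<in> carrier (quot_module M N)" using x c by (simp add: quot_smult cl)
  show "\<And>d. d \<in> carrier R \<Longrightarrow> (c \<oplus>\<^bsub>R\<^esub> d) \<odot>\<^bsub>quot_module M N\<^esub> X =
      c \<odot>\<^bsub>quot_module M N\<^esub> X \<oplus>\<^bsub>quot_module M N\<^esub> d \<odot>\<^bsub>quot_module M N\<^esub> X"
    and "\<And>d. d \<in> carrier R \<Longrightarrow> (c \<otimes>\<^bsub>R\<^esub> d) \<odot>\<^bsub>quot_module M N\<^esub> X =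
      c \<odot>\<^bsub>quot_module M N\<^esub> (d \<odot>\<^bsub>quot_module M N\<^esub> X)"
    using x c by (simp_all add: quot_smult quot_add M.smult_l_distr M.smult_assoc1)
  fix Y assume "Y \<in> carrier (quot_module M N)"
  then obtain y where "Y = N +>\<^bsub>M\<^esub> y" "y \<in> carrier M" using rep by blast
  then show "c \<odot>\<^bsub>quot_module M N\<^esub> (X \<oplus>\<^bsub>quot_module M N\<^esub> Y) =
      c \<odot>\<^bsub>quot_module M N\<^esub> X \<oplus>\<^bsub>quot_module M N\<^esub> c \<odot>\<^bsub>quot_module M N\<^esub> Y"
    using x c by (simp add: quot_smult quot_add M.smult_r_distr)
next
  fix X assume "X \<in> carrier (quot_module M N)"
  then obtain x where "X = N +>\<^bsub>M\<^esub> x" "x \<in> carrier M" unfolding quot_carrier by blast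
  then show "\<one>\<^bsub>R\<^esub> \<odot>\<^bsub>quot_module M N\<^esub> X = X" by (simp add: quot_smult)
qed

end

subsection \<open>Coordinates on the preprojective algebra\<close>

text \<open>Evaluated on a chosen representative; the choice is harmless at admissible triples by
  \<open>coeff_proj\<close>. At other triples the coefficient sum depends on the representative, and
  the value is set to 0.\<close>

definition coeff :: "nat \<Rightarrow> 'f::field pvec set \<Rightarrow> nat \<Rightarrow> nat \<Rightarrow> nat \<Rightarrow> 'f" where
  "coeff n X j i L = (if admissible n j i L then path_coeff n (SOME x. x \<in> X) j i L else 0)"

text \<open>\<open>F\<close> pins down the field, so that the abbreviations and constants of the
  locale have one fixed type.\<close>

locale preproj =
  fixes n :: nat and F :: "'f::field itself"
  assumes n3: "3 \<le> n"
begin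

abbreviation P :: "('f, 'f pvec) module" where "P \<equiv> path_algebra n"
abbreviation A :: "('f, 'f pvec set) module" where "A \<equiv> preprojective n"

lemma n2: "2 \<le> n"
  using n3 by simp

lemma rel_ideal_submodule: "submodule class_ring (rel_ideal n) P"
proof (rule submodule.intro)
  show "Module.module class_ring P" by (rule path_module)
  show "rel_ideal n \<subseteq> carrier P" using rel_ideal_closed[OF n2] by blast
qed (use rel_ideal_add[OF n2] rel_ideal_smult[OF n2]
    additive_subgroup.zero_closed[OF ideal.axioms(1)[OF ideal_relations[OF n2]]] in auto)

lemmas A_quot = path_module rel_ideal_submodule

lemma carrier_A: "carrier A = proj n ` carrier P"
  unfolding preprojective_def quot_carrier[OF A_quot] proj_def ..

lemma proj_closed: "x \<in> carrier P \<Longrightarrow> proj n x \<in> carrier A"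
  by (simp add: carrier_A)

lemma A_rep: "X \<in> carrier A \<Longrightarrow> \<exists>x\<in>carrier P. X = proj n x"
  unfolding carrier_A by blast

lemma proj_add: "x \<in> carrier P \<Longrightarrow> y \<in> carrier P \<Longrightarrow> proj n x \<oplus>\<^bsub>A\<^esub> proj n y = proj n (x \<oplus>\<^bsub>P\<^esub> y)"
  unfolding preprojective_def proj_def by (rule quot_add[OF A_quot])

lemma proj_smult: "x \<in> carrier P \<Longrightarrow> c \<odot>\<^bsub>A\<^esub> proj n x = proj n (c \<odot>\<^bsub>P\<^esub> x)"
  unfolding preprojective_def proj_def by (rule quot_smult[OF A_quot]) simp_all

lemma proj_mult: "x \<in> carrier P \<Longrightarrow> y \<in> carrier P \<Longrightarrow> proj n x \<otimes>\<^bsub>A\<^esub> proj n y = proj n (x \<otimes>\<^bsub>P\<^esub> y)"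
  using ideal.rcoset_mult_add[OF ideal_relations[OF n2], of x y]
  by (simp add: preprojective_def proj_def quot_module_def ring.defs module.defs FactRing_def)

lemma proj_one: "\<one>\<^bsub>A\<^esub> = proj n \<one>\<^bsub>P\<^esub>"
  by (simp add: preprojective_def proj_def quot_module_def ring.defs module.defs FactRing_def)

lemma proj_eq_iff:
  "x \<in> carrier P \<Longrightarrow> y \<in> carrier P \<Longrightarrow> proj n x = proj n y \<longleftrightarrow> x \<ominus>\<^bsub>P\<^esub> y \<in> rel_ideal n"
  unfolding proj_def by (rule quot_coset_eq_iff[OF A_quot])

lemma A_module: "Module.module class_ring A"
  unfolding preprojective_def by (rule quot_module_module[OF A_quot])

lemma A_ring: "ring A"
proof (rule ringI)
  show "abelian_group A" using A_module by (simp add: Module.module_def)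
  show "Group.monoid A"
  proof (rule monoidI)
    fix X assume "X \<in> carrier A"
    then obtain x where x: "X = proj n x" "x \<in> carrier P" using A_rep by blast
    show "\<one>\<^bsub>A\<^esub> \<otimes>\<^bsub>A\<^esub> X = X" "X \<otimes>\<^bsub>A\<^esub> \<one>\<^bsub>A\<^esub> = X"
      using x path_one_closed path_one_mult path_mult_one by (simp_all add: proj_one proj_mult)
    fix Y assume "Y \<in> carrier A"
    then obtain y where y: "Y = proj n y" "y \<in> carrier P" using A_rep by blast
    show "X \<otimes>\<^bsub>A\<^esub> Y \<in> carrier A" using x y by (simp add: proj_mult proj_closed)
    fix V assume "V \<in> carrier A"
    then obtain v where v: "V = proj n v" "v \<in> carrier P" using A_rep by blast
    show "X \<otimes>\<^bsub>A\<^esub> Y \<otimes>\<^bsub>A\<^esub> V = X \<otimes>\<^bsub>A\<^esub> (Y \<otimes>\<^bsub>A\<^esub> V)"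
      using x y v by (simp add: proj_mult path_mult_assoc)
  qed (simp add: proj_one proj_closed path_one_closed)
next
  fix X Y V assume "X \<in> carrier A" "Y \<in> carrier A" "V \<in> carrier A"
  then obtain x y v where x: "X = proj n x" "x \<in> carrier P" "Y = proj n y" "y \<in> carrier P" "V = proj n v" "v \<in> carrier P"
    using A_rep by metis
  show "(X \<oplus>\<^bsub>A\<^esub> Y) \<otimes>\<^bsub>A\<^esub> V = X \<otimes>\<^bsub>A\<^esub> V \<oplus>\<^bsub>A\<^esub> Y \<otimes>\<^bsub>A\<^esub> V"
    "V \<otimes>\<^bsub>A\<^esub> (X \<oplus>\<^bsub>A\<^esub> Y) = V \<otimes>\<^bsub>A\<^esub> X \<oplus>\<^bsub>A\<^esub> V \<otimes>\<^bsub>A\<^esub> Y"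
    using x by (simp_all add: proj_mult proj_add PA.l_distr PA.r_distr path_mult_closed PA.a_closed del: path_algebra_simps)
qed

sublocale A: ring A by (rule A_ring)
sublocale Am: Module.module class_ring A by (rule A_module)

lemma coeff_not_admissible: "\<not> admissible n j i L \<Longrightarrow> coeff n X j i L = 0"
  by (simp add: coeff_def)

lemma coeff_proj:
  assumes "x \<in> carrier P"
  shows "coeff n (proj n x) j i L = (if admissible n j i L then path_coeff n x j i L else 0)"
proof -
  have "x \<in> proj n x" unfolding proj_def
    by (rule abelian_subgroup.a_rcos_self[OF submodule_abelian_subgroup[OF A_quot] assms])
  then have "(SOME y. y \<in> proj n x) \<in> proj n x" by (rule someI[of "\<lambda>y. y \<in> proj n x"])
  then obtain r where r: "r \<in> rel_ideal n" "(SOME y. y \<in> proj n x) = r \<oplus>\<^bsub>P\<^esub> x"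
    unfolding proj_def a_r_coset_def' by blast
  have "admissible n j i L \<Longrightarrow> path_coeff n r j i L = 0"
    using r(1) rel_ideal_eq_coeff_kernel[OF n2] by (auto simp: coeff_kernel_def)
  with r(2) show ?thesis by (simp add: coeff_def)
qed

text \<open>Equal coordinates put the difference of representatives into
  \<open>coeff_kernel\<close>, which is the ideal of relations.\<close>

lemma coeff_inject:
  assumes "X \<in> carrier A" "Y \<in> carrier A" "\<And>j i L. admissible n j i L \<Longrightarrow> coeff n X j i L = coeff n Y j i L"
  shows "X = Y"
proof -
  from assms(1,2) obtain x y where x: "X = proj n x" "x \<in> carrier P" and y: "Y = proj n y" "y \<in> carrier P"
    using A_rep by metis
  have "x \<ominus>\<^bsub>P\<^esub> y \<in> coeff_kernel n"
    using assms(3) x y PA.minus_closed[OF x(2) y(2)]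
    by (auto simp: coeff_kernel_def path_minus coeff_proj)
  then show ?thesis using x y by (simp add: proj_eq_iff rel_ideal_eq_coeff_kernel[OF n2])
qed

lemma coeff_add:
  assumes "X \<in> carrier A" "Y \<in> carrier A"
  shows "coeff n (X \<oplus>\<^bsub>A\<^esub> Y) j i L = coeff n X j i L + coeff n Y j i L"
proof -
  from assms obtain x y where "X = proj n x" "x \<in> carrier P" "Y = proj n y" "y \<in> carrier P"
    using A_rep by metis
  then show ?thesis by (simp add: proj_add coeff_proj path_add_closed)
qed

lemma coeff_smult:
  assumes "X \<in> carrier A"
  shows "coeff n (c \<odot>\<^bsub>A\<^esub> X) j i L = c * coeff n X j i L"
proof -
  from assms obtain x where "X = proj n x" "x \<in> carrier P" using A_rep by metis
  then show ?thesis by (simp add: proj_smult coeff_proj path_smult_closed)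
qed

lemma coeff_zero: "coeff n \<zero>\<^bsub>A\<^esub> j i L = 0"
  using coeff_smult[of "\<zero>\<^bsub>A\<^esub>" 0 j i L] by simp

lemma coeff_minus:
  assumes "X \<in> carrier A" "Y \<in> carrier A"
  shows "coeff n (X \<ominus>\<^bsub>A\<^esub> Y) j i L = coeff n X j i L - coeff n Y j i L"
proof -
  have "X = (X \<ominus>\<^bsub>A\<^esub> Y) \<oplus>\<^bsub>A\<^esub> Y" using assms by (simp add: a_minus_def A.a_assoc A.l_neg)
  then have "coeff n X j i L = coeff n (X \<ominus>\<^bsub>A\<^esub> Y) j i L + coeff n Y j i L"
    using coeff_add[OF A.minus_closed[OF assms] assms(2)] by simp
  then show ?thesis by simp
qed

lemma coeff_finsum:
  "f \<in> S \<rightarrow> carrier A \<Longrightarrow> coeff n (\<Oplus>\<^bsub>A\<^esub>t\<in>S. f t) j i L = (\<Sum>t\<in>S. coeff n (f t) j i L)"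
proof (induction S rule: infinite_finite_induct)
  case (insert t S)
  then have f: "f t \<in> carrier A" "f \<in> S \<rightarrow> carrier A" by auto
  then have "(\<Oplus>\<^bsub>A\<^esub>t\<in>insert t S. f t) = f t \<oplus>\<^bsub>A\<^esub> (\<Oplus>\<^bsub>A\<^esub>t\<in>S. f t)"
    using insert.hyps by (intro A.finsum_insert)
  with insert f show ?case by (simp add: coeff_add A.finsum_closed)
qed (simp_all add: coeff_zero)

lemma coeff_mult:
  assumes "X \<in> carrier A" "Y \<in> carrier A"
  shows "coeff n (X \<otimes>\<^bsub>A\<^esub> Y) j i L =
    (if admissible n j i L then \<Sum>k\<le>L. \<Sum>v<n. coeff n X j v k * coeff n Y v i (L - k) else 0)"
proof (cases "admissible n j i L")
  case True
  from assms obtain x y where x: "X = proj n x" "x \<in> carrier P" and y: "Y = proj n y" "y \<in> carrier P"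
    using A_rep by metis
  \<comment> \<open>Replacing coefficient sums by truncated coordinates loses nothing: with an
    admissible total, two nonzero factors sit at admissible triples.\<close>
  have "path_coeff n x j v k * path_coeff n y v i (L - k) = coeff n X j v k * coeff n Y v i (L - k)"
    if "k \<le> L" for k v
  proof (cases "path_coeff n x j v k = 0 \<or> path_coeff n y v i (L - k) = 0")
    case False
    then have "path_coeff n x j v k \<noteq> 0" "path_coeff n y v i (L - k) \<noteq> 0" by auto
    note nz = path_coeff_nonzero[OF x(2) this(1)] path_coeff_nonzero[OF y(2) this(2)]
    have "admissible n j v k" "admissible n v i (L - k)"
      using True that nz unfolding admissible_def by auto
    then show ?thesis using x y by (simp add: coeff_proj)
  qed (auto simp: x y coeff_proj)
  then show ?thesis
    using True x y by (simp add: proj_mult coeff_proj path_mult_closed path_coeff_mult)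
qed (simp add: coeff_not_admissible)

lemma coeff_vec:
  "is_path n j xs i \<Longrightarrow> coeff n (proj n (path_vec (j, xs, i) :: 'f pvec)) j' i' L =
    (if j' = j \<and> i' = i \<and> L = length xs \<and> admissible n j i (length xs) then 1 else 0)"
  by (auto simp: coeff_proj path_vec_closed path_coeff_path_vec)

lemma admissible_less: "admissible n j i L \<Longrightarrow> j < n \<and> i < n"
  using n3 unfolding admissible_def by auto

text \<open>A right inverse of the coordinates: each admissible triple is represented by its valley,
  whose bottom is recovered from the length. There are finitely many such triples, so
  \<open>c\<close> may be arbitrary.\<close>

definition of_coeff :: "(nat \<Rightarrow> nat \<Rightarrow> nat \<Rightarrow> 'f) \<Rightarrow> 'f pvec set" where
  "of_coeff c = proj n (\<lambda>(j, xs, i).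
     if admissible n j i (length xs) \<and> xs = valley j ((i + j - length xs) div 2) i then c j i (length xs) else 0)"

lemma of_coeff_closed: "of_coeff c \<in> carrier A"
  and coeff_of_coeff: "coeff n (of_coeff c) j i L = (if admissible n j i L then c j i L else 0)"
proof -
  let ?x = "\<lambda>(j, xs, i).
     if admissible n j i (length xs) \<and> xs = valley j ((i + j - length xs) div 2) i then c j i (length xs) else 0"
  let ?D = "(\<lambda>(j, i, L). (j, valley j ((i + j - L) div 2) i, i)) ` ({..<n} \<times> {..<n} \<times> {..2 * n})"
  \<comment> \<open>Parity makes the division by 2 exact, and the distance conditions place the
    bottom below both end points.\<close>
  have path: "is_path n j (valley j ((i + j - L) div 2) i) i" "length (valley j ((i + j - L) div 2) i) = L"
    if adm: "admissible n j i L" for j i L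
  proof -
    have le: "(i + j - L) div 2 \<le> j" "(i + j - L) div 2 \<le> i" and ev: "even (i + j - L)" and L: "L \<le> i + j"
      using adm unfolding admissible_def by auto
    show "is_path n j (valley j ((i + j - L) div 2) i) i"
      using is_path_valley[OF le] admissible_less[OF adm] by simp
    show "length (valley j ((i + j - L) div 2) i) = L"
      using length_valley[OF le] ev L by simp
  qed
  have x: "?x \<in> carrier P"
    unfolding carrier_path_algebra
  proof
    have "{p. ?x p \<noteq> 0} \<subseteq> ?D"
    proof
      fix p assume p: "p \<in> {p. ?x p \<noteq> 0}"
      obtain j xs i where [simp]: "p = (j, xs, i)" by (cases p)
      from p have adm: "admissible n j i (length xs)" and xs: "xs = valley j ((i + j - length xs) div 2) i"
        by (auto split: if_splits)
      have "length xs \<le> 2 * n" using adm unfolding admissible_def by auto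
      then show "p \<in> ?D" using admissible_less[OF adm] xs by (intro image_eqI[of _ _ "(j, i, length xs)"]) auto
    qed
    then show "finite {p. ?x p \<noteq> 0}" by (rule finite_subset) simp
    show "{p. ?x p \<noteq> 0} \<subseteq> paths n"
    proof
      fix p assume p: "p \<in> {p. ?x p \<noteq> 0}"
      obtain j xs i where [simp]: "p = (j, xs, i)" by (cases p)
      from p have adm: "admissible n j i (length xs)" and xs: "xs = valley j ((i + j - length xs) div 2) i"
        by (auto split: if_splits)
      have "is_path n j xs i" by (subst xs) (rule path(1)[OF adm])
      then show "p \<in> paths n" by (simp add: paths_def)
    qed
  qed
  then show "of_coeff c \<in> carrier A" unfolding of_coeff_def by (rule proj_closed)
  have "path_coeff n ?x j i L = c j i L" if adm: "admissible n j i L"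
  proof -
    let ?v = "valley j ((i + j - L) div 2) i"
    have "path_coeff n ?x j i L = (\<Sum>xs\<in>words n L. if xs = ?v then c j i L else 0)"
      unfolding path_coeff_def by (rule sum.cong) (use adm in \<open>auto simp: words_def\<close>)
    moreover have "?v \<in> words n L" using path[OF adm] is_path_arrows by (auto simp: words_def)
    ultimately show ?thesis by simp
  qed
  then show "coeff n (of_coeff c) j i L = (if admissible n j i L then c j i L else 0)"
    unfolding of_coeff_def by (simp add: coeff_proj[OF x])
qed

end

subsection \<open>The spaces W\<close>

lemma tensor_powerD:
  assumes "x \<in> tensor_power n p"
  shows "x \<in> carrier (path_algebra n)" "x (j, xs, i) \<noteq> 0 \<Longrightarrow> length xs = p"
  using assms by (auto simp: tensor_power_def)

text \<open>Homogeneity of the left factor leaves a single place to cut the word.\<close>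

lemma tensor_power_mult:
  assumes u: "u \<in> tensor_power n p"
  shows "(u \<otimes>\<^bsub>path_algebra n\<^esub> x) (j, xs, i) =
    (if p \<le> length xs then \<Sum>v<n. u (j, take p xs, v) * x (v, drop p xs, i) else 0)"
proof -
  have "(u \<otimes>\<^bsub>path_algebra n\<^esub> x) (j, xs, i) =
    (\<Sum>k\<le>length xs. if k = p then \<Sum>v<n. u (j, take p xs, v) * x (v, drop p xs, i) else 0)"
    unfolding path_mult_apply
  proof (intro sum.cong refl)
    fix k assume k: "k \<in> {..length xs}"
    have "u (j, take k xs, v) = 0" if "k \<noteq> p" for v
      using tensor_powerD(2)[OF u, of j "take k xs" v] k that by auto
    then show "(\<Sum>v<n. u (j, take k xs, v) * x (v, drop k xs, i)) =
        (if k = p then \<Sum>v<n. u (j, take p xs, v) * x (v, drop p xs, i) else 0)" by simp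
  qed
  then show ?thesis by simp
qed

lemma mult_tensor_power:
  assumes v: "v \<in> tensor_power n p"
  shows "(x \<otimes>\<^bsub>path_algebra n\<^esub> v) (j, xs, i) =
    (if p \<le> length xs then \<Sum>u<n. x (j, take (length xs - p) xs, u) * v (u, drop (length xs - p) xs, i) else 0)"
proof -
  have "(x \<otimes>\<^bsub>path_algebra n\<^esub> v) (j, xs, i) =
    (\<Sum>k\<le>length xs. if k = length xs - p \<and> p \<le> length xs then
      \<Sum>u<n. x (j, take (length xs - p) xs, u) * v (u, drop (length xs - p) xs, i) else 0)"
    unfolding path_mult_apply
  proof (intro sum.cong refl)
    fix k assume k: "k \<in> {..length xs}"
    have "v (u, drop k xs, i) = 0" if "\<not> (k = length xs - p \<and> p \<le> length xs)" for u
    proof (rule ccontr)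
      assume "v (u, drop k xs, i) \<noteq> 0"
      from tensor_powerD(2)[OF v this] have "length xs - k = p" by simp
      with k that show False by auto
    qed
    then show "(\<Sum>u<n. x (j, take k xs, u) * v (u, drop k xs, i)) = (if k = length xs - p \<and> p \<le> length xs then
      \<Sum>u<n. x (j, take (length xs - p) xs, u) * v (u, drop (length xs - p) xs, i) else 0)" by auto
  qed
  then show ?thesis by simp
qed

lemma tensor_power_0_apply:
  assumes "u \<in> tensor_power n 0" "u (j, xs, i) \<noteq> 0"
  shows "xs = [] \<and> i = j \<and> j < n"
proof -
  have "xs = []" using tensor_powerD(2)[OF assms] by simp
  with carrier_path_algebraD[OF tensor_powerD(1)[OF assms(1)] assms(2)] show ?thesis by simp
qed

lemma tensor_power_0_mult:
  assumes u: "u \<in> tensor_power n 0" and x: "x \<in> carrier (path_algebra n)"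
  shows "(u \<otimes>\<^bsub>path_algebra n\<^esub> x) (j, xs, i) = u (j, [], j) * x (j, xs, i)"
proof -
  have "(u \<otimes>\<^bsub>path_algebra n\<^esub> x) (j, xs, i) = (\<Sum>v<n. if v = j then u (j, [], j) * x (j, xs, i) else 0)"
  proof -
    have "u (j, [], v) = 0" if "v \<noteq> j" for v using tensor_power_0_apply[OF u, of j "[]" v] that by auto
    then have eq: "u (j, [], v) * x (v, xs, i) = (if v = j then u (j, [], j) * x (j, xs, i) else 0)" for v by simp
    show ?thesis unfolding tensor_power_mult[OF u] by (simp only: le0 if_True take_0 drop_0) (rule sum.cong[OF refl eq])
  qed
  also have "\<dots> = u (j, [], j) * x (j, xs, i)"
    using tensor_power_0_apply[OF u, of j "[]" j] by auto
  finally show ?thesis .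
qed

lemma mult_tensor_power_0:
  assumes u: "u \<in> tensor_power n 0" and x: "x \<in> carrier (path_algebra n)"
  shows "(x \<otimes>\<^bsub>path_algebra n\<^esub> u) (j, xs, i) = x (j, xs, i) * u (i, [], i)"
proof -
  have "(x \<otimes>\<^bsub>path_algebra n\<^esub> u) (j, xs, i) = (\<Sum>v<n. if v = i then x (j, xs, i) * u (i, [], i) else 0)"
  proof -
    have "u (v, [], i) = 0" if "v \<noteq> i" for v using tensor_power_0_apply[OF u, of v "[]" i] that by auto
    then have eq: "x (j, xs, v) * u (v, [], i) = (if v = i then x (j, xs, i) * u (i, [], i) else 0)" for v by simp
    show ?thesis unfolding mult_tensor_power[OF u]
      by (simp only: le0 if_True diff_zero take_all drop_all order.refl) (rule sum.cong[OF refl eq])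
  qed
  also have "\<dots> = x (j, xs, i) * u (i, [], i)"
    using tensor_power_0_apply[OF u, of i "[]" i] by auto
  finally show ?thesis .
qed

lemma tensor_power_submodule: "submodule class_ring (tensor_power n p :: 'f::field pvec set) (path_algebra n)"
proof (rule submodule.intro[OF path_module])
  fix x y :: "'f pvec" assume x: "x \<in> tensor_power n p" and y: "y \<in> tensor_power n p"
  have "length xs = p" if "x (j, xs, i) + y (j, xs, i) \<noteq> 0" for j xs i
  proof -
    have "x (j, xs, i) \<noteq> 0 \<or> y (j, xs, i) \<noteq> 0" using that by auto
    then show ?thesis using tensor_powerD(2)[OF x] tensor_powerD(2)[OF y] by blast
  qed
  then show "x \<oplus>\<^bsub>path_algebra n\<^esub> y \<in> tensor_power n p"
    using path_add_closed[OF tensor_powerD(1)[OF x] tensor_powerD(1)[OF y]]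
    unfolding tensor_power_def path_algebra_simps by blast
qed (auto simp: tensor_power_def path_zero_closed path_smult_closed)

lemma one_tensor_power: "\<one>\<^bsub>path_algebra n\<^esub> \<in> tensor_power n 0"
  by (auto simp: tensor_power_def path_one_closed path_one_apply split: if_splits)

lemma tensor_subset:
  assumes "submodule class_ring S (path_algebra n)"
    and "\<And>x y. x \<in> X \<Longrightarrow> y \<in> Y \<Longrightarrow> x \<otimes>\<^bsub>path_algebra n\<^esub> y \<in> S"
  shows "tensor n X Y \<subseteq> S"
  unfolding tensor_def by (rule PAm.span_is_subset[OF _ assms(1)]) (use assms(2) in auto)

lemma tensor_generators_closed:
  assumes "X \<subseteq> carrier (path_algebra n)" "Y \<subseteq> carrier (path_algebra n)"
  shows "{x \<otimes>\<^bsub>path_algebra n\<^esub> y | x y. x \<in> X \<and> y \<in> Y} \<subseteq> carrier (path_algebra n)"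
proof
  fix w assume "w \<in> {x \<otimes>\<^bsub>path_algebra n\<^esub> y | x y. x \<in> X \<and> y \<in> Y}"
  then obtain x y where "w = x \<otimes>\<^bsub>path_algebra n\<^esub> y" "x \<in> X" "y \<in> Y" by blast
  with assms show "w \<in> carrier (path_algebra n)" using path_mult_closed by blast
qed

lemma tensor_closed:
  assumes "X \<subseteq> carrier (path_algebra n)" "Y \<subseteq> carrier (path_algebra n)"
  shows "tensor n X Y \<subseteq> carrier (path_algebra n)"
  unfolding tensor_def by (rule PAm.span_is_subset2[OF tensor_generators_closed[OF assms]])

lemma tensor_submodule:
  assumes "X \<subseteq> carrier (path_algebra n)" "Y \<subseteq> carrier (path_algebra n)"
  shows "submodule class_ring (tensor n X Y) (path_algebra n)"
  unfolding tensor_def by (rule PAm.span_is_submodule[OF tensor_generators_closed[OF assms]])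

lemma tensorI:
  assumes "X \<subseteq> carrier (path_algebra n)" "Y \<subseteq> carrier (path_algebra n)" "x \<in> X" "y \<in> Y"
  shows "x \<otimes>\<^bsub>path_algebra n\<^esub> y \<in> tensor n X Y"
  using PAm.in_own_span[OF tensor_generators_closed[OF assms(1,2)]] assms(3,4) unfolding tensor_def by blast

context preproj begin

section \<open>The space of relations and the vanishing of W_p for p at least 3\<close>

lemma sigma_apply:
  "l < n \<Longrightarrow> (sigma n l (j, xs, i) :: 'f) =
    (if j = l \<and> i = l then (if 0 < l \<and> xs = [Arr (l - 1), Star (l - 1)] then 1 else 0)
       - (if l < n - 1 \<and> xs = [Star l, Arr l] then 1 else 0) else 0)"
  using n2 by (simp add: sigma_eq path_vec_def)

lemma relations_apply:
  "(\<Sum>l<n. c l * sigma n l (j, xs, i) :: 'f) = (if j < n then c j * sigma n j (j, xs, i) else 0)"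
proof -
  have "(\<Sum>l<n. c l * sigma n l (j, xs, i) :: 'f) = (\<Sum>l<n. if l = j then c j * sigma n j (j, xs, i) else 0)"
    by (intro sum.cong refl) (auto simp: sigma_apply)
  then show ?thesis by simp
qed

lemma relations_submodule: "submodule class_ring (relations n) P"
  unfolding relations_def by (rule PAm.span_is_submodule) (use n2 sigma_closed in auto)

lemma relationsE:
  assumes "(r :: 'f pvec) \<in> relations n"
  obtains c where "\<And>j xs i. r (j, xs, i) = (if j < n then c j * sigma n j (j, xs, i) else 0)"
proof -
  obtain c where c: "r = (\<lambda>p. \<Sum>l<n. c l * sigma n l p)"
    using assms unfolding relations_eq[OF n2] by blast
  have "r (j, xs, i) = (if j < n then c j * sigma n j (j, xs, i) else 0)" for j xs i
    unfolding c by (rule relations_apply)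
  then show thesis by (rule that)
qed

lemma relationsI:
  assumes "\<And>j xs i. r (j, xs, i) = (if j < n then c j * sigma n j (j, xs, i) else 0)"
  shows "(r :: 'f pvec) \<in> relations n"
proof -
  have "r = (\<lambda>p. \<Sum>l<n. c l * sigma n l p)"
    by (rule ext, clarify) (unfold assms relations_apply, rule refl)
  then show ?thesis unfolding relations_eq[OF n2] by blast
qed

lemma relations_nonzero:
  assumes "(r :: 'f pvec) \<in> relations n" "r (j, xs, i) \<noteq> 0"
  shows "i = j \<and> j < n \<and> (0 < j \<and> xs = [Arr (j - 1), Star (j - 1)] \<or> j < n - 1 \<and> xs = [Star j, Arr j])"
proof -
  obtain c where c: "\<And>j xs i. r (j, xs, i) = (if j < n then c j * sigma n j (j, xs, i) else 0)"
    using relationsE[OF assms(1)] by blast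
  with assms(2) have "j < n" "sigma n j (j, xs, i) \<noteq> (0 :: 'f)" by (auto split: if_splits)
  then show ?thesis by (auto simp: sigma_apply split: if_splits)
qed

text \<open>At \<open>j = Suc k\<close> the two words are the two terms of one generator; at every
  other \<open>j\<close> both sides vanish.\<close>

lemma relations_opposite:
  assumes "(r :: 'f pvec) \<in> relations n" "Suc (Suc k) < n"
  shows "r (j, [Star (Suc k), Arr (Suc k)], i) = - r (j, [Arr k, Star k], i)"
proof -
  obtain c where c: "\<And>j xs i. r (j, xs, i) = (if j < n then c j * sigma n j (j, xs, i) else 0)"
    using relationsE[OF assms(1)] by blast
  show ?thesis unfolding c using assms(2) by (auto simp: sigma_apply)
qed

lemma relations_bimodule:
  assumes "r \<in> relations n" "u \<in> tensor_power n 0" "v \<in> tensor_power n 0"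
  shows "u \<otimes>\<^bsub>P\<^esub> r \<in> relations n" "r \<otimes>\<^bsub>P\<^esub> v \<in> relations n"
proof -
  obtain c where c: "\<And>j xs i. r (j, xs, i) = (if j < n then c j * sigma n j (j, xs, i) else 0)"
    using relationsE[OF assms(1)] by blast
  have r: "r \<in> carrier P" using relations_closed[OF n2] assms(1) by blast
  show "u \<otimes>\<^bsub>P\<^esub> r \<in> relations n"
    by (rule relationsI[of _ "\<lambda>j. u (j, [], j) * c j"])
      (simp add: tensor_power_0_mult[OF assms(2) r] c mult.assoc)
  show "r \<otimes>\<^bsub>P\<^esub> v \<in> relations n"
    by (rule relationsI[of _ "\<lambda>j. c j * v (j, [], j)"])
      (auto simp: mult_tensor_power_0[OF assms(3) r] c sigma_apply)
qed

lemma W_0: "W n 0 = tensor_power n 0" and W_1: "W n (Suc 0) = tensor_power n (Suc 0)"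
  by (simp_all add: W_def)

text \<open>The intersection has the single member with \<open>i = j = 0\<close>, and tensoring with
  \<open>k\<close> on either side changes nothing because the relations form a
  \<open>k\<close>-bimodule.\<close>

lemma W_2: "(W n 2 :: 'f pvec set) = relations n"
proof -
  have "{tensor n (tensor_power n i) (tensor n (relations n) (tensor_power n j)) | i j. i + 2 + j = 2} =
     {tensor n (tensor_power n 0) (tensor n (relations n) (tensor_power n 0)) :: 'f pvec set}"
    by auto
  then have W: "(W n 2 :: 'f pvec set) = tensor n (tensor_power n 0) (tensor n (relations n) (tensor_power n 0))"
    unfolding W_def by simp
  have inner: "tensor n (relations n) (tensor_power n 0) \<subseteq> (relations n :: 'f pvec set)"
    by (rule tensor_subset[OF relations_submodule]) (auto intro: relations_bimodule one_tensor_power)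
  have T0: "tensor_power n 0 \<subseteq> carrier P" using tensor_powerD(1) by blast
  show ?thesis unfolding W
  proof (rule antisym)
    show "tensor n (tensor_power n 0) (tensor n (relations n) (tensor_power n 0)) \<subseteq> (relations n :: 'f pvec set)"
      by (rule tensor_subset[OF relations_submodule]) (use inner in \<open>auto intro: relations_bimodule one_tensor_power\<close>)
    show "(relations n :: 'f pvec set) \<subseteq> tensor n (tensor_power n 0) (tensor n (relations n) (tensor_power n 0))"
    proof
      fix r :: "'f pvec" assume r: "r \<in> relations n"
      then have rc: "r \<in> carrier P" using relations_closed[OF n2] by blast
      have 1: "r \<otimes>\<^bsub>P\<^esub> \<one>\<^bsub>P\<^esub> \<in> tensor n (relations n) (tensor_power n 0)"
        by (rule tensorI[OF relations_closed[OF n2] T0 r one_tensor_power])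
      have "\<one>\<^bsub>P\<^esub> \<otimes>\<^bsub>P\<^esub> (r \<otimes>\<^bsub>P\<^esub> \<one>\<^bsub>P\<^esub>) \<in> tensor n (tensor_power n 0) (tensor n (relations n) (tensor_power n 0))"
        by (rule tensorI[OF T0 tensor_closed[OF relations_closed[OF n2] T0] one_tensor_power 1])
      then show "r \<in> tensor n (tensor_power n 0) (tensor n (relations n) (tensor_power n 0))"
        using rc by (simp add: path_one_mult path_mult_one)
    qed
  qed
qed

text \<open>Coefficient form of membership in \<open>V\<^bsup>\<otimes>i\<^esup> \<otimes> R \<otimes> V\<^bsup>\<otimes>j\<^esup>\<close>: letters \<open>i + 1\<close> and \<open>i + 2\<close> of every path
  that occurs form a term of a relation, and the two terms of a relation occur with opposite coefficients.\<close>

definition rel_at :: "nat \<Rightarrow> 'f pvec set" where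
  "rel_at i = {x \<in> carrier P. \<forall>j l.
     (\<forall>xs. length xs < i + 2 \<longrightarrow> x (j, xs, l) = 0) \<and>
     (\<forall>us b d vs. length us = i \<longrightarrow> x (j, us @ b # d # vs, l) \<noteq> 0 \<longrightarrow>
        (\<exists>k. Suc k < n \<and> (b = Arr k \<and> d = Star k \<or> b = Star k \<and> d = Arr k))) \<and>
     (\<forall>us k vs. length us = i \<longrightarrow> Suc (Suc k) < n \<longrightarrow>
        x (j, us @ Star (Suc k) # Arr (Suc k) # vs, l) = - x (j, us @ Arr k # Star k # vs, l))}"

lemma rel_at_closed: "x \<in> rel_at i \<Longrightarrow> x \<in> carrier P"
  by (simp add: rel_at_def)

lemma rel_at_short: "x \<in> rel_at i \<Longrightarrow> length xs < i + 2 \<Longrightarrow> x (j, xs, l) = 0"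
  by (simp add: rel_at_def)

lemma rel_at_letters:
  "x \<in> rel_at (length us) \<Longrightarrow> x (j, us @ b # d # vs, l) \<noteq> 0 \<Longrightarrow>
   \<exists>k. Suc k < n \<and> (b = Arr k \<and> d = Star k \<or> b = Star k \<and> d = Arr k)"
  unfolding rel_at_def by blast

lemma rel_at_opposite:
  "x \<in> rel_at (length us) \<Longrightarrow> Suc (Suc k) < n \<Longrightarrow>
   x (j, us @ Star (Suc k) # Arr (Suc k) # vs, l) = - x (j, us @ Arr k # Star k # vs, l)"
  unfolding rel_at_def by blast

lemma rel_atI:
  assumes "x \<in> carrier P" "\<And>j xs l. length xs < i + 2 \<Longrightarrow> x (j, xs, l) = 0"
    and "\<And>j us b d vs l. length us = i \<Longrightarrow> x (j, us @ b # d # vs, l) \<noteq> 0 \<Longrightarrow>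
      \<exists>k. Suc k < n \<and> (b = Arr k \<and> d = Star k \<or> b = Star k \<and> d = Arr k)"
    and "\<And>j us k vs l. length us = i \<Longrightarrow> Suc (Suc k) < n \<Longrightarrow>
      x (j, us @ Star (Suc k) # Arr (Suc k) # vs, l) = - x (j, us @ Arr k # Star k # vs, l)"
  shows "x \<in> rel_at i"
  unfolding rel_at_def using assms by blast

lemma rel_at_submodule: "submodule class_ring (rel_at i) P"
proof (rule submodule.intro[OF path_module])
  fix x y assume x: "x \<in> rel_at i" and y: "y \<in> rel_at i"
  show "x \<oplus>\<^bsub>P\<^esub> y \<in> rel_at i"
  proof (rule rel_atI)
    show "x \<oplus>\<^bsub>P\<^esub> y \<in> carrier P" using rel_at_closed[OF x] rel_at_closed[OF y] by (simp add: path_add_closed)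
    show "length xs < i + 2 \<Longrightarrow> (x \<oplus>\<^bsub>P\<^esub> y) (j, xs, l) = 0" for j xs l
      using rel_at_short[OF x] rel_at_short[OF y] by simp
    fix j l and us vs :: "arrow list" assume us: "length us = i"
    show "(x \<oplus>\<^bsub>P\<^esub> y) (j, us @ Star (Suc k) # Arr (Suc k) # vs, l) = - (x \<oplus>\<^bsub>P\<^esub> y) (j, us @ Arr k # Star k # vs, l)"
      if "Suc (Suc k) < n" for k
      using rel_at_opposite[of x us k j vs l] rel_at_opposite[of y us k j vs l] x y us that by simp
    fix b d assume "(x \<oplus>\<^bsub>P\<^esub> y) (j, us @ b # d # vs, l) \<noteq> 0"
    then consider "x (j, us @ b # d # vs, l) \<noteq> 0" | "y (j, us @ b # d # vs, l) \<noteq> 0" by force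
    then show "\<exists>k. Suc k < n \<and> (b = Arr k \<and> d = Star k \<or> b = Star k \<and> d = Arr k)"
      by cases (use rel_at_letters x y us in blast)+
  qed
next
  fix c x assume x: "x \<in> rel_at i"
  show "c \<odot>\<^bsub>P\<^esub> x \<in> rel_at i"
  proof (rule rel_atI)
    show "c \<odot>\<^bsub>P\<^esub> x \<in> carrier P" using rel_at_closed[OF x] by (simp add: path_smult_closed)
    show "length xs < i + 2 \<Longrightarrow> (c \<odot>\<^bsub>P\<^esub> x) (j, xs, l) = 0" for j xs l
      using rel_at_short[OF x] by simp
    fix j l and us vs :: "arrow list" assume us: "length us = i"
    show "(c \<odot>\<^bsub>P\<^esub> x) (j, us @ Star (Suc k) # Arr (Suc k) # vs, l) = - (c \<odot>\<^bsub>P\<^esub> x) (j, us @ Arr k # Star k # vs, l)"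
      if "Suc (Suc k) < n" for k
      using rel_at_opposite[of x us k j vs l] x us that by simp
    fix b d assume "(c \<odot>\<^bsub>P\<^esub> x) (j, us @ b # d # vs, l) \<noteq> 0"
    then have "x (j, us @ b # d # vs, l) \<noteq> 0" by simp
    then show "\<exists>k. Suc k < n \<and> (b = Arr k \<and> d = Star k \<or> b = Star k \<and> d = Arr k)"
      using rel_at_letters x us by blast
  qed
next
  show "rel_at i \<subseteq> carrier P" using rel_at_closed by blast
  show "\<zero>\<^bsub>P\<^esub> \<in> rel_at i" by (rule rel_atI) (simp_all add: path_zero_closed)
qed

lemma relations_mult_rel_at:
  assumes r: "r \<in> relations n" and v: "v \<in> carrier P"
  shows "r \<otimes>\<^bsub>P\<^esub> v \<in> rel_at 0"
proof -
  have rc: "r \<in> carrier P" using r relations_closed[OF n2] by blast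
  have "length xs = 2" if "r (j, xs, i) \<noteq> 0" for j xs i
    using relations_nonzero[OF r that] by auto
  then have r2: "r \<in> tensor_power n 2" using rc by (auto simp: tensor_power_def)
  note eq = tensor_power_mult[OF r2, of v]
  show ?thesis
  proof (rule rel_atI)
    show "r \<otimes>\<^bsub>P\<^esub> v \<in> carrier P" by (rule path_mult_closed[OF rc v])
  next
    fix j l and us vs :: "arrow list" and b d
    assume us: "length us = 0" and nz: "(r \<otimes>\<^bsub>P\<^esub> v) (j, us @ b # d # vs, l) \<noteq> 0"
    have "(\<Sum>w<n. r (j, [b, d], w) * v (w, vs, l)) \<noteq> 0" using nz us unfolding eq by (simp split: if_splits)
    then obtain w where "r (j, [b, d], w) * v (w, vs, l) \<noteq> 0" by (rule sum.not_neutral_contains_not_neutral)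
    then have "r (j, [b, d], w) \<noteq> 0" by simp
    from relations_nonzero[OF r this]
    show "\<exists>k. Suc k < n \<and> (b = Arr k \<and> d = Star k \<or> b = Star k \<and> d = Arr k)"
    proof (elim conjE disjE)
      assume "0 < j" "[b, d] = [Arr (j - 1), Star (j - 1)]" "j < n"
      then show ?thesis by (intro exI[of _ "j - 1"]) auto
    next
      assume "j < n - 1" "[b, d] = [Star j, Arr j]"
      then show ?thesis by (intro exI[of _ j]) auto
    qed
  next
    fix j l and us vs :: "arrow list" and k assume "length us = 0" "Suc (Suc k) < n"
    then show "(r \<otimes>\<^bsub>P\<^esub> v) (j, us @ Star (Suc k) # Arr (Suc k) # vs, l) =
        - (r \<otimes>\<^bsub>P\<^esub> v) (j, us @ Arr k # Star k # vs, l)"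
      unfolding eq by (simp add: relations_opposite[OF r] sum_negf)
  qed (simp add: eq)
qed

lemma tensor_power_mult_rel_at:
  assumes u: "u \<in> tensor_power n i" and s: "s \<in> rel_at 0"
  shows "u \<otimes>\<^bsub>P\<^esub> s \<in> rel_at i"
proof -
  note eq = tensor_power_mult[OF u, of s]
  show ?thesis
  proof (rule rel_atI)
    show "u \<otimes>\<^bsub>P\<^esub> s \<in> carrier P" by (rule path_mult_closed[OF tensor_powerD(1)[OF u] rel_at_closed[OF s]])
  next
    fix j l and xs :: "arrow list" assume "length xs < i + 2"
    then have "s (w, drop i xs, l) = 0" for w by (intro rel_at_short[OF s]) simp
    then show "(u \<otimes>\<^bsub>P\<^esub> s) (j, xs, l) = 0" unfolding eq by simp
  next
    fix j l and us vs :: "arrow list" and b d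
    assume us: "length us = i" and nz: "(u \<otimes>\<^bsub>P\<^esub> s) (j, us @ b # d # vs, l) \<noteq> 0"
    have "(\<Sum>w<n. u (j, us, w) * s (w, b # d # vs, l)) \<noteq> 0" using nz us unfolding eq by simp
    then obtain w where "u (j, us, w) * s (w, b # d # vs, l) \<noteq> 0" by (rule sum.not_neutral_contains_not_neutral)
    then have "s (w, [] @ b # d # vs, l) \<noteq> 0" by simp
    then show "\<exists>k. Suc k < n \<and> (b = Arr k \<and> d = Star k \<or> b = Star k \<and> d = Arr k)"
      by (intro rel_at_letters[of s "[]"]) (use s in simp_all)
  next
    fix j l and us vs :: "arrow list" and k assume "length us = i" "Suc (Suc k) < n"
    then show "(u \<otimes>\<^bsub>P\<^esub> s) (j, us @ Star (Suc k) # Arr (Suc k) # vs, l) =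
        - (u \<otimes>\<^bsub>P\<^esub> s) (j, us @ Arr k # Star k # vs, l)"
      using rel_at_opposite[of s "[]" k _ vs l] s unfolding eq by (simp add: sum_negf)
  qed
qed

lemma tensor_rel_at:
  "tensor n (tensor_power n i) (tensor n (relations n) (tensor_power n j :: 'f pvec set)) \<subseteq> rel_at i"
proof (rule tensor_subset[OF rel_at_submodule tensor_power_mult_rel_at])
  fix y :: "'f pvec" assume y: "y \<in> tensor n (relations n) (tensor_power n j)"
  have "tensor n (relations n) (tensor_power n j :: 'f pvec set) \<subseteq> rel_at 0"
    by (rule tensor_subset[OF rel_at_submodule]) (auto intro: relations_mult_rel_at dest: tensor_powerD)
  with y show "y \<in> rel_at 0" by blast
qed

text \<open>Two overlapping relations are incompatible since the quiver has at least three vertices.\<close>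

lemma rel_at_0_1:
  assumes 0: "w \<in> rel_at 0" and 1: "w \<in> rel_at 1"
  shows "w = (\<lambda>p. 0)"
proof (rule ccontr)
  assume "w \<noteq> (\<lambda>p. 0)"
  then obtain q where "w q \<noteq> 0" by (auto simp: fun_eq_iff)
  then obtain j xs l where nz: "w (j, xs, l) \<noteq> 0" by (cases q) auto
  have "\<not> length xs < 1 + 2" using nz rel_at_short[OF 1] by blast
  then have "Suc (Suc (Suc 0)) \<le> length xs" by simp
  then obtain b d e vs where xs: "xs = b # d # e # vs" by (auto simp: Suc_le_length_iff)
  note A0 = rel_at_letters[of w "[]", simplified, OF 0]
    and A1 = rel_at_letters[of w "[_]", simplified, OF 1[simplified]]
    and B0 = rel_at_opposite[of w "[]", simplified, OF 0]
    and B1 = rel_at_opposite[of w "[_]", simplified, OF 1[simplified]]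
  from nz A0[of j b d "e # vs" l] xs obtain k where k: "Suc k < n" "b = Arr k \<and> d = Star k \<or> b = Star k \<and> d = Arr k"
    by auto
  from nz A1[of j b d e vs l] xs obtain k' where k': "Suc k' < n" "d = Arr k' \<and> e = Star k' \<or> d = Star k' \<and> e = Arr k'"
    by auto
  \<comment> \<open>The two overlapping pairs share the letter \<open>d\<close>, which forces
    \<open>k = k'\<close> and an alternating word.\<close>
  from k(2) k'(2) consider "b = Arr k" "d = Star k" "e = Arr k" | "b = Star k" "d = Arr k" "e = Star k" by auto
  then show False
  proof cases
    case 1
    show False
    \<comment> \<open>Replacing the first pair by its partner makes the second and third letters
      \<open>Arr (Suc k)\<close> and \<open>Arr k\<close>, which form no term of a relation. If
      \<open>k\<close> is the last index, \<open>n3\<close> provides a previous one, and replacing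
      the second pair spoils the first.\<close>
    proof (cases "Suc (Suc k) < n")
      case True
      then have "w (j, Star (Suc k) # Arr (Suc k) # Arr k # vs, l) \<noteq> 0" using B0[of k j "Arr k # vs" l] nz xs 1 by auto
      from A1[OF this] show False by auto
    next
      case False
      with k(1) n3 obtain k0 where k0: "k = Suc k0" by (cases k) auto
      have "w (j, Arr k # Arr k0 # Star k0 # vs, l) \<noteq> 0" using B1[of k0 j "Arr k" vs l] k nz xs 1 k0 by auto
      from A0[OF this] show False by auto
    qed
  next
    case 2
    show False
    \<comment> \<open>For \<open>k = 0\<close> the second pair is replaced, by arrows with index 1,
      which spoils the first pair; otherwise replacing the first pair spoils the second.\<close>
    proof (cases k)
      case 0
      have "w (j, Star k # Star (Suc 0) # Arr (Suc 0) # vs, l) \<noteq> 0" using B1[of 0 j "Star k" vs l] n3 nz xs 2 0 by auto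
      from A0[OF this] show False by auto
    next
      case (Suc k0)
      have "w (j, Arr k0 # Star k0 # Star k # vs, l) \<noteq> 0" using B0[of k0 j "Star k # vs" l] k nz xs 2 Suc by auto
      from A1[OF this] show False by auto
    qed
  qed
qed

text \<open>The members of the intersection with \<open>i = 0\<close> and \<open>i = 1\<close>
  already meet only in zero; zero remains because every member is a subspace.\<close>

lemma W_ge_3:
  assumes "3 \<le> p"
  shows "(W n p :: 'f pvec set) = {\<lambda>p. 0}"
proof -
  let ?T = "\<lambda>i j. tensor n (tensor_power n i) (tensor n (relations n) (tensor_power n j)) :: 'f pvec set"
  have W: "(W n p :: 'f pvec set) = \<Inter>{?T i j | i j. i + 2 + j = p}" using assms by (simp add: W_def)
  have tp: "tensor_power n i \<subseteq> carrier P" for i using tensor_powerD(1) by blast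
  have "(\<lambda>p. 0) \<in> ?T i j" for i j
  proof -
    have "submodule class_ring (?T i j) P"
      by (rule tensor_submodule[OF tp tensor_closed[OF relations_closed[OF n2] tp]])
    from submodule.zero_closed[OF this] show ?thesis by simp
  qed
  then have "(\<lambda>p. 0) \<in> (W n p :: 'f pvec set)" unfolding W by blast
  moreover have "x = (\<lambda>p. 0)" if "x \<in> W n p" for x :: "'f pvec"
  proof (rule rel_at_0_1)
    have mem: "x \<in> ?T i j" if "i + 2 + j = p" for i j
      using \<open>x \<in> W n p\<close> that unfolding W by blast
    have "x \<in> ?T 0 (p - 2)" "x \<in> ?T 1 (p - 3)" by (rule mem, use assms in simp)+
    then show "x \<in> rel_at 0" "x \<in> rel_at 1" using tensor_rel_at by blast+
  qed
  ultimately show ?thesis by blast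
qed

end

subsection \<open>Cochains in coordinates\<close>

context preproj begin

lemma W_submodule: "submodule class_ring (W n p :: 'f pvec set) P"
proof -
  consider "p = 0" | "p = Suc 0" | "p = 2" | "3 \<le> p" by linarith
  then show ?thesis
  proof cases
    case 4
    have "submodule class_ring {\<lambda>p. 0} P"
      by (rule submodule.intro[OF path_module]) (auto simp: path_zero_closed)
    with 4 show ?thesis by (simp add: W_ge_3)
  qed (simp_all add: W_0 W_1 W_2 tensor_power_submodule relations_submodule)
qed

lemma W_closed: "w \<in> W n p \<Longrightarrow> w \<in> carrier P"
  using submodule.subset[OF W_submodule] by blast

lemma W_add: "w \<in> W n p \<Longrightarrow> w' \<in> W n p \<Longrightarrow> w \<oplus>\<^bsub>P\<^esub> w' \<in> W n p"
  by (rule submodule.m_closed[OF W_submodule])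

lemma W_smult: "w \<in> W n p \<Longrightarrow> c \<odot>\<^bsub>P\<^esub> w \<in> W n p"
  by (rule submodule.smult_closed[OF W_submodule]) simp_all

lemma W_zero: "\<zero>\<^bsub>P\<^esub> \<in> W n p"
  by (rule submodule.zero_closed[OF W_submodule])

lemma bimodule_apply:
  assumes "u \<in> tensor_power n 0" "v \<in> tensor_power n 0" "x \<in> carrier P"
  shows "(u \<otimes>\<^bsub>P\<^esub> x \<otimes>\<^bsub>P\<^esub> v) (j, xs, i) = u (j, [], j) * x (j, xs, i) * v (i, [], i)"
  using assms by (simp add: mult_tensor_power_0 tensor_power_0_mult path_mult_closed tensor_powerD(1))

lemma W_bimodule:
  assumes "w \<in> W n p" "u \<in> tensor_power n 0" "v \<in> tensor_power n 0"
  shows "u \<otimes>\<^bsub>P\<^esub> w \<otimes>\<^bsub>P\<^esub> v \<in> W n p"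
proof -
  note wc = W_closed[OF assms(1)]
  have uwv: "u \<otimes>\<^bsub>P\<^esub> w \<otimes>\<^bsub>P\<^esub> v \<in> carrier P"
    using wc assms by (simp add: path_mult_closed tensor_powerD(1))
  have len: "u \<otimes>\<^bsub>P\<^esub> w \<otimes>\<^bsub>P\<^esub> v \<in> tensor_power n q" if "w \<in> tensor_power n q" for q
    unfolding tensor_power_def
  proof (intro CollectI conjI allI impI uwv)
    fix j xs i assume "(u \<otimes>\<^bsub>P\<^esub> w \<otimes>\<^bsub>P\<^esub> v) (j, xs, i) \<noteq> 0"
    then have "w (j, xs, i) \<noteq> 0" unfolding bimodule_apply[OF assms(2,3) wc] by auto
    then show "length xs = q" by (rule tensor_powerD(2)[OF that])
  qed
  consider "p = 0" | "p = Suc 0" | "p = 2" | "3 \<le> p" by linarith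
  then show ?thesis
  proof cases
    case 3
    with assms show ?thesis by (simp add: W_2 relations_bimodule)
  next
    case 4
    with assms(1) have "w = (\<lambda>p. 0)" by (simp add: W_ge_3)
    then have "(u \<otimes>\<^bsub>P\<^esub> w \<otimes>\<^bsub>P\<^esub> v) (j, xs, i) = 0" for j xs i
      unfolding bimodule_apply[OF assms(2,3) wc] by simp
    then have "u \<otimes>\<^bsub>P\<^esub> w \<otimes>\<^bsub>P\<^esub> v = (\<lambda>p. 0)" by auto
    with 4 show ?thesis by (simp add: W_ge_3)
  qed (use assms len in \<open>simp_all add: W_0 W_1\<close>)
qed

lemma W_length:
  assumes "(w :: 'f pvec) \<in> W n p" "w (j, xs, i) \<noteq> 0"
  shows "xs \<in> words n p"
proof -
  have "length xs = p"
  proof -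
    consider "p = 0" | "p = Suc 0" | "p = 2" | "3 \<le> p" by linarith
    then show ?thesis
    proof cases
      case 3
      then show ?thesis using relations_nonzero[of w j xs i] assms by (auto simp: W_2)
    next
      case 4
      with assms show ?thesis by (simp add: W_ge_3)
    qed (use tensor_powerD(2)[of w n _ j xs i] assms in \<open>simp_all add: W_0 W_1\<close>)
  qed
  moreover have "set xs \<subseteq> arrows n"
    using carrier_path_algebraD[OF W_closed[OF assms(1)] assms(2)] is_path_arrows by blast
  ultimately show ?thesis by (simp add: words_def)
qed

lemma vertex_in_W: "i < n \<Longrightarrow> vertex i \<in> W n 0"
  by (auto simp: W_0 tensor_power_def vertex_def path_vec_closed) (auto simp: path_vec_def split: if_splits)

lemma arrow_vec_in_W: "x \<in> arrows n \<Longrightarrow> arrow_vec x \<in> W n (Suc 0)"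
proof -
  assume x: "x \<in> arrows n"
  then have "is_path n (tgt x) [x] (src x)" by (auto simp: arrows_def)
  then show ?thesis unfolding W_1 tensor_power_def arrow_vec_def
    by (auto simp: path_vec_closed) (auto simp: path_vec_def split: if_splits)
qed

lemma sigma_in_W: "i < n \<Longrightarrow> (sigma n i :: 'f pvec) \<in> W n 2"
  using sigma_in_relations[OF n2] by (simp add: W_2)

lemma coeff_bimodule:
  assumes "u \<in> tensor_power n 0" "v \<in> tensor_power n 0" "X \<in> carrier A"
  shows "coeff n (proj n u \<otimes>\<^bsub>A\<^esub> X \<otimes>\<^bsub>A\<^esub> proj n v) j i L = u (j, [], j) * coeff n X j i L * v (i, [], i)"
proof -
  from A_rep[OF assms(3)] obtain x where x: "X = proj n x" "x \<in> carrier P" by blast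
  have u: "u \<in> carrier P" "v \<in> carrier P" using assms tensor_powerD(1) by auto
  have "coeff n (proj n u \<otimes>\<^bsub>A\<^esub> X \<otimes>\<^bsub>A\<^esub> proj n v) j i L =
      (if admissible n j i L then path_coeff n (u \<otimes>\<^bsub>P\<^esub> x \<otimes>\<^bsub>P\<^esub> v) j i L else 0)"
    using x u by (simp add: proj_mult path_mult_closed coeff_proj)
  also have "path_coeff n (u \<otimes>\<^bsub>P\<^esub> x \<otimes>\<^bsub>P\<^esub> v) j i L = u (j, [], j) * path_coeff n x j i L * v (i, [], i)"
    unfolding path_coeff_def bimodule_apply[OF assms(1,2) x(2)] by (simp add: sum_distrib_left sum_distrib_right)
  finally show ?thesis using x by (simp add: coeff_proj)
qed

text \<open>A cochain extends from $W_p$ to all of $V^{\otimes_k p}$ and is then given by its values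
  \<open>\<phi> j xs i L\<close> on paths, \<open>L\<close> being the length in $A$. The extension is not unique, so \<open>\<phi>\<close> is not
  determined by the cochain.\<close>

definition mk :: "nat \<Rightarrow> (nat \<Rightarrow> arrow list \<Rightarrow> nat \<Rightarrow> nat \<Rightarrow> 'f) \<Rightarrow> 'f cochain" where
  "mk p \<phi> = (\<lambda>w\<in>W n p. of_coeff (\<lambda>j i L. \<Sum>xs\<in>words n p. w (j, xs, i) * \<phi> j xs i L))"

lemma mk_closed: "w \<in> W n p \<Longrightarrow> mk p \<phi> w \<in> carrier A"
  by (simp add: mk_def of_coeff_closed)

lemma coeff_mk: "w \<in> W n p \<Longrightarrow> coeff n (mk p \<phi> w) j i L =
    (if admissible n j i L then \<Sum>xs\<in>words n p. w (j, xs, i) * \<phi> j xs i L else 0)"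
  by (simp add: mk_def coeff_of_coeff)

lemma mk_in_Hom: "mk p \<phi> \<in> Hom_ke n p"
  unfolding Hom_ke_def
proof (intro CollectI conjI ballI)
  show "mk p \<phi> \<in> W n p \<rightarrow>\<^sub>E carrier A"
    by (auto simp: mk_def of_coeff_closed)
next
  fix w w' :: "'f pvec" assume w: "w \<in> W n p" "w' \<in> W n p"
  show "mk p \<phi> (w \<oplus>\<^bsub>P\<^esub> w') = mk p \<phi> w \<oplus>\<^bsub>A\<^esub> mk p \<phi> w'"
  proof (rule coeff_inject)
    fix j i L assume "admissible n j i L"
    then show "coeff n (mk p \<phi> (w \<oplus>\<^bsub>P\<^esub> w')) j i L = coeff n (mk p \<phi> w \<oplus>\<^bsub>A\<^esub> mk p \<phi> w') j i L"
      unfolding coeff_add[OF mk_closed[OF w(1)] mk_closed[OF w(2)]] coeff_mk[OF W_add[OF w]]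
        coeff_mk[OF w(1)] coeff_mk[OF w(2)]
      by (simp add: distrib_right sum.distrib)
  qed (use w W_add[OF w] in \<open>simp_all add: mk_closed\<close>)
next
  fix w u v :: "'f pvec" assume w: "w \<in> W n p" and u: "u \<in> tensor_power n 0" and v: "v \<in> tensor_power n 0"
  have cl: "proj n u \<in> carrier A" "proj n v \<in> carrier A"
    using u v tensor_powerD(1) proj_closed by auto
  show "mk p \<phi> (u \<otimes>\<^bsub>P\<^esub> w \<otimes>\<^bsub>P\<^esub> v) = proj n u \<otimes>\<^bsub>A\<^esub> mk p \<phi> w \<otimes>\<^bsub>A\<^esub> proj n v"
  proof (rule coeff_inject)
    fix j i L assume "admissible n j i L"
    then show "coeff n (mk p \<phi> (u \<otimes>\<^bsub>P\<^esub> w \<otimes>\<^bsub>P\<^esub> v)) j i L = coeff n (proj n u \<otimes>\<^bsub>A\<^esub> mk p \<phi> w \<otimes>\<^bsub>A\<^esub> proj n v) j i L"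
      unfolding coeff_mk[OF W_bimodule[OF w u v]] coeff_bimodule[OF u v mk_closed[OF w]] coeff_mk[OF w]
        bimodule_apply[OF u v W_closed[OF w]]
      by (simp add: sum_distrib_left sum_distrib_right mult_ac)
  qed (use mk_closed[OF w] mk_closed[OF W_bimodule[OF w u v]] cl in simp_all)
qed

lemma Hom_closed: "f \<in> Hom_ke n p \<Longrightarrow> w \<in> W n p \<Longrightarrow> f w \<in> carrier A"
  by (auto simp: Hom_ke_def)

lemma Hom_add: "f \<in> Hom_ke n p \<Longrightarrow> w \<in> W n p \<Longrightarrow> w' \<in> W n p \<Longrightarrow> f (w \<oplus>\<^bsub>P\<^esub> w') = f w \<oplus>\<^bsub>A\<^esub> f w'"
  unfolding Hom_ke_def by blast

lemma Hom_bimodule: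
  "f \<in> Hom_ke n p \<Longrightarrow> w \<in> W n p \<Longrightarrow> u \<in> tensor_power n 0 \<Longrightarrow> v \<in> tensor_power n 0 \<Longrightarrow>
   f (u \<otimes>\<^bsub>P\<^esub> w \<otimes>\<^bsub>P\<^esub> v) = proj n u \<otimes>\<^bsub>A\<^esub> f w \<otimes>\<^bsub>A\<^esub> proj n v"
  unfolding Hom_ke_def by blast

lemma Hom_eqI:
  assumes "(f :: 'f cochain) \<in> Hom_ke n p" "g \<in> Hom_ke n p"
    and "\<And>w j i L. w \<in> W n p \<Longrightarrow> admissible n j i L \<Longrightarrow> coeff n (f w) j i L = coeff n (g w) j i L"
  shows "f = g"
proof (rule PiE_ext)
  show "f \<in> W n p \<rightarrow>\<^sub>E carrier A" "g \<in> W n p \<rightarrow>\<^sub>E carrier A" using assms(1,2) by (auto simp: Hom_ke_def)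
  show "f w = g w" if "w \<in> W n p" for w
    by (rule coeff_inject) (use assms that Hom_closed in auto)
qed

lemma smult_one_tensor_power: "(\<lambda>p. c * \<one>\<^bsub>P\<^esub> p) \<in> tensor_power n 0"
  using submodule.smult_closed[OF tensor_power_submodule _ one_tensor_power, of c n] by simp

text \<open>Scalar linearity is the bimodule condition for the multiple \<open>c\<close> of the
  unit.\<close>

lemma Hom_smult:
  assumes f: "(f :: 'f cochain) \<in> Hom_ke n p" and w: "w \<in> W n p"
  shows "coeff n (f (c \<odot>\<^bsub>P\<^esub> w)) j i L = c * coeff n (f w) j i L"
proof -
  let ?u = "\<lambda>p. c * \<one>\<^bsub>P\<^esub> p"
  have "c \<odot>\<^bsub>P\<^esub> w = ?u \<otimes>\<^bsub>P\<^esub> w \<otimes>\<^bsub>P\<^esub> \<one>\<^bsub>P\<^esub>"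
    using W_closed[OF w] by (simp add: smult_one_mult(1) path_mult_one path_smult_closed)
  then have "f (c \<odot>\<^bsub>P\<^esub> w) = proj n ?u \<otimes>\<^bsub>A\<^esub> f w \<otimes>\<^bsub>A\<^esub> proj n \<one>\<^bsub>P\<^esub>"
    using Hom_bimodule[OF f w smult_one_tensor_power one_tensor_power] by simp
  then have "coeff n (f (c \<odot>\<^bsub>P\<^esub> w)) j i L = ?u (j, [], j) * coeff n (f w) j i L * \<one>\<^bsub>P\<^esub> (i, [], i)"
    using coeff_bimodule[OF smult_one_tensor_power one_tensor_power Hom_closed[OF f w]] by simp
  then show ?thesis using admissible_less[of j i L] coeff_not_admissible[of j i L "f w"]
    by (cases "admissible n j i L") (simp_all add: path_one_apply)
qed

lemma Hom_zero:
  assumes "(f :: 'f cochain) \<in> Hom_ke n p"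
  shows "coeff n (f (\<lambda>p. 0)) j i L = 0"
  using Hom_smult[OF assms W_zero, of 0 j i L] by simp

lemma Hom_sum:
  assumes f: "(f :: 'f cochain) \<in> Hom_ke n p" and "finite T" and b: "\<And>t. t \<in> T \<Longrightarrow> b t \<in> W n p"
  shows "(\<lambda>q. \<Sum>t\<in>T. c t * b t q) \<in> W n p \<and>
    coeff n (f (\<lambda>q. \<Sum>t\<in>T. c t * b t q)) j i L = (\<Sum>t\<in>T. c t * coeff n (f (b t)) j i L)"
  using assms(2) b
proof (induction T rule: finite_induct)
  case empty
  then show ?case using W_zero Hom_zero[OF f] by simp
next
  case (insert t T)
  let ?s = "\<lambda>q. \<Sum>t\<in>T. c t * b t q"
  have IH: "?s \<in> W n p" "coeff n (f ?s) j i L = (\<Sum>t\<in>T. c t * coeff n (f (b t)) j i L)"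
    using insert by auto
  have bt: "b t \<in> W n p" using insert.prems by simp
  have eq: "(\<lambda>q. \<Sum>t\<in>insert t T. c t * b t q) = (c t \<odot>\<^bsub>P\<^esub> b t) \<oplus>\<^bsub>P\<^esub> ?s"
    using insert.hyps by simp
  show ?case
    unfolding eq using W_add[OF W_smult[OF bt] IH(1)]
      Hom_add[OF f W_smult[OF bt] IH(1)] coeff_add[OF Hom_closed[OF f W_smult[OF bt]] Hom_closed[OF f IH(1)]]
      Hom_smult[OF f bt] IH(2) insert.hyps by (simp del: path_algebra_simps)
qed

lemma vertex_tensor_power: "i < n \<Longrightarrow> vertex i \<in> tensor_power n 0"
  using vertex_in_W by (simp add: W_0)

text \<open>If \<open>w\<close> equals \<open>e_j0 w e_i0\<close>, then so does its value, which
  therefore lives at the single pair \<open>(j0, i0)\<close>.\<close>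

lemma Hom_support:
  assumes f: "(f :: 'f cochain) \<in> Hom_ke n p" and w: "w \<in> W n p" and ji: "j0 < n" "i0 < n"
    and supp: "\<And>j xs i. w (j, xs, i) \<noteq> 0 \<Longrightarrow> j = j0 \<and> i = i0"
    and "j \<noteq> j0 \<or> i \<noteq> i0"
  shows "coeff n (f w) j i L = 0"
proof -
  note v = vertex_tensor_power[OF ji(1)] vertex_tensor_power[OF ji(2)]
  have "(vertex j0 \<otimes>\<^bsub>P\<^esub> w \<otimes>\<^bsub>P\<^esub> vertex i0) q = w q" for q
  proof (cases q)
    case (fields j xs i)
    show ?thesis unfolding fields bimodule_apply[OF v W_closed[OF w]]
    proof (cases "w (j, xs, i) = 0")
      case False
      from supp[OF this] show "vertex j0 (j, [], j) * w (j, xs, i) * vertex i0 (i, [], i) = w (j, xs, i)"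
        by (auto simp: vertex_def path_vec_def)
    qed simp
  qed
  then have eq: "vertex j0 \<otimes>\<^bsub>P\<^esub> w \<otimes>\<^bsub>P\<^esub> vertex i0 = w" by (rule ext)
  have "f w = proj n (vertex j0) \<otimes>\<^bsub>A\<^esub> f w \<otimes>\<^bsub>A\<^esub> proj n (vertex i0)"
    by (rule Hom_bimodule[OF f w v, unfolded eq])
  then have "coeff n (f w) j i L = coeff n (proj n (vertex j0) \<otimes>\<^bsub>A\<^esub> f w \<otimes>\<^bsub>A\<^esub> proj n (vertex i0)) j i L"
    by (rule arg_cong)
  also have "\<dots> = vertex j0 (j, [], j) * coeff n (f w) j i L * vertex i0 (i, [], i)"
    by (rule coeff_bimodule[OF v Hom_closed[OF f w]])
  also have "\<dots> = 0"
    using assms(6) by (auto simp: vertex_def path_vec_def)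
  finally show ?thesis .
qed

section \<open>Generators of W_0, W_1, W_2 and cochains determined by them\<close>

lemma W_0_expand:
  assumes "(w :: 'f pvec) \<in> W n 0"
  shows "w = (\<lambda>q. \<Sum>l<n. w (l, [], l) * vertex l q)"
proof
  fix q :: path obtain j xs i where q: "q = (j, xs, i)" by (cases q)
  have "(\<Sum>l<n. w (l, [], l) * vertex l q) = (\<Sum>l<n. if l = j then w (j, xs, i) else 0)"
  proof (rule sum.cong[OF refl])
    fix l
    show "w (l, [], l) * vertex l q = (if l = j then w (j, xs, i) else 0)"
    proof (cases "w (j, xs, i) = 0")
      case True
      then have "w (l, [], l) = 0" if "q = (l, [], l)" using that q by simp
      with True show ?thesis by (cases "q = (l, [], l)") (simp_all add: vertex_def path_vec_def)
    next
      case False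
      then have "xs = []" "i = j" using tensor_power_0_apply[OF assms[unfolded W_0]] by blast+
      then show ?thesis by (auto simp: q vertex_def path_vec_def)
    qed
  qed
  also have "\<dots> = w q"
  proof (cases "w (j, xs, i) = 0")
    case False
    then have "j < n" using tensor_power_0_apply[OF assms[unfolded W_0]] by blast
    then show ?thesis by (simp add: q)
  qed (simp add: q)
  finally show "w q = (\<Sum>l<n. w (l, [], l) * vertex l q)" by (rule sym)
qed

lemma words_1: "words n (Suc 0) = (\<lambda>x. [x]) ` arrows n"
  by (auto simp: words_def length_Suc_conv)

lemma W_1_apply:
  assumes "(w :: 'f pvec) \<in> W n (Suc 0)" "w (j, xs, i) \<noteq> 0"
  shows "\<exists>x\<in>arrows n. xs = [x] \<and> j = tgt x \<and> i = src x"
proof -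
  obtain x where x: "xs = [x]" "x \<in> arrows n" using W_length[OF assms] by (auto simp: words_1)
  with carrier_path_algebraD[OF W_closed[OF assms(1)] assms(2)] show ?thesis by auto
qed

lemma W_1_expand:
  assumes "(w :: 'f pvec) \<in> W n (Suc 0)"
  shows "w = (\<lambda>q. \<Sum>x\<in>arrows n. w (tgt x, [x], src x) * arrow_vec x q)"
proof
  fix q :: path obtain j xs i where q: "q = (j, xs, i)" by (cases q)
  have "(\<Sum>x\<in>arrows n. w (tgt x, [x], src x) * arrow_vec x q) =
      (\<Sum>x\<in>arrows n. if x = hd xs then w (j, xs, i) else 0)"
  proof (rule sum.cong[OF refl])
    fix x assume "x \<in> arrows n"
    show "w (tgt x, [x], src x) * arrow_vec x q = (if x = hd xs then w (j, xs, i) else 0)"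
    proof (cases "w (j, xs, i) = 0")
      case True
      then have "w (tgt x, [x], src x) = 0" if "q = (tgt x, [x], src x)" using that q by simp
      with True show ?thesis by (cases "q = (tgt x, [x], src x)") (simp_all add: arrow_vec_def path_vec_def)
    next
      case False
      then obtain y where "xs = [y]" "j = tgt y" "i = src y" using W_1_apply[OF assms] by blast
      then show ?thesis by (simp add: q arrow_vec_def path_vec_def)
    qed
  qed
  also have "\<dots> = w q"
  proof (cases "w (j, xs, i) = 0")
    case False
    then obtain y where "y \<in> arrows n" "xs = [y]" using W_1_apply[OF assms] by blast
    then show ?thesis by (simp add: q)
  qed (simp add: q)
  finally show "w q = (\<Sum>x\<in>arrows n. w (tgt x, [x], src x) * arrow_vec x q)" by (rule sym)
qed

lemma W_2_expand:
  assumes "(w :: 'f pvec) \<in> W n 2"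
  obtains c where "w = (\<lambda>q. \<Sum>l<n. c l * sigma n l q)"
proof -
  obtain c where "w = (\<lambda>q. \<Sum>l<n. c l * sigma n l q)"
    using assms unfolding W_2 relations_eq[OF n2] by blast
  then show thesis by (rule that)
qed


text \<open>The coordinate of \<open>mk 2 \<phi>\<close> on \<open>sigma n i\<close> in length
  \<open>L\<close>. Different \<open>\<phi>\<close> with equal \<open>rel_coeff\<close> at
  admissible places give the same cochain, see \<open>mk_eq_2\<close>.\<close>

definition rel_coeff :: "(nat \<Rightarrow> arrow list \<Rightarrow> nat \<Rightarrow> nat \<Rightarrow> 'f) \<Rightarrow> nat \<Rightarrow> nat \<Rightarrow> 'f" where
  "rel_coeff \<phi> i L = (if 0 < i then \<phi> i [Arr (i - 1), Star (i - 1)] i L else 0)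
     - (if i < n - 1 then \<phi> i [Star i, Arr i] i L else 0)"

lemma sigma_sum:
  assumes "l < n"
  shows "(\<Sum>xs\<in>words n 2. (sigma n l (j, xs, i) :: 'f) * \<phi> j xs i L) = (if j = l \<and> i = l then rel_coeff \<phi> l L else 0)"
proof (cases "j = l \<and> i = l")
  case True
  let ?U = "[Arr (l - 1), Star (l - 1)]" and ?D = "[Star l, Arr l]"
  have U: "0 < l \<Longrightarrow> ?U \<in> words n 2" and D: "l < n - 1 \<Longrightarrow> ?D \<in> words n 2"
    using assms by (auto simp: words_def arrows_def)
  have "(\<Sum>xs\<in>words n 2. (sigma n l (j, xs, i) :: 'f) * \<phi> j xs i L) =
     (\<Sum>xs\<in>words n 2. (if xs = ?U then if 0 < l then \<phi> l ?U l L else 0 else 0)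
       - (if xs = ?D then if l < n - 1 then \<phi> l ?D l L else 0 else 0))"
    by (intro sum.cong refl) (use True assms in \<open>auto simp: sigma_apply\<close>)
  also have "\<dots> = rel_coeff \<phi> l L"
    unfolding sum_subtractf using U D by (auto simp: rel_coeff_def)
  finally show ?thesis using True by simp
next
  case False
  then show ?thesis by (intro trans[OF sum.neutral]) (auto simp: sigma_apply assms)
qed

lemma vertex_sum:
  "(\<Sum>xs\<in>words n 0. (vertex l (j, xs, i) :: 'f) * \<phi> j xs i L) = (if j = l \<and> i = l then \<phi> l [] l L else 0)"
  by (simp add: vertex_def path_vec_def)

lemma arrow_vec_sum:
  assumes "x \<in> arrows n"
  shows "(\<Sum>xs\<in>words n (Suc 0). (arrow_vec x (j, xs, i) :: 'f) * \<phi> j xs i L) =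
    (if j = tgt x \<and> i = src x then \<phi> j [x] i L else 0)"
proof -
  have "(\<Sum>xs\<in>words n (Suc 0). (arrow_vec x (j, xs, i) :: 'f) * \<phi> j xs i L) =
      (\<Sum>xs\<in>words n (Suc 0). if xs = [x] then if j = tgt x \<and> i = src x then \<phi> j [x] i L else 0 else 0)"
    by (intro sum.cong refl) (auto simp: arrow_vec_def path_vec_def)
  then show ?thesis using assms by (auto simp: words_1)
qed

lemma coeff_mk_vertex:
  "l < n \<Longrightarrow> coeff n (mk 0 \<phi> (vertex l)) j i L = (if j = l \<and> i = l \<and> admissible n l l L then \<phi> l [] l L else 0)"
  by (simp add: coeff_mk[OF vertex_in_W] vertex_sum del: words_0)

lemma coeff_mk_arrow:
  "x \<in> arrows n \<Longrightarrow> coeff n (mk (Suc 0) \<phi> (arrow_vec x)) j i L =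
    (if j = tgt x \<and> i = src x \<and> admissible n j i L then \<phi> j [x] i L else 0)"
  by (auto simp: coeff_mk[OF arrow_vec_in_W] arrow_vec_sum)

lemma coeff_mk_sigma:
  "l < n \<Longrightarrow> coeff n (mk 2 \<phi> (sigma n l)) j i L = (if j = l \<and> i = l \<and> admissible n l l L then rel_coeff \<phi> l L else 0)"
  by (simp add: coeff_mk[OF sigma_in_W] sigma_sum)

lemma vertex_support: "vertex l (j, xs, i) \<noteq> 0 \<Longrightarrow> j = l \<and> i = l"
  by (simp add: vertex_def path_vec_def split: if_splits)

lemma arrow_vec_support: "arrow_vec x (j, xs, i) \<noteq> 0 \<Longrightarrow> j = tgt x \<and> i = src x"
  by (simp add: arrow_vec_def path_vec_def split: if_splits)

lemma sigma_support: "l < n \<Longrightarrow> (sigma n l (j, xs, i) :: 'f) \<noteq> 0 \<Longrightarrow> j = l \<and> i = l"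
  by (simp add: sigma_apply split: if_splits)

lemma arrows_bound: "x \<in> arrows n \<Longrightarrow> tgt x < n \<and> src x < n"
  by (auto simp: arrows_def)

text \<open>Common core of the extensionality rules in degrees 0, 1 and 2. Each generator has one
  source and one target, so by \<open>Hom_support\<close> its value needs to be compared only at
  this pair of vertices.\<close>

lemma Hom_ext_generators:
  assumes f: "(f :: 'f cochain) \<in> Hom_ke n p" "g \<in> Hom_ke n p" and T: "finite T"
    and b: "\<And>t. t \<in> T \<Longrightarrow> b t \<in> W n p" and bound: "\<And>t. t \<in> T \<Longrightarrow> tj t < n \<and> ti t < n"
    and supp: "\<And>t j xs i. t \<in> T \<Longrightarrow> b t (j, xs, i) \<noteq> 0 \<Longrightarrow> j = tj t \<and> i = ti t"
    and expand: "\<And>w. w \<in> W n p \<Longrightarrow> \<exists>c. w = (\<lambda>q. \<Sum>t\<in>T. c t * b t q)"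
    and eq: "\<And>t L. t \<in> T \<Longrightarrow> admissible n (tj t) (ti t) L \<Longrightarrow>
      coeff n (f (b t)) (tj t) (ti t) L = coeff n (g (b t)) (tj t) (ti t) L"
  shows "f = g"
proof (rule Hom_eqI[OF f])
  fix w :: "'f pvec" and j i L assume w: "w \<in> W n p" and adm: "admissible n j i L"
  obtain c where c: "w = (\<lambda>q. \<Sum>t\<in>T. c t * b t q)" using expand[OF w] by blast
  have "coeff n (f (b t)) j i L = coeff n (g (b t)) j i L" if t: "t \<in> T" for t
  proof (cases "j = tj t \<and> i = ti t")
    case True
    with eq[OF t] adm show ?thesis by simp
  next
    case False
    have "coeff n (k (b t)) j i L = 0" if "(k :: 'f cochain) \<in> Hom_ke n p" for k
      by (rule Hom_support[OF that b[OF t] conjunct1[OF bound[OF t]] conjunct2[OF bound[OF t]]])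
        (erule supp[OF t], use False in blast)
    with f show ?thesis by simp
  qed
  moreover have "coeff n (k w) j i L = (\<Sum>t\<in>T. c t * coeff n (k (b t)) j i L)"
    if "(k :: 'f cochain) \<in> Hom_ke n p" for k
    using conjunct2[OF Hom_sum[where c = c and b = b and T = T, OF that T b]] unfolding c by this
  ultimately show "coeff n (f w) j i L = coeff n (g w) j i L" using f by simp
qed

lemma Hom_ext_0:
  assumes f: "(f :: 'f cochain) \<in> Hom_ke n 0" "g \<in> Hom_ke n 0"
    and eq: "\<And>l L. l < n \<Longrightarrow> admissible n l l L \<Longrightarrow> coeff n (f (vertex l)) l l L = coeff n (g (vertex l)) l l L"
  shows "f = g"
proof (rule Hom_ext_generators[OF f finite_lessThan[of n], where b = vertex and tj = "\<lambda>l. l" and ti = "\<lambda>l. l"])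
  show "vertex t (j, xs, i) \<noteq> (0 :: 'f) \<Longrightarrow> j = t \<and> i = t" for t j xs i by (rule vertex_support)
  show "\<exists>c. w = (\<lambda>q. \<Sum>t<n. c t * vertex t q)" if "w \<in> W n 0" for w :: "'f pvec"
    by (rule exI, rule W_0_expand[OF that])
qed (simp_all add: vertex_in_W eq)

lemma Hom_ext_1:
  assumes f: "(f :: 'f cochain) \<in> Hom_ke n (Suc 0)" "g \<in> Hom_ke n (Suc 0)"
    and eq: "\<And>x L. x \<in> arrows n \<Longrightarrow> admissible n (tgt x) (src x) L \<Longrightarrow>
      coeff n (f (arrow_vec x)) (tgt x) (src x) L = coeff n (g (arrow_vec x)) (tgt x) (src x) L"
  shows "f = g"
proof (rule Hom_ext_generators[OF f finite_arrows[of n], where b = arrow_vec and tj = tgt and ti = src])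
  show "arrow_vec x (j, xs, i) \<noteq> (0 :: 'f) \<Longrightarrow> j = tgt x \<and> i = src x" for x j xs i by (rule arrow_vec_support)
  show "\<exists>c. w = (\<lambda>q. \<Sum>x\<in>arrows n. c x * arrow_vec x q)" if "w \<in> W n (Suc 0)" for w :: "'f pvec"
    by (rule exI, rule W_1_expand[OF that])
qed (simp_all add: arrow_vec_in_W arrows_bound eq)

lemma Hom_ext_2:
  assumes f: "(f :: 'f cochain) \<in> Hom_ke n 2" "g \<in> Hom_ke n 2"
    and eq: "\<And>l L. l < n \<Longrightarrow> admissible n l l L \<Longrightarrow> coeff n (f (sigma n l)) l l L = coeff n (g (sigma n l)) l l L"
  shows "f = g"
proof (rule Hom_ext_generators[OF f finite_lessThan[of n], where b = "sigma n" and tj = "\<lambda>l. l" and ti = "\<lambda>l. l"])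
  show "j = t \<and> i = t" if "t \<in> {..<n}" "sigma n t (j, xs, i) \<noteq> (0 :: 'f)" for t j xs i
    using sigma_support[OF _ that(2)] that(1) by simp
  show "\<exists>c. w = (\<lambda>q. \<Sum>t<n. c t * sigma n t q)" if "w \<in> W n 2" for w :: "'f pvec"
    using W_2_expand[OF that] by blast
qed (simp_all add: sigma_in_W eq)

lemma Hom_ext_3:
  assumes f: "(f :: 'f cochain) \<in> Hom_ke n p" "g \<in> Hom_ke n p" and p: "3 \<le> p"
  shows "f = g"
proof (rule Hom_eqI[OF f])
  fix w :: "'f pvec" and j i L assume "w \<in> W n p"
  then have w: "w = (\<lambda>p. 0)" using W_ge_3[OF p] by simp
  show "coeff n (f w) j i L = coeff n (g w) j i L"
    unfolding w by (simp add: Hom_zero[OF f(1)] Hom_zero[OF f(2)])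
qed

lemma Hom_eq_mk:
  assumes f: "(f :: 'f cochain) \<in> Hom_ke n p"
  shows "\<exists>\<phi>. f = mk p \<phi>"
proof -
  consider "p = 0" | "p = Suc 0" | "p = 2" | "3 \<le> p" by linarith
  then show ?thesis
  proof cases
    case 1
    show ?thesis unfolding 1
      by (rule exI, rule Hom_ext_0[OF f[unfolded 1] mk_in_Hom, of "\<lambda>j xs i L. coeff n (f (vertex j)) j j L"])
        (simp add: coeff_mk_vertex)
  next
    case 2
    show ?thesis unfolding 2
      by (rule exI, rule Hom_ext_1[OF f[unfolded 2] mk_in_Hom, of "\<lambda>j xs i L. coeff n (f (arrow_vec (hd xs))) j i L"])
        (simp add: coeff_mk_arrow)
  next
    case 3
    \<comment> \<open>To extend from the relations to all words of length 2, the value on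
      \<open>sigma n j\<close> is put on the peak, which occurs with sign -1; the last vertex has no
      peak, and there the dip carries it.\<close>
    let ?\<phi> = "\<lambda>j xs i L. if xs = [Star j, Arr j] then - coeff n (f (sigma n j)) j j L
        else if j = n - 1 then coeff n (f (sigma n j)) j j L else 0"
    have "f = mk 2 ?\<phi>"
      by (rule Hom_ext_2[OF f[unfolded 3] mk_in_Hom]) (use n3 in \<open>auto simp: coeff_mk_sigma rel_coeff_def\<close>)
    then show ?thesis unfolding 3 by blast
  next
    case 4
    show ?thesis by (rule exI, rule Hom_ext_3[OF f mk_in_Hom 4])
  qed
qed

lemma mk_eq_0: "mk 0 \<phi> = mk 0 \<psi> \<longleftrightarrow> (\<forall>l<n. \<forall>L. admissible n l l L \<longrightarrow> \<phi> l [] l L = \<psi> l [] l L)"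
proof
  assume eq: "mk 0 \<phi> = mk 0 \<psi>"
  show "\<forall>l<n. \<forall>L. admissible n l l L \<longrightarrow> \<phi> l [] l L = \<psi> l [] l L"
  proof (intro allI impI)
    fix l L assume l: "l < n" "admissible n l l L"
    then show "\<phi> l [] l L = \<psi> l [] l L"
      using arg_cong[OF eq, of "\<lambda>f. coeff n (f (vertex l)) l l L"] by (simp add: coeff_mk_vertex)
  qed
qed (auto intro!: Hom_ext_0[OF mk_in_Hom mk_in_Hom] simp: coeff_mk_vertex)

lemma mk_eq_1: "mk (Suc 0) \<phi> = mk (Suc 0) \<psi> \<longleftrightarrow>
  (\<forall>x\<in>arrows n. \<forall>L. admissible n (tgt x) (src x) L \<longrightarrow> \<phi> (tgt x) [x] (src x) L = \<psi> (tgt x) [x] (src x) L)"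
proof
  assume eq: "mk (Suc 0) \<phi> = mk (Suc 0) \<psi>"
  show "\<forall>x\<in>arrows n. \<forall>L. admissible n (tgt x) (src x) L \<longrightarrow> \<phi> (tgt x) [x] (src x) L = \<psi> (tgt x) [x] (src x) L"
  proof (intro ballI allI impI)
    fix x L assume x: "x \<in> arrows n" "admissible n (tgt x) (src x) L"
    then show "\<phi> (tgt x) [x] (src x) L = \<psi> (tgt x) [x] (src x) L"
      using arg_cong[OF eq, of "\<lambda>f. coeff n (f (arrow_vec x)) (tgt x) (src x) L"] by (simp add: coeff_mk_arrow)
  qed
qed (auto intro!: Hom_ext_1[OF mk_in_Hom mk_in_Hom] simp: coeff_mk_arrow)

lemma mk_eq_2: "mk 2 \<phi> = mk 2 \<psi> \<longleftrightarrow> (\<forall>l<n. \<forall>L. admissible n l l L \<longrightarrow> rel_coeff \<phi> l L = rel_coeff \<psi> l L)"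
proof
  assume eq: "mk 2 \<phi> = mk 2 \<psi>"
  show "\<forall>l<n. \<forall>L. admissible n l l L \<longrightarrow> rel_coeff \<phi> l L = rel_coeff \<psi> l L"
  proof (intro allI impI)
    fix l L assume l: "l < n" "admissible n l l L"
    then show "rel_coeff \<phi> l L = rel_coeff \<psi> l L"
      using arg_cong[OF eq, of "\<lambda>f. coeff n (f (sigma n l)) l l L"] by (simp add: coeff_mk_sigma)
  qed
qed (auto intro!: Hom_ext_2[OF mk_in_Hom mk_in_Hom] simp: coeff_mk_sigma)

lemma mk_eq_3: "3 \<le> p \<Longrightarrow> mk p \<phi> = mk p \<psi>"
  by (rule Hom_ext_3[OF mk_in_Hom mk_in_Hom])

end

subsection \<open>Convolution, differential and cup product in coordinates\<close>

text \<open>The source of a path with target \<open>j\<close> and arrows \<open>us\<close>. Reading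
  it off the word lets sums over an intermediate vertex collapse to one term.\<close>

definition mid :: "nat \<Rightarrow> arrow list \<Rightarrow> nat" where
  "mid j us = (if us = [] then j else src (last us))"

lemma is_path_mid: "is_path n j us v \<Longrightarrow> v = mid j us"
  by (induction us arbitrary: j) (auto simp: mid_def)

context preproj begin

text \<open>Only coefficients at admissible triples are visible in $A$.\<close>

definition trunc :: "(nat \<Rightarrow> arrow list \<Rightarrow> nat \<Rightarrow> nat \<Rightarrow> 'f) \<Rightarrow> nat \<Rightarrow> arrow list \<Rightarrow> nat \<Rightarrow> nat \<Rightarrow> 'f" where
  "trunc \<phi> j xs i L = (if admissible n j i L then \<phi> j xs i L else 0)"

text \<open>The word is cut after \<open>p\<close> arrows, and the lengths in $A$ of the two values
  add up to \<open>L\<close>. The factors are truncated so that values of \<open>\<phi>\<close> and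
  \<open>\<psi>\<close> at inadmissible triples, which the cochains do not see, do not leak into the
  product.\<close>

definition conv_coeff ::
  "nat \<Rightarrow> (nat \<Rightarrow> arrow list \<Rightarrow> nat \<Rightarrow> nat \<Rightarrow> 'f) \<Rightarrow> (nat \<Rightarrow> arrow list \<Rightarrow> nat \<Rightarrow> nat \<Rightarrow> 'f) \<Rightarrow>
   nat \<Rightarrow> arrow list \<Rightarrow> nat \<Rightarrow> nat \<Rightarrow> 'f" where
  "conv_coeff p \<phi> \<psi> j xs i L = (\<Sum>k\<le>L. trunc \<phi> j (take p xs) (mid j (take p xs)) k *
     trunc \<psi> (mid j (take p xs)) (drop p xs) i (L - k))"

lemma W_tensor_power: "(w :: 'f pvec) \<in> W n p \<Longrightarrow> w \<in> tensor_power n p"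
  unfolding tensor_power_def using W_closed[of w p] W_length[of w p] by (auto simp: words_def)

lemma coeff_mk_trunc: "w \<in> W n p \<Longrightarrow> coeff n (mk p \<phi> w) j i L = (\<Sum>xs\<in>words n p. w (j, xs, i) * trunc \<phi> j xs i L)"
  by (simp add: coeff_mk trunc_def)

text \<open>The point is that the right side depends on \<open>u\<close> and \<open>v\<close> only
  through their product in the path algebra, and linearly; this makes \<open>conv\<close>
  independent of the decomposition.\<close>

lemma coeff_mk_mult:
  assumes u: "u \<in> W n p" and v: "v \<in> W n q" and adm: "admissible n j i L"
  shows "coeff n (mk p \<phi> u \<otimes>\<^bsub>A\<^esub> mk q \<psi> v) j i L =
    (\<Sum>zs\<in>words n (p + q). (u \<otimes>\<^bsub>P\<^esub> v) (j, zs, i) * conv_coeff p \<phi> \<psi> j zs i L)"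
proof -
  let ?t = "\<lambda>k w xs ys. u (j, xs, w) * trunc \<phi> j xs w k * (v (w, ys, i) * trunc \<psi> w ys i (L - k))"
  have "coeff n (mk p \<phi> u \<otimes>\<^bsub>A\<^esub> mk q \<psi> v) j i L =
      (\<Sum>k\<le>L. \<Sum>w<n. \<Sum>xs\<in>words n p. \<Sum>ys\<in>words n q. ?t k w xs ys)"
    unfolding coeff_mult[OF mk_closed[OF u] mk_closed[OF v]] coeff_mk_trunc[OF u] coeff_mk_trunc[OF v] sum_product
    using adm by simp
  also have "\<dots> = (\<Sum>k\<le>L. \<Sum>xs\<in>words n p. \<Sum>w<n. \<Sum>ys\<in>words n q. ?t k w xs ys)"
    by (rule sum.cong[OF refl], rule sum.swap)
  also have "\<dots> = (\<Sum>k\<le>L. \<Sum>xs\<in>words n p. \<Sum>ys\<in>words n q. \<Sum>w<n. ?t k w xs ys)"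
    by (rule sum.cong[OF refl], rule sum.cong[OF refl], rule sum.swap)
  also have "\<dots> = (\<Sum>xs\<in>words n p. \<Sum>k\<le>L. \<Sum>ys\<in>words n q. \<Sum>w<n. ?t k w xs ys)"
    by (rule sum.swap)
  also have "\<dots> = (\<Sum>xs\<in>words n p. \<Sum>ys\<in>words n q. \<Sum>k\<le>L. \<Sum>w<n. ?t k w xs ys)"
    by (rule sum.cong[OF refl], rule sum.swap)
  also have "\<dots> = (\<Sum>xs\<in>words n p. \<Sum>ys\<in>words n q. (\<Sum>w<n. u (j, xs, w) * v (w, ys, i)) *
      (\<Sum>k\<le>L. trunc \<phi> j xs (mid j xs) k * trunc \<psi> (mid j xs) ys i (L - k)))"
  proof (intro sum.cong refl)
    fix xs ys
    have "(\<Sum>k\<le>L. \<Sum>w<n. ?t k w xs ys) = (\<Sum>w<n. \<Sum>k\<le>L. ?t k w xs ys)" by (rule sum.swap)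
    also have "\<dots> = (\<Sum>w<n. \<Sum>k\<le>L. u (j, xs, w) * v (w, ys, i) *
        (trunc \<phi> j xs (mid j xs) k * trunc \<psi> (mid j xs) ys i (L - k)))"
    proof (intro sum.cong refl)
      fix w k
      show "?t k w xs ys = u (j, xs, w) * v (w, ys, i) * (trunc \<phi> j xs (mid j xs) k * trunc \<psi> (mid j xs) ys i (L - k))"
      \<comment> \<open>A word with nonzero coefficient is a path, so its source \<open>w\<close> is
        determined by the word.\<close>
      proof (cases "u (j, xs, w) = 0")
        case False
        from is_path_mid[OF carrier_path_algebraD[OF W_closed[OF u] this]] have "mid j xs = w" by simp
        then show ?thesis by simp
      qed simp
    qed
    finally show "(\<Sum>k\<le>L. \<Sum>w<n. ?t k w xs ys) = (\<Sum>w<n. u (j, xs, w) * v (w, ys, i)) *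
      (\<Sum>k\<le>L. trunc \<phi> j xs (mid j xs) k * trunc \<psi> (mid j xs) ys i (L - k))"
      by (simp only: sum_product)
  qed
  also have "\<dots> = (\<Sum>zs\<in>words n (p + q). (\<Sum>w<n. u (j, take p zs, w) * v (w, drop p zs, i)) *
      (\<Sum>k\<le>L. trunc \<phi> j (take p zs) (mid j (take p zs)) k * trunc \<psi> (mid j (take p zs)) (drop p zs) i (L - k)))"
    using sum_words_split[of p "p + q" "\<lambda>xs ys. (\<Sum>w<n. u (j, xs, w) * v (w, ys, i)) *
      (\<Sum>k\<le>L. trunc \<phi> j xs (mid j xs) k * trunc \<psi> (mid j xs) ys i (L - k))" n] by simp
  also have "\<dots> = (\<Sum>zs\<in>words n (p + q). (u \<otimes>\<^bsub>P\<^esub> v) (j, zs, i) * conv_coeff p \<phi> \<psi> j zs i L)"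
  proof (intro sum.cong refl)
    fix zs assume "zs \<in> words n (p + q)"
    then show "(\<Sum>w<n. u (j, take p zs, w) * v (w, drop p zs, i)) *
      (\<Sum>k\<le>L. trunc \<phi> j (take p zs) (mid j (take p zs)) k * trunc \<psi> (mid j (take p zs)) (drop p zs) i (L - k))
      = (u \<otimes>\<^bsub>P\<^esub> v) (j, zs, i) * conv_coeff p \<phi> \<psi> j zs i L"
      unfolding conv_coeff_def tensor_power_mult[OF W_tensor_power[OF u]] by (simp add: words_def)
  qed
  finally show ?thesis .
qed

text \<open>Split off the leftmost arrow: \<open>w\<close> is the sum over all arrows
  \<open>x\<close> of \<open>arrow_vec x\<close> times the rest \<open>v x\<close> of the words of
  \<open>w\<close> beginning with \<open>x\<close>.\<close>

lemma W_2_factor: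
  assumes w: "(w :: 'f pvec) \<in> W n 2"
  shows "\<exists>(N::nat) u v. (\<forall>t<N. u t \<in> W n (Suc 0) \<and> v t \<in> W n (Suc 0)) \<and>
    w = (\<lambda>q. \<Sum>t<N. (u t \<otimes>\<^bsub>P\<^esub> v t) q)"
proof -
  define v where "v x = (\<lambda>(j, ys, i). if j = src x then w (tgt x, x # ys, i) else 0)" for x
  have v: "v x \<in> W n (Suc 0)" for x
    unfolding W_1 tensor_power_def
  proof (intro CollectI conjI allI impI)
    have "{q. v x q \<noteq> 0} \<subseteq> (\<lambda>(j, zs, i). (src x, tl zs, i)) ` {q. w q \<noteq> 0}"
    proof
      fix q assume q: "q \<in> {q. v x q \<noteq> 0}"
      obtain j ys i where [simp]: "q = (j, ys, i)" by (cases q)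
      from q have "j = src x" "w (tgt x, x # ys, i) \<noteq> 0" by (auto simp: v_def split: if_splits)
      then show "q \<in> (\<lambda>(j, zs, i). (src x, tl zs, i)) ` {q. w q \<noteq> 0}"
        by (intro image_eqI[of _ _ "(tgt x, x # ys, i)"]) auto
    qed
    moreover have "finite {q. w q \<noteq> 0}" using W_closed[OF w] by (simp add: carrier_path_algebra)
    ultimately have fin: "finite {q. v x q \<noteq> 0}" by (meson finite_imageI finite_subset)
    have "is_path n j ys i" if "v x (j, ys, i) \<noteq> 0" for j ys i
    proof -
      from that have "j = src x" "w (tgt x, x # ys, i) \<noteq> 0" by (auto simp: v_def split: if_splits)
      with carrier_path_algebraD[OF W_closed[OF w] this(2)] show ?thesis by simp
    qed
    with fin show "v x \<in> carrier P" by (auto simp: carrier_path_algebra paths_def)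
    fix j ys i assume "v x (j, ys, i) \<noteq> 0"
    then have "w (tgt x, x # ys, i) \<noteq> 0" by (auto simp: v_def split: if_splits)
    from W_length[OF w this] show "length ys = Suc 0" by (simp add: words_def)
  qed
  have factor: "(arrow_vec x \<otimes>\<^bsub>P\<^esub> v x) (j, zs, i) = (if zs \<noteq> [] \<and> hd zs = x then if j = tgt x then w (j, zs, i) else 0 else 0)"
    if x: "x \<in> arrows n" for x j zs i
  proof (cases zs)
    case Nil
    then show ?thesis unfolding tensor_power_mult[OF W_tensor_power[OF arrow_vec_in_W[OF x]]] by simp
  next
    case (Cons y ys)
    have "(arrow_vec x \<otimes>\<^bsub>P\<^esub> v x) (j, zs, i) = (\<Sum>k<n. arrow_vec x (j, [y], k) * v x (k, ys, i))"
      unfolding tensor_power_mult[OF W_tensor_power[OF arrow_vec_in_W[OF x]]] by (simp add: Cons)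
    also have "\<dots> = (\<Sum>k<n. if k = src x then if y = x \<and> j = tgt x then w (j, zs, i) else 0 else 0)"
      by (intro sum.cong refl) (auto simp: arrow_vec_def path_vec_def v_def Cons)
    also have "\<dots> = (if y = x \<and> j = tgt x then w (j, zs, i) else 0)"
      using arrows_bound[OF x] by simp
    finally show ?thesis by (simp add: Cons)
  qed
  have sum: "w q = (\<Sum>x\<in>arrows n. (arrow_vec x \<otimes>\<^bsub>P\<^esub> v x) q)" for q
  proof (cases q)
    case (fields j zs i)
    have "(\<Sum>x\<in>arrows n. (arrow_vec x \<otimes>\<^bsub>P\<^esub> v x) q) =
        (\<Sum>x\<in>arrows n. if x = hd zs then if zs \<noteq> [] \<and> j = tgt x then w (j, zs, i) else 0 else 0)"
      by (intro sum.cong refl) (simp add: fields factor)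
    also have "\<dots> = w q"
    proof (cases "w q = 0")
      case False
      then have nz: "w (j, zs, i) \<noteq> 0" by (simp add: fields)
      obtain x ys where "zs = x # ys" "x \<in> arrows n"
        using W_length[OF w nz] by (cases zs) (auto simp: words_def)
      moreover have "is_path n j zs i" by (rule carrier_path_algebraD[OF W_closed[OF w] nz])
      ultimately show ?thesis by (simp add: fields)
    qed (auto simp: fields)
    finally show ?thesis by (rule sym)
  qed
  \<comment> \<open>The definition of \<open>conv\<close> indexes decompositions by an initial
    segment of the naturals, so the arrows are enumerated.\<close>
  obtain e where e: "bij_betw e {..<card (arrows n)} (arrows n)"
    using ex_bij_betw_nat_finite[OF finite_arrows[of n]] by (auto simp: atLeast0LessThan)
  show ?thesis
  proof (intro exI conjI allI impI)
    show "w = (\<lambda>q. \<Sum>t<card (arrows n). ((arrow_vec \<circ> e) t \<otimes>\<^bsub>P\<^esub> (v \<circ> e) t) q)"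
      unfolding sum comp_def by (rule ext) (rule sum.reindex_bij_betw[OF e, symmetric])
    fix t assume "t < card (arrows n)"
    then have "e t \<in> arrows n" using e by (auto simp: bij_betw_def)
    then show "(arrow_vec \<circ> e) t \<in> W n (Suc 0)" "(v \<circ> e) t \<in> W n (Suc 0)"
      using v arrow_vec_in_W by simp_all
  qed
qed

lemma one_in_W: "\<one>\<^bsub>P\<^esub> \<in> W n 0"
  by (simp add: W_0 one_tensor_power)

text \<open>With a factor of degree 0 the unit gives a one-term decomposition, and in total degree
  at least 3 the empty sum suffices, so the only real case is \<open>p = q = 1\<close>.\<close>

lemma W_factor:
  assumes w: "(w :: 'f pvec) \<in> W n (p + q)"
  shows "\<exists>(N::nat) u v. (\<forall>t<N. u t \<in> W n p \<and> v t \<in> W n q) \<and> w = (\<lambda>r. \<Sum>t<N. (u t \<otimes>\<^bsub>P\<^esub> v t) r)"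
proof -
  note wc = W_closed[OF w]
  consider "p = 0" | "q = 0" | "p = Suc 0" "q = Suc 0" | "3 \<le> p + q" by linarith
  then show ?thesis
  proof cases
    case 1
    show ?thesis
      by (rule exI[of _ "Suc 0"], rule exI[of _ "\<lambda>t. \<one>\<^bsub>P\<^esub>"], rule exI[of _ "\<lambda>t. w"])
        (use w in \<open>simp add: 1 one_in_W path_one_mult[OF wc]\<close>)
  next
    case 2
    show ?thesis
      by (rule exI[of _ "Suc 0"], rule exI[of _ "\<lambda>t. w"], rule exI[of _ "\<lambda>t. \<one>\<^bsub>P\<^esub>"])
        (use w in \<open>simp add: 2 one_in_W path_mult_one[OF wc]\<close>)
  next
    case 3
    with w have "w \<in> W n 2" by (simp add: numeral_2_eq_2)
    from W_2_factor[OF this] show ?thesis unfolding 3 .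
  next
    case 4
    with w have "w = (\<lambda>r. 0)" by (simp add: W_ge_3)
    then show ?thesis by (intro exI[of _ 0]) simp
  qed
qed

text \<open>This settles the description in \<open>conv\<close>: a decomposition exists by
  \<open>W_factor\<close>, and by \<open>coeff_mk_mult\<close> all decompositions of
  \<open>w\<close> give the same coordinates.\<close>

lemma conv_mk: "conv n p q (mk p \<phi>) (mk q \<psi>) = mk (p + q) (conv_coeff p \<phi> \<psi>)"
proof (rule ext)
  fix w :: "'f pvec"
  let ?f = "mk p \<phi>" and ?g = "mk q \<psi>" and ?h = "mk (p + q) (conv_coeff p \<phi> \<psi>)"
  let ?Q = "\<lambda>y. \<exists>(N::nat) u v. (\<forall>t<N. u t \<in> W n p \<and> v t \<in> W n q) \<and>
     w = (\<Oplus>\<^bsub>P\<^esub>t\<in>{..<N}. u t \<otimes>\<^bsub>P\<^esub> v t) \<and> y = (\<Oplus>\<^bsub>A\<^esub>t\<in>{..<N}. ?f (u t) \<otimes>\<^bsub>A\<^esub> ?g (v t))"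
  show "conv n p q ?f ?g w = ?h w"
  proof (cases "w \<in> W n (p + q)")
    case True
    have result: "(\<Oplus>\<^bsub>A\<^esub>t\<in>{..<N}. ?f (u t) \<otimes>\<^bsub>A\<^esub> ?g (v t)) = ?h w"
      if uv: "\<And>t. t < N \<Longrightarrow> u t \<in> W n p \<and> v t \<in> W n q" and wsum: "\<And>r. w r = (\<Sum>t<N. (u t \<otimes>\<^bsub>P\<^esub> v t) r)"
      for N :: nat and u v
    proof (rule coeff_inject)
      have cl: "(\<lambda>t. ?f (u t) \<otimes>\<^bsub>A\<^esub> ?g (v t)) \<in> {..<N} \<rightarrow> carrier A"
        using uv mk_closed by (auto intro!: A.m_closed)
      then show "(\<Oplus>\<^bsub>A\<^esub>t\<in>{..<N}. ?f (u t) \<otimes>\<^bsub>A\<^esub> ?g (v t)) \<in> carrier A" by (rule A.finsum_closed)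
      show "?h w \<in> carrier A" by (rule mk_closed[OF True])
      fix j i L assume adm: "admissible n j i L"
      have "coeff n (\<Oplus>\<^bsub>A\<^esub>t\<in>{..<N}. ?f (u t) \<otimes>\<^bsub>A\<^esub> ?g (v t)) j i L = (\<Sum>t<N. coeff n (?f (u t) \<otimes>\<^bsub>A\<^esub> ?g (v t)) j i L)"
        by (rule coeff_finsum[OF cl])
      also have "\<dots> = (\<Sum>t<N. \<Sum>zs\<in>words n (p + q). (u t \<otimes>\<^bsub>P\<^esub> v t) (j, zs, i) * conv_coeff p \<phi> \<psi> j zs i L)"
        by (intro sum.cong refl coeff_mk_mult adm) (use uv in auto)
      also have "\<dots> = (\<Sum>zs\<in>words n (p + q). \<Sum>t<N. (u t \<otimes>\<^bsub>P\<^esub> v t) (j, zs, i) * conv_coeff p \<phi> \<psi> j zs i L)"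
        by (rule sum.swap)
      also have "\<dots> = coeff n (?h w) j i L"
        using adm by (simp add: coeff_mk[OF True] wsum sum_distrib_right)
      finally show "coeff n (\<Oplus>\<^bsub>A\<^esub>t\<in>{..<N}. ?f (u t) \<otimes>\<^bsub>A\<^esub> ?g (v t)) j i L = coeff n (?h w) j i L" .
    qed
    have pointwise: "(\<Oplus>\<^bsub>P\<^esub>t\<in>{..<N}. u t \<otimes>\<^bsub>P\<^esub> v t) r = (\<Sum>t<N. (u t \<otimes>\<^bsub>P\<^esub> v t) r)"
      if "\<And>t. t < N \<Longrightarrow> u t \<in> W n p \<and> v t \<in> W n q" for N :: nat and u v r
      by (rule path_finsum_apply) (use that W_closed in \<open>auto intro!: path_mult_closed\<close>)
    have "(THE y. ?Q y) = ?h w"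
    proof (rule the_equality)
      obtain N :: nat and u v where uv: "\<And>t. t < N \<Longrightarrow> u t \<in> W n p \<and> v t \<in> W n q"
        and wsum: "w = (\<lambda>r. \<Sum>t<N. (u t \<otimes>\<^bsub>P\<^esub> v t) r)"
        using W_factor[OF True] by blast
      have "w = (\<Oplus>\<^bsub>P\<^esub>t\<in>{..<N}. u t \<otimes>\<^bsub>P\<^esub> v t)"
        by (rule ext) (simp only: pointwise[OF uv], rule fun_cong[OF wsum])
      moreover have "?h w = (\<Oplus>\<^bsub>A\<^esub>t\<in>{..<N}. ?f (u t) \<otimes>\<^bsub>A\<^esub> ?g (v t))"
        by (rule result[OF uv fun_cong[OF wsum], symmetric])
      ultimately show "?Q (?h w)" using uv by blast
    next
      fix y assume "?Q y"
      then obtain N :: nat and u v where uv: "\<And>t. t < N \<Longrightarrow> u t \<in> W n p \<and> v t \<in> W n q"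
        and wsum: "w = (\<Oplus>\<^bsub>P\<^esub>t\<in>{..<N}. u t \<otimes>\<^bsub>P\<^esub> v t)"
        and y: "y = (\<Oplus>\<^bsub>A\<^esub>t\<in>{..<N}. ?f (u t) \<otimes>\<^bsub>A\<^esub> ?g (v t))"
        by blast
      have "w r = (\<Sum>t<N. (u t \<otimes>\<^bsub>P\<^esub> v t) r)" for r
        unfolding wsum by (rule pointwise[OF uv])
      note sums = this
      show "y = ?h w" unfolding y by (rule result[OF uv sums])
    qed
    then show ?thesis using True by (simp add: conv_def)
  next
    case False
    then show ?thesis by (simp add: conv_def mk_def)
  qed
qed

definition incl_coeff :: "nat \<Rightarrow> arrow list \<Rightarrow> nat \<Rightarrow> nat \<Rightarrow> 'f" where
  "incl_coeff j xs i L = (if L = Suc 0 then 1 else 0)"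

lemma incl_mk: "incl n = mk (Suc 0) incl_coeff"
proof (rule ext)
  fix w :: "'f pvec"
  show "incl n w = mk (Suc 0) incl_coeff w"
  proof (cases "w \<in> W n (Suc 0)")
    case True
    have "proj n w = mk (Suc 0) incl_coeff w"
    proof (rule coeff_inject)
      show "proj n w \<in> carrier A" by (rule proj_closed[OF W_closed[OF True]])
      show "mk (Suc 0) incl_coeff w \<in> carrier A" by (rule mk_closed[OF True])
      fix j i L assume adm: "admissible n j i L"
      have "path_coeff n w j i L = (\<Sum>xs\<in>words n (Suc 0). w (j, xs, i) * incl_coeff j xs i L)"
      proof (cases "L = Suc 0")
        case True
        then show ?thesis by (simp add: path_coeff_def incl_coeff_def)
      next
        case L: False
        have "w (j, xs, i) = 0" if "xs \<in> words n L" for xs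
          using W_length[OF True, of j xs i] L that by (auto simp: words_def)
        then show ?thesis using L by (simp add: path_coeff_def incl_coeff_def)
      qed
      then show "coeff n (proj n w) j i L = coeff n (mk (Suc 0) incl_coeff w) j i L"
        using adm by (simp add: coeff_proj[OF W_closed[OF True]] coeff_mk[OF True])
    qed
    then show ?thesis using True by (simp add: incl_def)
  next
    case False
    then show ?thesis by (simp add: incl_def mk_def)
  qed
qed

lemma mk_apply_eqI:
  assumes "w \<in> W n p" "X \<in> carrier A"
    and "\<And>j i L. admissible n j i L \<Longrightarrow> coeff n X j i L = (\<Sum>xs\<in>words n p. w (j, xs, i) * \<phi> j xs i L)"
  shows "X = mk p \<phi> w"
  by (rule coeff_inject[OF assms(2) mk_closed[OF assms(1)]]) (simp add: coeff_mk[OF assms(1)] assms(3))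

lemma bK_mk: "bK n p (mk p \<phi>) = mk (Suc p)
  (\<lambda>j xs i L. conv_coeff p \<phi> incl_coeff j xs i L - (- 1) ^ p * conv_coeff (Suc 0) incl_coeff \<phi> j xs i L)"
proof (rule ext)
  fix w :: "'f pvec"
  show "bK n p (mk p \<phi>) w = mk (Suc p)
    (\<lambda>j xs i L. conv_coeff p \<phi> incl_coeff j xs i L - (- 1) ^ p * conv_coeff (Suc 0) incl_coeff \<phi> j xs i L) w"
  proof (cases "w \<in> W n (Suc p)")
    case True
    have 1: "conv n p 1 (mk p \<phi>) (incl n) = mk (Suc p) (conv_coeff p \<phi> incl_coeff)"
      using conv_mk[of p "Suc 0" \<phi> incl_coeff] by (simp add: incl_mk)
    have 2: "conv n 1 p (incl n) (mk p \<phi>) = mk (Suc p) (conv_coeff (Suc 0) incl_coeff \<phi>)"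
      using conv_mk[of "Suc 0" p incl_coeff \<phi>] by (simp add: incl_mk)
    note cl = mk_closed[OF True]
    have "bK n p (mk p \<phi>) w = mk (Suc p) (conv_coeff p \<phi> incl_coeff) w \<ominus>\<^bsub>A\<^esub>
        ((- 1) ^ p) \<odot>\<^bsub>A\<^esub> mk (Suc p) (conv_coeff (Suc 0) incl_coeff \<phi>) w"
      unfolding bK_def 1 2 using True by simp
    also have "\<dots> = mk (Suc p) (\<lambda>j xs i L. conv_coeff p \<phi> incl_coeff j xs i L -
        (- 1) ^ p * conv_coeff (Suc 0) incl_coeff \<phi> j xs i L) w"
    proof (rule mk_apply_eqI[OF True])
      have cl2: "((- 1) ^ p) \<odot>\<^bsub>A\<^esub> mk (Suc p) (conv_coeff (Suc 0) incl_coeff \<phi>) w \<in> carrier A"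
        by (rule Am.smult_closed) (simp_all add: cl)
      then show "mk (Suc p) (conv_coeff p \<phi> incl_coeff) w \<ominus>\<^bsub>A\<^esub>
        ((- 1) ^ p) \<odot>\<^bsub>A\<^esub> mk (Suc p) (conv_coeff (Suc 0) incl_coeff \<phi>) w \<in> carrier A"
        by (rule A.minus_closed[OF cl])
      fix j i L assume "admissible n j i L"
      then show "coeff n (mk (Suc p) (conv_coeff p \<phi> incl_coeff) w \<ominus>\<^bsub>A\<^esub>
          ((- 1) ^ p) \<odot>\<^bsub>A\<^esub> mk (Suc p) (conv_coeff (Suc 0) incl_coeff \<phi>) w) j i L =
        (\<Sum>xs\<in>words n (Suc p). w (j, xs, i) * (conv_coeff p \<phi> incl_coeff j xs i L -
          (- 1) ^ p * conv_coeff (Suc 0) incl_coeff \<phi> j xs i L))"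
        unfolding coeff_minus[OF cl cl2] coeff_smult[OF cl] coeff_mk[OF True]
        by (simp add: sum_distrib_left sum_subtractf algebra_simps)
    qed
    finally show ?thesis .
  next
    case False
    then show ?thesis by (simp add: bK_def mk_def)
  qed
qed

lemma cup_mk: "cup_cochain n p q (mk p \<phi>) (mk q \<psi>) = mk (p + q) (\<lambda>j xs i L. (- 1) ^ (p * q) * conv_coeff p \<phi> \<psi> j xs i L)"
proof (rule ext)
  fix w :: "'f pvec"
  show "cup_cochain n p q (mk p \<phi>) (mk q \<psi>) w =
    mk (p + q) (\<lambda>j xs i L. (- 1) ^ (p * q) * conv_coeff p \<phi> \<psi> j xs i L) w"
  proof (cases "w \<in> W n (p + q)")
    case True
    have "((- 1) ^ (p * q)) \<odot>\<^bsub>A\<^esub> mk (p + q) (conv_coeff p \<phi> \<psi>) w =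
      mk (p + q) (\<lambda>j xs i L. (- 1) ^ (p * q) * conv_coeff p \<phi> \<psi> j xs i L) w"
    proof (rule mk_apply_eqI[OF True])
      show "((- 1) ^ (p * q)) \<odot>\<^bsub>A\<^esub> mk (p + q) (conv_coeff p \<phi> \<psi>) w \<in> carrier A"
        by (rule Am.smult_closed) (simp_all add: mk_closed[OF True])
      fix j i L assume "admissible n j i L"
      then show "coeff n (((- 1) ^ (p * q)) \<odot>\<^bsub>A\<^esub> mk (p + q) (conv_coeff p \<phi> \<psi>) w) j i L =
        (\<Sum>xs\<in>words n (p + q). w (j, xs, i) * ((- 1) ^ (p * q) * conv_coeff p \<phi> \<psi> j xs i L))"
        unfolding coeff_smult[OF mk_closed[OF True]] coeff_mk[OF True]
        by (simp add: sum_distrib_left algebra_simps)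
    qed
    then show ?thesis using True by (simp add: cup_cochain_def conv_mk)
  next
    case False
    then show ?thesis by (simp add: cup_cochain_def mk_def)
  qed
qed

end

subsection \<open>Cocycles and coboundaries\<close>

context preproj begin

lemma ball_arrows: "(\<forall>x\<in>arrows n. Q x) \<longleftrightarrow> (\<forall>i. Suc i < n \<longrightarrow> Q (Arr i) \<and> Q (Star i))"
  by (auto simp: arrows_def)

lemma admissible_commute: "admissible n j i L \<longleftrightarrow> admissible n i j L"
  by (auto simp: admissible_def add.commute)

lemma admissible_diag: "admissible n i i L \<longleftrightarrow> even L \<and> L \<le> 2 * i \<and> L + 2 * i \<le> 2 * (n - 1)"
  unfolding admissible_def by auto

lemma admissible_arrow:
  "admissible n (Suc i) i L \<longleftrightarrow> odd L \<and> L \<le> Suc (2 * i) \<and> L + Suc (2 * i) \<le> 2 * (n - 1)"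
  "admissible n i (Suc i) L \<longleftrightarrow> odd L \<and> L \<le> Suc (2 * i) \<and> L + Suc (2 * i) \<le> 2 * (n - 1)"
  unfolding admissible_def by (auto elim: oddE)

text \<open>Multiplication by an arrow shifts the length by one.\<close>

lemma sum_single:
  fixes g :: "nat \<Rightarrow> 'f"
  assumes "1 \<le> L"
  shows "(\<Sum>k\<le>L. g k * (if L - k = Suc 0 then 1 else 0)) = g (L - 1)"
    and "(\<Sum>k\<le>L. (if k = Suc 0 then 1 else 0) * g (L - k)) = g (L - 1)"
proof -
  have "(\<Sum>k\<le>L. g k * (if L - k = Suc 0 then 1 else 0)) = (\<Sum>k\<le>L. if k = L - 1 then g (L - 1) else 0)"
    by (intro sum.cong refl) (use assms in auto)
  then show "(\<Sum>k\<le>L. g k * (if L - k = Suc 0 then 1 else 0)) = g (L - 1)" by simp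
  have "(\<Sum>k\<le>L. (if k = Suc 0 then 1 else 0) * g (L - k)) = (\<Sum>k\<le>L. if k = 1 then g (L - 1) else 0)"
    by (intro sum.cong refl) auto
  then show "(\<Sum>k\<le>L. (if k = Suc 0 then 1 else 0) * g (L - k)) = g (L - 1)" using assms by simp
qed

lemma trunc_incl:
  "x \<in> arrows n \<Longrightarrow> trunc incl_coeff (tgt x) [x] (src x) L = (if L = Suc 0 then 1 else 0)"
  by (auto simp: trunc_def incl_coeff_def arrows_def admissible_arrow)

lemma mid_single [simp]: "mid j [x] = src x" "mid j [] = j" "mid j [y, x] = src x"
  by (simp_all add: mid_def)

lemma conv_incl_right:
  assumes "x \<in> arrows n" "1 \<le> L" "j = tgt x"
  shows "conv_coeff 0 \<phi> incl_coeff j [x] (src x) L = trunc \<phi> j [] j (L - 1)"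
  using assms by (simp add: conv_coeff_def trunc_incl sum_single(1))

lemma conv_incl_left:
  assumes "x \<in> arrows n" "1 \<le> L" "i = src x"
  shows "conv_coeff (Suc 0) incl_coeff \<phi> (tgt x) (x # xs) i' L = trunc \<phi> i xs i' (L - 1)"
  using assms by (simp add: conv_coeff_def trunc_incl sum_single(2))

lemma conv_incl_right_1:
  assumes "y \<in> arrows n" "1 \<le> L" "src x = tgt y"
  shows "conv_coeff (Suc 0) \<phi> incl_coeff j [x, y] (src y) L = trunc \<phi> j [x] (src x) (L - 1)"
  using assms by (simp add: conv_coeff_def trunc_incl sum_single(1))

lemma bK_mk_0: "bK n 0 (mk 0 \<phi>) = mk (Suc 0) (\<lambda>j xs i L. \<phi> j [] j (L - 1) - \<phi> i [] i (L - 1))"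
  unfolding bK_mk mk_eq_1 ball_arrows
proof (intro allI impI conjI)
  fix i L assume i: "Suc i < n"
  then have x: "Arr i \<in> arrows n" "Star i \<in> arrows n" by (auto simp: arrows_def)
  \<comment> \<open>A length admissible along an arrow is odd, and one less is admissible at both of
    its end points, so truncation has no effect.\<close>
  have t: "trunc \<phi> (Suc i) [] (Suc i) (L - 1) = \<phi> (Suc i) [] (Suc i) (L - 1)"
    "trunc \<phi> i [] i (L - 1) = \<phi> i [] i (L - 1)" "1 \<le> L"
    if "odd L \<and> L \<le> Suc (2 * i) \<and> L + Suc (2 * i) \<le> 2 * (n - 1)"
    using that by (auto simp: trunc_def admissible_diag elim!: oddE)
  show "conv_coeff 0 \<phi> incl_coeff (tgt (Arr i)) [Arr i] (src (Arr i)) L -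
      (- 1) ^ 0 * conv_coeff (Suc 0) incl_coeff \<phi> (tgt (Arr i)) [Arr i] (src (Arr i)) L =
    \<phi> (tgt (Arr i)) [] (tgt (Arr i)) (L - 1) - \<phi> (src (Arr i)) [] (src (Arr i)) (L - 1)"
    if "admissible n (tgt (Arr i)) (src (Arr i)) L"
    using that t conv_incl_right[OF x(1), of L "Suc i" \<phi>] conv_incl_left[OF x(1), of L i \<phi> "[]" i]
    by (simp add: admissible_arrow)
  show "conv_coeff 0 \<phi> incl_coeff (tgt (Star i)) [Star i] (src (Star i)) L -
      (- 1) ^ 0 * conv_coeff (Suc 0) incl_coeff \<phi> (tgt (Star i)) [Star i] (src (Star i)) L =
    \<phi> (tgt (Star i)) [] (tgt (Star i)) (L - 1) - \<phi> (src (Star i)) [] (src (Star i)) (L - 1)"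
    if "admissible n (tgt (Star i)) (src (Star i)) L"
    using that t conv_incl_right[OF x(2), of L i \<phi>] conv_incl_left[OF x(2), of L "Suc i" \<phi> "[]" "Suc i"]
    by (simp add: admissible_arrow)
qed

text \<open>For a cochain of degree one only the sum of its coefficients along \<open>a\<^sub>i\<close> and \<open>a\<^sub>i\<^sup>*\<close> enters its
  differential.\<close>

definition arrow_coeff :: "(nat \<Rightarrow> arrow list \<Rightarrow> nat \<Rightarrow> nat \<Rightarrow> 'f) \<Rightarrow> nat \<Rightarrow> nat \<Rightarrow> 'f" where
  "arrow_coeff \<phi> i L = \<phi> (Suc i) [Arr i] i L + \<phi> i [Star i] (Suc i) L"

text \<open>In degree 1 the two halves of the differential are added. The dip in
  \<open>sigma n i\<close> collects the values on \<open>Arr (i - 1)\<close> and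
  \<open>Star (i - 1)\<close>, the peak those on \<open>Arr i\<close> and \<open>Star i\<close>,
  with opposite signs.\<close>

lemma rel_coeff_bK:
  assumes adm: "admissible n i i L"
  shows "rel_coeff (\<lambda>j xs i L. conv_coeff (Suc 0) \<phi> incl_coeff j xs i L -
      (- 1) ^ Suc 0 * conv_coeff (Suc 0) incl_coeff \<phi> j xs i L) i L =
    (if L = 0 then 0 else arrow_coeff \<phi> (i - 1) (L - 1) - arrow_coeff \<phi> i (L - 1))"
proof (cases "L = 0")
  case True
  \<comment> \<open>One factor is an arrow, so products of length 0 do not occur.\<close>
  have "conv_coeff (Suc 0) \<phi> incl_coeff i [x, y] i 0 = 0 \<and> conv_coeff (Suc 0) incl_coeff \<phi> i [x, y] i 0 = 0" for x y
    by (simp add: conv_coeff_def trunc_def incl_coeff_def)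
  with True show ?thesis by (simp add: rel_coeff_def)
next
  case False
  with adm have L: "2 \<le> L" by (auto simp: admissible_diag)
  with adm have i: "0 < i" "i < n - 1" by (auto simp: admissible_diag)
  then obtain i' where i': "i = Suc i'" by (cases i) auto
  have x: "Arr i' \<in> arrows n" "Star i' \<in> arrows n" "Arr i \<in> arrows n" "Star i \<in> arrows n"
    using i i' by (auto simp: arrows_def)
  have "odd (L - 1)" using adm L by (auto simp: admissible_diag)
  then have t: "trunc \<phi> i [Arr i'] i' (L - 1) = \<phi> i [Arr i'] i' (L - 1)"
    "trunc \<phi> i' [Star i'] i (L - 1) = \<phi> i' [Star i'] i (L - 1)"
    "trunc \<phi> i [Star i] (Suc i) (L - 1) = \<phi> i [Star i] (Suc i) (L - 1)"
    "trunc \<phi> (Suc i) [Arr i] i (L - 1) = \<phi> (Suc i) [Arr i] i (L - 1)"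
    using adm L unfolding i' by (auto simp: trunc_def admissible_arrow admissible_diag)
  have "conv_coeff (Suc 0) \<phi> incl_coeff i [Arr i', Star i'] i L = \<phi> i [Arr i'] i' (L - 1)"
    using conv_incl_right_1[OF x(2), of L "Arr i'" \<phi> i] L t by (simp add: i')
  moreover have "conv_coeff (Suc 0) incl_coeff \<phi> i [Arr i', Star i'] i L = \<phi> i' [Star i'] i (L - 1)"
    using conv_incl_left[OF x(1), of L i' \<phi> "[Star i']" i] L t by (simp add: i')
  moreover have "conv_coeff (Suc 0) \<phi> incl_coeff i [Star i, Arr i] i L = \<phi> i [Star i] (Suc i) (L - 1)"
    using conv_incl_right_1[OF x(3), of L "Star i" \<phi> i] L t by simp
  moreover have "conv_coeff (Suc 0) incl_coeff \<phi> i [Star i, Arr i] i L = \<phi> (Suc i) [Arr i] i (L - 1)"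
    using conv_incl_left[OF x(4), of L "Suc i" \<phi> "[Arr i]" i] L t by simp
  ultimately show ?thesis
    using L i by (simp add: rel_coeff_def arrow_coeff_def i')
qed

lemma bK_mk_1_eq_iff:
  "bK n (Suc 0) (mk (Suc 0) \<phi>) = mk 2 \<psi> \<longleftrightarrow>
   (\<forall>i L. admissible n i i L \<longrightarrow>
      (if L = 0 then 0 else arrow_coeff \<phi> (i - 1) (L - 1) - arrow_coeff \<phi> i (L - 1)) = rel_coeff \<psi> i L)"
proof -
  have "bK n (Suc 0) (mk (Suc 0) \<phi>) = mk 2 \<psi> \<longleftrightarrow> (\<forall>i<n. \<forall>L. admissible n i i L \<longrightarrow>
      (if L = 0 then 0 else arrow_coeff \<phi> (i - 1) (L - 1) - arrow_coeff \<phi> i (L - 1)) = rel_coeff \<psi> i L)"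
    unfolding bK_mk numeral_2_eq_2[symmetric] mk_eq_2 by (simp only: rel_coeff_bK cong: imp_cong)
  then show ?thesis using admissible_less by blast
qed

lemma zero_cochain: "\<zero>\<^bsub>cochains n p\<^esub> = mk p (\<lambda>j xs i L. 0)"
proof (rule ext)
  fix w :: "'f pvec"
  show "\<zero>\<^bsub>cochains n p\<^esub> w = mk p (\<lambda>j xs i L. 0) w"
  proof (cases "w \<in> W n p")
    case True
    have "\<zero>\<^bsub>A\<^esub> = mk p (\<lambda>j xs i L. 0) w"
      by (rule mk_apply_eqI[OF True]) (simp_all add: coeff_zero)
    then show ?thesis using True by (simp add: cochains_def)
  qed (simp add: cochains_def mk_def)
qed

lemma cocycleE:
  assumes "f \<in> cocycles n p"
  obtains \<phi> where "f = mk p \<phi>"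
  using Hom_eq_mk[of f p] assms unfolding cocycles_def by blast

lemma cocycle_0_iff:
  "mk 0 \<phi> \<in> cocycles n 0 \<longleftrightarrow>
   (\<forall>i L. admissible n (Suc i) i L \<longrightarrow> \<phi> (Suc i) [] (Suc i) (L - 1) = \<phi> i [] i (L - 1))"
proof -
  have "mk 0 \<phi> \<in> cocycles n 0 \<longleftrightarrow> (\<forall>i. Suc i < n \<longrightarrow>
      (\<forall>L. admissible n (Suc i) i L \<longrightarrow> \<phi> (Suc i) [] (Suc i) (L - 1) - \<phi> i [] i (L - 1) = 0) \<and>
      (\<forall>L. admissible n i (Suc i) L \<longrightarrow> \<phi> i [] i (L - 1) - \<phi> (Suc i) [] (Suc i) (L - 1) = 0))"
    by (simp add: cocycles_def mk_in_Hom bK_mk_0 zero_cochain mk_eq_1 ball_arrows)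
  also have "\<dots> \<longleftrightarrow> (\<forall>i L. admissible n (Suc i) i L \<longrightarrow> \<phi> (Suc i) [] (Suc i) (L - 1) = \<phi> i [] i (L - 1))"
    using admissible_less admissible_commute by (metis eq_iff_diff_eq_0)
  finally show ?thesis .
qed

lemma cocycle_1_iff:
  "mk (Suc 0) \<phi> \<in> cocycles n (Suc 0) \<longleftrightarrow>
   (\<forall>i L. admissible n i i L \<longrightarrow> 0 < L \<longrightarrow> arrow_coeff \<phi> (i - 1) (L - 1) = arrow_coeff \<phi> i (L - 1))"
proof -
  have "rel_coeff (\<lambda>j xs i L. 0) i L = 0" for i L by (simp add: rel_coeff_def)
  moreover have "mk (Suc 0) \<phi> \<in> cocycles n (Suc 0) \<longleftrightarrow> bK n (Suc 0) (mk (Suc 0) \<phi>) = mk 2 (\<lambda>j xs i L. 0)"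
    by (simp add: cocycles_def mk_in_Hom zero_cochain numeral_2_eq_2)
  ultimately show ?thesis unfolding bK_mk_1_eq_iff by auto
qed

text \<open>The differential takes values in cochains on a zero space.\<close>

lemma cocycle_ge_2: "2 \<le> p \<Longrightarrow> mk p \<phi> \<in> cocycles n p"
  by (simp add: cocycles_def mk_in_Hom zero_cochain bK_mk) (rule mk_eq_3, simp)

text \<open>Coordinates on cohomology. The coefficients of a cocycle of degree 0 or 1 in a given length do not
  depend on the vertex, so they are read off at the first vertex where this length is admissible.\<close>

definition lam :: "nat \<Rightarrow> nat \<Rightarrow> 'f cochain \<Rightarrow> 'f" where
  "lam p l f =
    (if p = 0 then coeff n (f (vertex l)) l l (2 * l)
     else if p = 1 then coeff n (f (arrow_vec (Arr l))) (Suc l) l (Suc (2 * l))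
       + coeff n (f (arrow_vec (Star l))) l (Suc l) (Suc (2 * l))
     else if p = 2 then coeff n (f (sigma n l)) l l 0 else 0)"

text \<open>The lengths in which classes can live: \<open>2 * l\<close> is admissible at vertex
  \<open>l\<close> exactly if \<open>2 * l + 1 \<le> n\<close>, and \<open>2 * l + 1\<close> along
  the arrows \<open>Arr l\<close> and \<open>Star l\<close> exactly if
  \<open>2 * l + 2 \<le> n\<close>. In degree 2 the index is a vertex and the length is 0.\<close>

definition idx :: "nat \<Rightarrow> nat set" where
  "idx p = (if p = 0 then {l. Suc (2 * l) \<le> n} else if p = 1 then {l. Suc (Suc (2 * l)) \<le> n}
     else if p = 2 then {..<n} else {})"

lemma lam_mk_0: "l \<in> idx 0 \<Longrightarrow> lam 0 l (mk 0 \<phi>) = \<phi> l [] l (2 * l)"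
  unfolding lam_def idx_def by (subst if_P[OF refl], subst coeff_mk_vertex) (auto simp: admissible_diag)

lemma lam_mk_1: "l \<in> idx (Suc 0) \<Longrightarrow> lam (Suc 0) l (mk (Suc 0) \<phi>) = arrow_coeff \<phi> l (Suc (2 * l))"
  unfolding lam_def idx_def arrow_coeff_def
  by (simp add: coeff_mk_arrow arrows_def admissible_arrow)

lemma lam_mk_2: "l \<in> idx 2 \<Longrightarrow> lam 2 l (mk 2 \<phi>) = rel_coeff \<phi> l 0"
  unfolding lam_def idx_def by (simp add: coeff_mk_sigma admissible_diag)

text \<open>The vertices admitting length \<open>2 * k\<close> form the interval from
  \<open>k\<close> to \<open>n - 1 - k\<close>. Any arrow inside it admits length
  \<open>2 * k + 1\<close>, so the cocycle condition carries the value from \<open>k\<close> to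
  every vertex of the interval.\<close>

lemma cocycle_0_const:
  assumes "mk 0 \<phi> \<in> cocycles n 0" "admissible n i i L"
  shows "\<phi> i [] i L = lam 0 (L div 2) (mk 0 \<phi>)" and "L div 2 \<in> idx 0"
proof -
  obtain k where k: "L = 2 * k" using assms(2) by (auto simp: admissible_diag)
  from assms(2) have ki: "k \<le> i" "k + i \<le> n - 1" by (auto simp: admissible_diag k)
  then show idx: "L div 2 \<in> idx 0" using n3 by (auto simp: idx_def k)
  have "k + i \<le> n - 1 \<longrightarrow> \<phi> i [] i L = \<phi> k [] k L"
    using ki(1)
  proof (induction i rule: dec_induct)
    case (step i)
    show ?case
    proof
      assume le: "k + Suc i \<le> n - 1"
      then have "admissible n (Suc i) i (Suc L)" using step by (auto simp: admissible_arrow k)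
      with assms(1) have "\<phi> (Suc i) [] (Suc i) (Suc L - 1) = \<phi> i [] i (Suc L - 1)"
        unfolding cocycle_0_iff by blast
      with step le show "\<phi> (Suc i) [] (Suc i) L = \<phi> k [] k L" by simp
    qed
  qed simp
  with ki show "\<phi> i [] i L = lam 0 (L div 2) (mk 0 \<phi>)" using lam_mk_0[OF idx] by (simp add: k)
qed

text \<open>As in degree 0, with arrows and vertices exchanged: neighbouring arrows are compared
  through the relation at the vertex between them.\<close>

lemma cocycle_1_const:
  assumes "mk (Suc 0) \<phi> \<in> cocycles n (Suc 0)" "admissible n (Suc i) i L"
  shows "arrow_coeff \<phi> i L = lam (Suc 0) (L div 2) (mk (Suc 0) \<phi>)" and "L div 2 \<in> idx (Suc 0)"
proof -
  obtain k where k: "L = Suc (2 * k)" using assms(2) by (auto simp: admissible_arrow elim!: oddE)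
  from assms(2) have ki: "k \<le> i" "Suc (k + i) \<le> n - 1" by (auto simp: admissible_arrow k)
  then show idx: "L div 2 \<in> idx (Suc 0)" by (auto simp: idx_def k)
  have "Suc (k + i) \<le> n - 1 \<longrightarrow> arrow_coeff \<phi> i L = arrow_coeff \<phi> k L"
    using ki(1)
  proof (induction i rule: dec_induct)
    case (step i)
    show ?case
    proof
      assume le: "Suc (k + Suc i) \<le> n - 1"
      then have "admissible n (Suc i) (Suc i) (Suc L)" using step by (auto simp: admissible_diag k)
      with assms(1) have "arrow_coeff \<phi> (Suc i - 1) (Suc L - 1) = arrow_coeff \<phi> (Suc i) (Suc L - 1)"
        unfolding cocycle_1_iff by blast
      with step le show "arrow_coeff \<phi> (Suc i) L = arrow_coeff \<phi> k L" by simp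
    qed
  qed simp
  with ki show "arrow_coeff \<phi> i L = lam (Suc 0) (L div 2) (mk (Suc 0) \<phi>)" using lam_mk_1[OF idx] by (simp add: k)
qed

text \<open>In degrees 0 and 1 the functionals control all visible coefficients, by constancy along
  the quiver. Primitives are then built by summation along the line: in degree 1 as a potential on
  the vertices, in degree 2 as partial sums that telescope. In degree at least 3 everything is
  zero.\<close>

lemma coboundary_iff:
  assumes f: "f \<in> cocycles n p"
  shows "f \<in> coboundaries n p \<longleftrightarrow> (\<forall>l\<in>idx p. lam p l f = 0)"
proof -
  obtain \<phi> where \<phi>: "f = mk p \<phi>" using cocycleE[OF f] .
  consider "p = 0" | "p = Suc 0" | "p = 2" | "3 \<le> p" by linarith
  then show ?thesis
  proof cases
    case 1
    have "f \<in> coboundaries n p \<longleftrightarrow> (\<forall>i L. admissible n i i L \<longrightarrow> \<phi> i [] i L = 0)"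
      unfolding \<phi> 1 using admissible_less by (auto simp: coboundaries_def zero_cochain mk_eq_0)
    also have "\<dots> \<longleftrightarrow> (\<forall>l\<in>idx p. lam p l f = 0)"
    proof
      assume all: "\<forall>i L. admissible n i i L \<longrightarrow> \<phi> i [] i L = 0"
      show "\<forall>l\<in>idx p. lam p l f = 0"
      proof
        fix l assume l: "l \<in> idx p"
        then have "admissible n l l (2 * l)" by (auto simp: 1 idx_def admissible_diag)
        with all l show "lam p l f = 0" unfolding \<phi> 1 by (simp add: lam_mk_0)
      qed
    next
      assume "\<forall>l\<in>idx p. lam p l f = 0"
      with f show "\<forall>i L. admissible n i i L \<longrightarrow> \<phi> i [] i L = 0"
        unfolding \<phi> 1 using cocycle_0_const[of \<phi>] by (metis \<phi> 1)
    qed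
    finally show ?thesis .
  next
    case 2
    show ?thesis
    proof
      assume "f \<in> coboundaries n p"
      then obtain g where g: "g \<in> Hom_ke n 0" "f = bK n 0 g" by (auto simp: coboundaries_def 2)
      obtain \<psi> where \<psi>: "g = mk 0 \<psi>" using Hom_eq_mk[OF g(1)] by blast
      show "\<forall>l\<in>idx p. lam p l f = 0"
        unfolding g(2) \<psi> bK_mk_0 2 by (simp add: lam_mk_1 arrow_coeff_def)
    next
      assume all: "\<forall>l\<in>idx p. lam p l f = 0"
      have zero: "arrow_coeff \<phi> i L = 0" if "admissible n (Suc i) i L" for i L
        using cocycle_1_const[OF f[unfolded \<phi> 2] that] all unfolding \<phi> 2 by simp
      \<comment> \<open>A potential whose differences are the values on the arrows
        \<open>Arr k\<close>; the values on \<open>Star k\<close> then match because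
        \<open>arrow_coeff\<close> vanishes. Terms at inadmissible places may occur, but they cancel
        in the differences.\<close>
      define \<psi> where "\<psi> j xs i L = (\<Sum>k<j. \<phi> (Suc k) [Arr k] k (Suc L))" for j i L :: nat and xs :: "arrow list"
      have "mk (Suc 0) \<phi> = bK n 0 (mk 0 \<psi>)"
        unfolding bK_mk_0 mk_eq_1 ball_arrows
      proof (intro allI impI conjI)
        fix i L assume "admissible n (tgt (Arr i)) (src (Arr i)) L"
        then have "Suc (L - 1) = L" by (auto simp: admissible_arrow elim: oddE)
        then show "\<phi> (tgt (Arr i)) [Arr i] (src (Arr i)) L =
            \<psi> (tgt (Arr i)) [] (tgt (Arr i)) (L - 1) - \<psi> (src (Arr i)) [] (src (Arr i)) (L - 1)"
          by (simp add: \<psi>_def)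
      next
        fix i L assume adm: "admissible n (tgt (Star i)) (src (Star i)) L"
        then have "Suc (L - 1) = L" by (auto simp: admissible_arrow elim: oddE)
        moreover have "arrow_coeff \<phi> i L = 0" using zero adm by (simp add: admissible_commute)
        ultimately show "\<phi> (tgt (Star i)) [Star i] (src (Star i)) L =
            \<psi> (tgt (Star i)) [] (tgt (Star i)) (L - 1) - \<psi> (src (Star i)) [] (src (Star i)) (L - 1)"
          by (simp add: \<psi>_def arrow_coeff_def eq_neg_iff_add_eq_0 add.commute)
      qed
      then show "f \<in> coboundaries n p" unfolding coboundaries_def \<phi> 2 using mk_in_Hom by auto
    qed
  next
    case 3
    show ?thesis
    proof
      assume "f \<in> coboundaries n p"
      then obtain g where g: "g \<in> Hom_ke n (Suc 0)" "f = bK n (Suc 0) g"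
        by (auto simp: coboundaries_def 3 numeral_2_eq_2)
      obtain \<psi> where \<psi>: "g = mk (Suc 0) \<psi>" using Hom_eq_mk[OF g(1)] by blast
      have e: "bK n (Suc 0) (mk (Suc 0) \<psi>) = mk 2 \<phi>" using g \<psi> \<phi> 3 by simp
      show "\<forall>l\<in>idx p. lam p l f = 0"
      proof
        fix l assume l: "l \<in> idx p"
        then have "admissible n l l 0" by (auto simp: idx_def 3 admissible_diag)
        with e have "rel_coeff \<phi> l 0 = 0" unfolding bK_mk_1_eq_iff by fastforce
        with l show "lam p l f = 0" unfolding \<phi> 3 by (simp add: lam_mk_2)
      qed
    next
      assume all: "\<forall>l\<in>idx p. lam p l f = 0"
      \<comment> \<open>Only the sum along \<open>Arr i\<close> and \<open>Star i\<close> enters the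
        differential, so all of it is put on \<open>Arr i\<close>. The sign is chosen so that the
        differences of consecutive sums give \<open>rel_coeff \<phi> i\<close>.\<close>
      define \<psi> where "\<psi> j xs i L = (if xs = [Arr i] then - (\<Sum>k\<le>i. rel_coeff \<phi> k (Suc L)) else 0)"
        for j i L :: nat and xs
      have ac: "arrow_coeff \<psi> i L = - (\<Sum>k\<le>i. rel_coeff \<phi> k (Suc L))" for i L
        by (simp add: arrow_coeff_def \<psi>_def)
      have "bK n (Suc 0) (mk (Suc 0) \<psi>) = mk 2 \<phi>"
        unfolding bK_mk_1_eq_iff
      proof (intro allI impI)
        fix i L assume adm: "admissible n i i L"
        show "(if L = 0 then 0 else arrow_coeff \<psi> (i - 1) (L - 1) - arrow_coeff \<psi> i (L - 1)) = rel_coeff \<phi> i L"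
        \<comment> \<open>The differential cannot reach length 0; there the vanishing of the
          functionals is exactly what is required.\<close>
        proof (cases "L = 0")
          case True
          have "i \<in> idx p" using admissible_less[OF adm] by (simp add: idx_def 3)
          with all have "rel_coeff \<phi> i 0 = 0" unfolding \<phi> 3 using lam_mk_2[of i \<phi>] by simp
          with True show ?thesis by simp
        next
          case False
          with adm have "0 < i" by (auto simp: admissible_diag)
          then obtain i' where "i = Suc i'" by (cases i) auto
          with False show ?thesis by (simp add: ac)
        qed
      qed
      then have "f = bK n (Suc 0) (mk (Suc 0) \<psi>)" unfolding \<phi> 3 by (rule sym)
      then show "f \<in> coboundaries n p" using mk_in_Hom by (auto simp: coboundaries_def 3)
    qed
  next
    case 4
    have "f = bK n (p - 1) (mk (p - 1) (\<lambda>j xs i L. 0))"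
      unfolding \<phi> bK_mk using mk_eq_3[OF 4] 4 by simp
    then have "f \<in> coboundaries n p" using 4 mk_in_Hom by (auto simp: coboundaries_def)
    moreover have "idx p = {}" using 4 by (simp add: idx_def)
    ultimately show ?thesis by simp
  qed
qed

end

subsection \<open>The cohomology spaces\<close>

lemma sum_even:
  fixes g :: "nat \<Rightarrow> 'f::comm_monoid_add"
  assumes "\<And>k. odd k \<Longrightarrow> g k = 0"
  shows "(\<Sum>k\<le>2 * l. g k) = (\<Sum>k\<le>l. g (2 * k))" and "(\<Sum>k\<le>Suc (2 * l). g k) = (\<Sum>k\<le>l. g (2 * k))"
proof -
  show "(\<Sum>k\<le>2 * l. g k) = (\<Sum>k\<le>l. g (2 * k))"
    by (induction l) (simp_all add: assms)
  then show "(\<Sum>k\<le>Suc (2 * l). g k) = (\<Sum>k\<le>l. g (2 * k))"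
    by (simp add: assms)
qed

lemma sum_reverse: "(\<Sum>k\<le>L. g k (L - k)) = (\<Sum>k\<le>(L::nat). g (L - k) k)"
  by (rule sum.reindex_bij_witness[where i = "\<lambda>k. L - k" and j = "\<lambda>k. L - k"]) auto

context preproj begin

section \<open>Cup products of cocycles in coordinates\<close>

lemma trunc_cocycle_0:
  assumes "mk 0 \<phi> \<in> cocycles n 0" "admissible n i i (2 * k)"
  shows "trunc \<phi> i [] i (2 * k) = lam 0 k (mk 0 \<phi>)"
  using cocycle_0_const(1)[OF assms] assms(2) by (simp add: trunc_def)

text \<open>Closed paths have even length, and the value of a 0-cocycle depends on the length alone,
  so the result is a product of polynomials independent of the vertex.\<close>

lemma conv_coeff_0_0:
  assumes f: "mk 0 \<phi> \<in> cocycles n 0" and g: "mk 0 \<psi> \<in> cocycles n 0" and adm: "admissible n i i L"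
  shows "conv_coeff 0 \<phi> \<psi> i [] i L = (\<Sum>k\<le>L div 2. lam 0 k (mk 0 \<phi>) * lam 0 (L div 2 - k) (mk 0 \<psi>))"
proof -
  obtain l where l: "L = 2 * l" using adm by (auto simp: admissible_diag)
  have "conv_coeff 0 \<phi> \<psi> i [] i L = (\<Sum>k\<le>2 * l. trunc \<phi> i [] i k * trunc \<psi> i [] i (2 * l - k))"
    by (simp add: conv_coeff_def l)
  also have "\<dots> = (\<Sum>k\<le>l. trunc \<phi> i [] i (2 * k) * trunc \<psi> i [] i (2 * l - 2 * k))"
    by (rule sum_even) (simp add: trunc_def admissible_diag)
  also have "\<dots> = (\<Sum>k\<le>l. lam 0 k (mk 0 \<phi>) * lam 0 (l - k) (mk 0 \<psi>))"
  proof (intro sum.cong refl)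
    fix k assume "k \<in> {..l}"
    then have "admissible n i i (2 * k)" "admissible n i i (2 * (l - k))"
      using adm by (auto simp: admissible_diag l)
    then show "trunc \<phi> i [] i (2 * k) * trunc \<psi> i [] i (2 * l - 2 * k) = lam 0 k (mk 0 \<phi>) * lam 0 (l - k) (mk 0 \<psi>)"
      using trunc_cocycle_0[OF f, of i k] trunc_cocycle_0[OF g, of i "l - k"] by (simp add: diff_mult_distrib2)
  qed
  finally show ?thesis by (simp add: l)
qed

text \<open>The 0-cocycle takes equal values at both ends of an arrow, so it can be pulled out of
  the sum of the contributions of \<open>Arr i\<close> and \<open>Star i\<close>.\<close>

lemma conv_coeff_0_1:
  assumes f: "mk 0 \<phi> \<in> cocycles n 0" and g: "mk (Suc 0) \<psi> \<in> cocycles n (Suc 0)" and adm: "admissible n (Suc i) i L"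
  shows "arrow_coeff (conv_coeff 0 \<phi> \<psi>) i L =
    (\<Sum>k\<le>L div 2. lam 0 k (mk 0 \<phi>) * lam (Suc 0) (L div 2 - k) (mk (Suc 0) \<psi>))"
proof -
  obtain l where l: "L = Suc (2 * l)" using adm by (auto simp: admissible_arrow elim!: oddE)
  let ?t = "\<lambda>k. trunc \<phi> (Suc i) [] (Suc i) k * trunc \<psi> (Suc i) [Arr i] i (L - k)
      + trunc \<phi> i [] i k * trunc \<psi> i [Star i] (Suc i) (L - k)"
  have "arrow_coeff (conv_coeff 0 \<phi> \<psi>) i L = (\<Sum>k\<le>Suc (2 * l). ?t k)"
    by (simp only: arrow_coeff_def conv_coeff_def sum.distrib l take_0 drop_0 mid_single)
  also have "\<dots> = (\<Sum>k\<le>l. ?t (2 * k))"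
    by (rule sum_even(2)) (simp add: trunc_def admissible_diag)
  also have "\<dots> = (\<Sum>k\<le>l. lam 0 k (mk 0 \<phi>) * lam (Suc 0) (l - k) (mk (Suc 0) \<psi>))"
  proof (intro sum.cong refl)
    fix k assume k: "k \<in> {..l}"
    have a0: "admissible n (Suc i) (Suc i) (2 * k)" "admissible n i i (2 * k)"
      using adm k by (auto simp: admissible_diag admissible_arrow l)
    have L: "L - 2 * k = Suc (2 * (l - k))" using k by (auto simp: l)
    have a1: "admissible n (Suc i) i (Suc (2 * (l - k)))" "admissible n i (Suc i) (Suc (2 * (l - k)))"
      using adm k by (auto simp: admissible_arrow l)
    have "?t (2 * k) = lam 0 k (mk 0 \<phi>) * arrow_coeff \<psi> i (Suc (2 * (l - k)))"
      unfolding trunc_cocycle_0[OF f a0(1)] trunc_cocycle_0[OF f a0(2)] L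
      using a1 by (simp add: trunc_def arrow_coeff_def distrib_left)
    then show "?t (2 * k) = lam 0 k (mk 0 \<phi>) * lam (Suc 0) (l - k) (mk (Suc 0) \<psi>)"
      unfolding cocycle_1_const(1)[OF g a1(1)] by simp
  qed
  finally show ?thesis by (simp add: l)
qed

text \<open>The two products agree already as cochains, since a 0-cocycle has the same value at
  source and target of an arrow.\<close>

lemma cup_1_0:
  assumes g: "mk 0 \<psi> \<in> cocycles n 0"
  shows "cup_cochain n (Suc 0) 0 (mk (Suc 0) \<phi>) (mk 0 \<psi>) = cup_cochain n 0 (Suc 0) (mk 0 \<psi>) (mk (Suc 0) \<phi>)"
proof -
  have "conv_coeff (Suc 0) \<phi> \<psi> (tgt x) [x] (src x) L = conv_coeff 0 \<psi> \<phi> (tgt x) [x] (src x) L"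
    if x: "x \<in> arrows n" and adm: "admissible n (tgt x) (src x) L" for x L
  proof -
    have "conv_coeff (Suc 0) \<phi> \<psi> (tgt x) [x] (src x) L =
        (\<Sum>k\<le>L. trunc \<phi> (tgt x) [x] (src x) (L - k) * trunc \<psi> (src x) [] (src x) k)"
      unfolding conv_coeff_def
      by (simp, rule sum_reverse[of "\<lambda>k k'. trunc \<phi> (tgt x) [x] (src x) k * trunc \<psi> (src x) [] (src x) k'" L])
    also have "\<dots> = (\<Sum>k\<le>L. trunc \<psi> (tgt x) [] (tgt x) k * trunc \<phi> (tgt x) [x] (src x) (L - k))"
    proof (intro sum.cong refl)
      fix k assume k: "k \<in> {..L}"
      have "trunc \<psi> (src x) [] (src x) k = trunc \<psi> (tgt x) [] (tgt x) k"
      proof (cases "even k")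
        case True
        then obtain k' where k': "k = 2 * k'" by blast
        \<comment> \<open>Parity excludes \<open>k = L\<close>; for smaller even \<open>k\<close>
          the length is admissible at both ends of the arrow, and the values there can be
          compared.\<close>
        have "odd L" using adm by (cases x) (simp_all add: admissible_arrow)
        with True have "k \<noteq> L" by blast
        with k have "k < L" by simp
        then have "admissible n (src x) (src x) k" "admissible n (tgt x) (tgt x) k"
          using adm True by (cases x; simp add: admissible_arrow admissible_diag)+
        then show ?thesis unfolding k' using trunc_cocycle_0[OF g] by simp
      qed (simp add: trunc_def admissible_diag)
      then show "trunc \<phi> (tgt x) [x] (src x) (L - k) * trunc \<psi> (src x) [] (src x) k =
          trunc \<psi> (tgt x) [] (tgt x) k * trunc \<phi> (tgt x) [x] (src x) (L - k)" by simp
    qed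
    also have "\<dots> = conv_coeff 0 \<psi> \<phi> (tgt x) [x] (src x) L" by (simp add: conv_coeff_def)
    finally show ?thesis .
  qed
  then show ?thesis unfolding cup_mk by (simp add: mk_eq_1)
qed

text \<open>The cup product in coordinates: degrees 0 and 1 multiply like polynomials, degree 0 acts
  on degree 2 through its constant coefficient only, and all other products vanish.\<close>

definition lam_mult :: "nat \<Rightarrow> nat \<Rightarrow> (nat \<Rightarrow> 'f) \<Rightarrow> (nat \<Rightarrow> 'f) \<Rightarrow> nat \<Rightarrow> 'f" where
  "lam_mult p q x y l =
    (if p = 0 \<and> q \<le> 1 then \<Sum>k\<le>l. x k * y (l - k)
     else if p = 1 \<and> q = 0 then \<Sum>k\<le>l. y k * x (l - k)
     else if p = 0 \<and> q = 2 then x 0 * y l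
     else if p = 2 \<and> q = 0 then y 0 * x l else 0)"

lemma lam_mult_commute: "lam_mult p q x y l = lam_mult q p y x l"
  using sum_reverse[of "\<lambda>k k'. x k * y k'" l]
  by (auto simp: lam_mult_def mult.commute)

lemma idx_down: "l \<in> idx p \<Longrightarrow> k \<le> l \<Longrightarrow> k \<in> idx p"
  by (auto simp: idx_def split: if_splits)

lemma idx_1_0: "l \<in> idx (Suc 0) \<Longrightarrow> l \<in> idx 0"
  by (auto simp: idx_def)

lemma zero_in_idx: "0 \<in> idx 0"
  using n3 by (auto simp: idx_def)

text \<open>Coordinates outside \<open>idx\<close> carry no information on the class. The formula
  never reads them, because \<open>idx\<close> is closed downwards and \<open>idx 1\<close> is
  contained in \<open>idx 0\<close>.\<close>

lemma lam_mult_cong: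
  assumes l: "l \<in> idx (p + q)" and x: "\<And>k. k \<in> idx p \<Longrightarrow> x k = x' k" and y: "\<And>k. k \<in> idx q \<Longrightarrow> y k = y' k"
  shows "lam_mult p q x y l = lam_mult p q x' y' l"
proof -
  consider "p = 0" "q = 0" | "p = 0" "q = Suc 0" | "p = Suc 0" "q = 0" | "p = 0" "q = 2" | "p = 2" "q = 0"
    | "\<not> (p = 0 \<and> q \<le> 1)" "\<not> (p = 1 \<and> q = 0)" "\<not> (p = 0 \<and> q = 2)" "\<not> (p = 2 \<and> q = 0)"
    by (cases p; cases q) auto
  then show ?thesis
  proof cases
    case 1
    have "x k * y (l - k) = x' k * y' (l - k)" if "k \<le> l" for k
      using x[of k] y[of "l - k"] idx_down[of l 0] l that by (simp add: 1)
    then show ?thesis by (simp add: lam_mult_def 1)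
  next
    case 2
    have "x k * y (l - k) = x' k * y' (l - k)" if "k \<le> l" for k
      using x[of k] y[of "l - k"] idx_down[of l 0] idx_down[of l "Suc 0"] idx_1_0[of l] l that by (simp add: 2)
    then show ?thesis by (simp add: lam_mult_def 2)
  next
    case 3
    have "y k * x (l - k) = y' k * x' (l - k)" if "k \<le> l" for k
      using x[of "l - k"] y[of k] idx_down[of l 0] idx_down[of l "Suc 0"] idx_1_0[of l] l that by (simp add: 3)
    then show ?thesis by (simp add: lam_mult_def 3)
  next
    case 4
    with x[of 0] y[of l] zero_in_idx l show ?thesis by (simp add: lam_mult_def numeral_2_eq_2)
  next
    case 5
    with x[of l] y[of 0] zero_in_idx l show ?thesis by (simp add: lam_mult_def numeral_2_eq_2)
  next
    case 6
    then show ?thesis unfolding lam_mult_def by (simp only: if_False)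
  qed
qed

lemma cup_cocycle:
  assumes f: "f \<in> cocycles n p" and g: "g \<in> cocycles n q"
  shows "cup_cochain n p q f g \<in> cocycles n (p + q)"
    and "l \<in> idx (p + q) \<Longrightarrow>
      lam (p + q) l (cup_cochain n p q f g) = lam_mult p q (\<lambda>l. lam p l f) (\<lambda>l. lam q l g) l"
proof -
  obtain \<phi> where \<phi>: "f = mk p \<phi>" using cocycleE[OF f] .
  obtain \<psi> where \<psi>: "g = mk q \<psi>" using cocycleE[OF g] .
  \<comment> \<open>Stated for arbitrary cocycles so that it serves both orders of the factors, the
    second one through \<open>cup_1_0\<close>.\<close>
  have cup01: "cup_cochain n 0 (Suc 0) (mk 0 \<phi>) (mk (Suc 0) \<psi>) \<in> cocycles n (Suc 0) \<and>
      (\<forall>l\<in>idx (Suc 0). lam (Suc 0) l (cup_cochain n 0 (Suc 0) (mk 0 \<phi>) (mk (Suc 0) \<psi>)) =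
        (\<Sum>k\<le>l. lam 0 k (mk 0 \<phi>) * lam (Suc 0) (l - k) (mk (Suc 0) \<psi>)))"
    if f: "mk 0 \<phi> \<in> cocycles n 0" and g: "mk (Suc 0) \<psi> \<in> cocycles n (Suc 0)" for \<phi> \<psi>
  proof -
    have c: "cup_cochain n 0 (Suc 0) (mk 0 \<phi>) (mk (Suc 0) \<psi>) = mk (Suc 0) (conv_coeff 0 \<phi> \<psi>)"
      by (simp add: cup_mk)
    have "arrow_coeff (conv_coeff 0 \<phi> \<psi>) (i - 1) (L - 1) = arrow_coeff (conv_coeff 0 \<phi> \<psi>) i (L - 1)"
      if adm: "admissible n i i L" "0 < L" for i L
    proof -
      from adm obtain i' where i': "i = Suc i'" by (cases i) (auto simp: admissible_diag)
      have "admissible n (Suc i') i' (L - 1)" "admissible n (Suc i) i (L - 1)"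
        using adm by (auto simp: admissible_diag admissible_arrow i')
      from conv_coeff_0_1[OF f g this(1)] conv_coeff_0_1[OF f g this(2)] show ?thesis by (simp add: i')
    qed
    then have "mk (Suc 0) (conv_coeff 0 \<phi> \<psi>) \<in> cocycles n (Suc 0)" unfolding cocycle_1_iff by blast
    moreover have "lam (Suc 0) l (mk (Suc 0) (conv_coeff 0 \<phi> \<psi>)) =
        (\<Sum>k\<le>l. lam 0 k (mk 0 \<phi>) * lam (Suc 0) (l - k) (mk (Suc 0) \<psi>))" if l: "l \<in> idx (Suc 0)" for l
    proof -
      have "admissible n (Suc l) l (Suc (2 * l))" using l by (auto simp: idx_def admissible_arrow)
      from conv_coeff_0_1[OF f g this] show ?thesis using lam_mk_1[OF l] by simp
    qed
    ultimately show ?thesis unfolding c by blast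
  qed
  consider "p = 0" "q = 0" | "p = 0" "q = Suc 0" | "p = Suc 0" "q = 0" | "p = 0" "q = 2" | "p = 2" "q = 0"
    | "p = Suc 0" "q = Suc 0" | "3 \<le> p + q"
    by linarith
  then have "cup_cochain n p q f g \<in> cocycles n (p + q) \<and> (\<forall>l\<in>idx (p + q).
      lam (p + q) l (cup_cochain n p q f g) = lam_mult p q (\<lambda>l. lam p l f) (\<lambda>l. lam q l g) l)"
  proof cases
    case 1
    note f0 = f[unfolded \<phi> 1] and g0 = g[unfolded \<psi> 1]
    have c: "cup_cochain n p q f g = mk 0 (conv_coeff 0 \<phi> \<psi>)" by (simp add: \<phi> \<psi> 1 cup_mk)
    have "conv_coeff 0 \<phi> \<psi> (Suc i) [] (Suc i) (L - 1) = conv_coeff 0 \<phi> \<psi> i [] i (L - 1)"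
      if "admissible n (Suc i) i L" for i L
    proof -
      have "admissible n (Suc i) (Suc i) (L - 1)" "admissible n i i (L - 1)"
        using that by (auto simp: admissible_diag admissible_arrow elim!: oddE)
      from conv_coeff_0_0[OF f0 g0 this(1)] conv_coeff_0_0[OF f0 g0 this(2)] show ?thesis by simp
    qed
    then have "mk 0 (conv_coeff 0 \<phi> \<psi>) \<in> cocycles n 0" unfolding cocycle_0_iff by blast
    moreover have "lam 0 l (mk 0 (conv_coeff 0 \<phi> \<psi>)) = (\<Sum>k\<le>l. lam 0 k (mk 0 \<phi>) * lam 0 (l - k) (mk 0 \<psi>))"
      if l: "l \<in> idx 0" for l
    proof -
      have "admissible n l l (2 * l)" using l by (auto simp: idx_def admissible_diag)
      from conv_coeff_0_0[OF f0 g0 this] show ?thesis using lam_mk_0[OF l] by simp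
    qed
    ultimately show ?thesis unfolding c by (simp add: 1 \<phi> \<psi> lam_mult_def)
  next
    case 2
    with cup01[of \<phi> \<psi>] f g show ?thesis by (simp add: \<phi> \<psi> lam_mult_def)
  next
    case 3
    with cup01[of \<psi> \<phi>] cup_1_0[of \<psi> \<phi>] f g show ?thesis by (simp add: \<phi> \<psi> lam_mult_def)
  next
    case 4
    have c: "cup_cochain n p q f g = mk 2 (conv_coeff 0 \<phi> \<psi>)" by (simp add: \<phi> \<psi> 4 cup_mk numeral_2_eq_2)
    have "lam 2 l (mk 2 (conv_coeff 0 \<phi> \<psi>)) = lam 0 0 (mk 0 \<phi>) * lam 2 l (mk 2 \<psi>)" if l: "l \<in> idx 2" for l
    proof -
      have adm: "admissible n l l 0" using l by (auto simp: idx_def admissible_diag)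
      \<comment> \<open>In length 0 the sum over lengths has one term, so only the constant part of
        the factor of degree 0 acts.\<close>
      have "rel_coeff (conv_coeff 0 \<phi> \<psi>) l 0 = \<phi> l [] l 0 * rel_coeff \<psi> l 0"
        using adm by (simp add: rel_coeff_def conv_coeff_def trunc_def right_diff_distrib)
      then show ?thesis
        using cocycle_0_const(1)[OF f[unfolded \<phi> 4] adm] l by (simp add: lam_mk_2)
    qed
    with cocycle_ge_2[of 2] show ?thesis unfolding c by (simp add: 4 \<phi> \<psi> lam_mult_def numeral_2_eq_2)
  next
    case 5
    have c: "cup_cochain n p q f g = mk 2 (conv_coeff 2 \<phi> \<psi>)" by (simp add: \<phi> \<psi> 5 cup_mk numeral_2_eq_2)
    have "lam 2 l (mk 2 (conv_coeff 2 \<phi> \<psi>)) = lam 0 0 (mk 0 \<psi>) * lam 2 l (mk 2 \<phi>)" if l: "l \<in> idx 2" for l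
    proof -
      have adm: "admissible n l l 0" using l by (auto simp: idx_def admissible_diag)
      have "rel_coeff (conv_coeff 2 \<phi> \<psi>) l 0 = \<psi> l [] l 0 * rel_coeff \<phi> l 0"
        using adm by (simp add: rel_coeff_def conv_coeff_def trunc_def right_diff_distrib mult.commute)
      then show ?thesis
        using cocycle_0_const(1)[OF g[unfolded \<psi> 5] adm] l by (simp add: lam_mk_2)
    qed
    with cocycle_ge_2[of 2] show ?thesis unfolding c by (simp add: 5 \<phi> \<psi> lam_mult_def numeral_2_eq_2)
  next
    case 6
    have c: "cup_cochain n p q f g = mk 2 (\<lambda>j xs i L. - conv_coeff (Suc 0) \<phi> \<psi> j xs i L)"
      unfolding \<phi> \<psi> 6 cup_mk by (simp add: numeral_2_eq_2)
    \<comment> \<open>Values on arrows connect neighbouring vertices and have length at least 1, so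
      their product has no part of length 0.\<close>
    have "lam 2 l (mk 2 (\<lambda>j xs i L. - conv_coeff (Suc 0) \<phi> \<psi> j xs i L)) = 0" if l: "l \<in> idx 2" for l
      unfolding lam_mk_2[OF l] by (auto simp: rel_coeff_def conv_coeff_def trunc_def admissible_def)
    with cocycle_ge_2[of 2] show ?thesis unfolding c by (simp add: 6 numeral_2_eq_2 lam_mult_def)
  next
    case 7
    then have "idx (p + q) = {}" by (auto simp: idx_def)
    moreover have "cup_cochain n p q f g \<in> cocycles n (p + q)"
      unfolding \<phi> \<psi> cup_mk by (rule cocycle_ge_2) (use 7 in simp)
    ultimately show ?thesis by blast
  qed
  then show "cup_cochain n p q f g \<in> cocycles n (p + q)"
    and "l \<in> idx (p + q) \<Longrightarrow>
      lam (p + q) l (cup_cochain n p q f g) = lam_mult p q (\<lambda>l. lam p l f) (\<lambda>l. lam q l g) l"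
    by blast+
qed

section \<open>Cochains and cocycles as vector spaces\<close>

abbreviation C :: "nat \<Rightarrow> ('f, 'f cochain) module" where "C p \<equiv> cochains n p"

lemma carrier_cochains [simp]: "carrier (C p) = Hom_ke n p"
  by (simp add: cochains_def)

lemma mk_add: "mk p \<phi> \<oplus>\<^bsub>C p\<^esub> mk p \<psi> = mk p (\<lambda>j xs i L. \<phi> j xs i L + \<psi> j xs i L)"
proof (rule ext)
  fix w :: "'f pvec"
  show "(mk p \<phi> \<oplus>\<^bsub>C p\<^esub> mk p \<psi>) w = mk p (\<lambda>j xs i L. \<phi> j xs i L + \<psi> j xs i L) w"
  proof (cases "w \<in> W n p")
    case True
    have "mk p \<phi> w \<oplus>\<^bsub>A\<^esub> mk p \<psi> w = mk p (\<lambda>j xs i L. \<phi> j xs i L + \<psi> j xs i L) w"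
      by (rule mk_apply_eqI[OF True])
        (simp_all add: mk_closed[OF True] coeff_add coeff_mk[OF True] sum.distrib distrib_left)
    then show ?thesis using True by (simp add: cochains_def)
  qed (simp add: cochains_def mk_def)
qed

lemma mk_smult: "c \<odot>\<^bsub>C p\<^esub> mk p \<phi> = mk p (\<lambda>j xs i L. c * \<phi> j xs i L)"
proof (rule ext)
  fix w :: "'f pvec"
  show "(c \<odot>\<^bsub>C p\<^esub> mk p \<phi>) w = mk p (\<lambda>j xs i L. c * \<phi> j xs i L) w"
  proof (cases "w \<in> W n p")
    case True
    have "c \<odot>\<^bsub>A\<^esub> mk p \<phi> w = mk p (\<lambda>j xs i L. c * \<phi> j xs i L) w"
      by (rule mk_apply_eqI[OF True])
        (simp_all add: mk_closed[OF True] coeff_smult coeff_mk[OF True] sum_distrib_left mult.left_commute)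
    then show ?thesis using True by (simp add: cochains_def)
  qed (simp add: cochains_def mk_def)
qed

lemma cochains_module: "Module.module class_ring (C p)"
proof (rule moduleI)
  have rep: "\<exists>\<phi>. f = mk p \<phi>" if "f \<in> carrier (C p)" for f
    using Hom_eq_mk that by simp
  show "cring (class_ring :: 'f ring)" by (rule class_cring.is_cring)
  show "abelian_group (C p)"
  proof (rule abelian_groupI)
    fix f g e assume "f \<in> carrier (C p)" "g \<in> carrier (C p)" "e \<in> carrier (C p)"
    then obtain \<phi> \<psi> \<chi> where "f = mk p \<phi>" "g = mk p \<psi>" "e = mk p \<chi>" using rep by metis
    then show "f \<oplus>\<^bsub>C p\<^esub> g \<oplus>\<^bsub>C p\<^esub> e = f \<oplus>\<^bsub>C p\<^esub> (g \<oplus>\<^bsub>C p\<^esub> e)"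
      by (simp add: mk_add add.assoc)
  next
    fix f g assume "f \<in> carrier (C p)" "g \<in> carrier (C p)"
    then obtain \<phi> \<psi> where "f = mk p \<phi>" "g = mk p \<psi>" using rep by metis
    then show "f \<oplus>\<^bsub>C p\<^esub> g \<in> carrier (C p)" "f \<oplus>\<^bsub>C p\<^esub> g = g \<oplus>\<^bsub>C p\<^esub> f"
      by (simp_all add: mk_add mk_in_Hom add.commute)
  next
    fix f assume "f \<in> carrier (C p)"
    then obtain \<phi> where \<phi>: "f = mk p \<phi>" using rep by metis
    then show "\<zero>\<^bsub>C p\<^esub> \<oplus>\<^bsub>C p\<^esub> f = f" by (simp add: zero_cochain mk_add)
    show "\<exists>g\<in>carrier (C p). g \<oplus>\<^bsub>C p\<^esub> f = \<zero>\<^bsub>C p\<^esub>"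
      by (rule bexI[of _ "mk p (\<lambda>j xs i L. - \<phi> j xs i L)"]) (simp_all add: \<phi> zero_cochain mk_add mk_in_Hom)
  qed (simp add: zero_cochain mk_in_Hom)
  fix c f assume "f \<in> carrier (C p)"
  then obtain \<phi> where \<phi>: "f = mk p \<phi>" using rep by metis
  show "c \<odot>\<^bsub>C p\<^esub> f \<in> carrier (C p)" by (simp add: \<phi> mk_smult mk_in_Hom)
  show "(c \<oplus>\<^bsub>class_ring\<^esub> d) \<odot>\<^bsub>C p\<^esub> f = c \<odot>\<^bsub>C p\<^esub> f \<oplus>\<^bsub>C p\<^esub> d \<odot>\<^bsub>C p\<^esub> f"
    "(c \<otimes>\<^bsub>class_ring\<^esub> d) \<odot>\<^bsub>C p\<^esub> f = c \<odot>\<^bsub>C p\<^esub> (d \<odot>\<^bsub>C p\<^esub> f)"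
    "\<one>\<^bsub>class_ring\<^esub> \<odot>\<^bsub>C p\<^esub> f = f" for d
    by (simp_all add: \<phi> mk_smult mk_add distrib_right mult.assoc)
  fix g assume "g \<in> carrier (C p)"
  then obtain \<psi> where "g = mk p \<psi>" using rep by metis
  then show "c \<odot>\<^bsub>C p\<^esub> (f \<oplus>\<^bsub>C p\<^esub> g) = c \<odot>\<^bsub>C p\<^esub> f \<oplus>\<^bsub>C p\<^esub> c \<odot>\<^bsub>C p\<^esub> g"
    by (simp add: \<phi> mk_smult mk_add distrib_left)
qed

lemma conv_coeff_linear:
  "conv_coeff p (\<lambda>j xs i L. \<phi> j xs i L + \<phi>' j xs i L) \<psi> j xs i L = conv_coeff p \<phi> \<psi> j xs i L + conv_coeff p \<phi>' \<psi> j xs i L"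
  "conv_coeff p \<psi> (\<lambda>j xs i L. \<phi> j xs i L + \<phi>' j xs i L) j xs i L = conv_coeff p \<psi> \<phi> j xs i L + conv_coeff p \<psi> \<phi>' j xs i L"
  "conv_coeff p (\<lambda>j xs i L. c * \<phi> j xs i L) \<psi> j xs i L = c * conv_coeff p \<phi> \<psi> j xs i L"
  "conv_coeff p \<psi> (\<lambda>j xs i L. c * \<phi> j xs i L) j xs i L = c * conv_coeff p \<psi> \<phi> j xs i L"
proof -
  have t: "trunc (\<lambda>j xs i L. \<phi> j xs i L + \<phi>' j xs i L) j xs i L = trunc \<phi> j xs i L + trunc \<phi>' j xs i L"
    "trunc (\<lambda>j xs i L. c * \<phi> j xs i L) j xs i L = c * trunc \<phi> j xs i L" for j xs i L
    by (simp_all add: trunc_def)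
  show "conv_coeff p (\<lambda>j xs i L. \<phi> j xs i L + \<phi>' j xs i L) \<psi> j xs i L = conv_coeff p \<phi> \<psi> j xs i L + conv_coeff p \<phi>' \<psi> j xs i L"
    "conv_coeff p \<psi> (\<lambda>j xs i L. \<phi> j xs i L + \<phi>' j xs i L) j xs i L = conv_coeff p \<psi> \<phi> j xs i L + conv_coeff p \<psi> \<phi>' j xs i L"
    "conv_coeff p (\<lambda>j xs i L. c * \<phi> j xs i L) \<psi> j xs i L = c * conv_coeff p \<phi> \<psi> j xs i L"
    "conv_coeff p \<psi> (\<lambda>j xs i L. c * \<phi> j xs i L) j xs i L = c * conv_coeff p \<psi> \<phi> j xs i L"
    unfolding conv_coeff_def t
    by (simp_all add: distrib_left distrib_right sum.distrib sum_distrib_left mult.assoc mult.left_commute)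
qed

lemma bK_add: "bK n p (mk p \<phi> \<oplus>\<^bsub>C p\<^esub> mk p \<psi>) = bK n p (mk p \<phi>) \<oplus>\<^bsub>C (Suc p)\<^esub> bK n p (mk p \<psi>)"
  by (simp add: mk_add bK_mk conv_coeff_linear algebra_simps)

lemma bK_smult: "bK n p (c \<odot>\<^bsub>C p\<^esub> mk p \<phi>) = c \<odot>\<^bsub>C (Suc p)\<^esub> bK n p (mk p \<phi>)"
  by (simp add: mk_smult bK_mk conv_coeff_linear algebra_simps)

lemma bK_zero: "bK n p (mk p (\<lambda>j xs i L. 0)) = mk (Suc p) (\<lambda>j xs i L. 0)"
  unfolding bK_mk by (simp add: conv_coeff_def trunc_def)

lemma cocycles_submodule: "submodule class_ring (cocycles n p :: 'f cochain set) (C p)"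
proof (rule submodule.intro[OF cochains_module])
  show "(cocycles n p :: 'f cochain set) \<subseteq> carrier (C p)" by (auto simp: cocycles_def)
  fix f g :: "'f cochain" assume f: "f \<in> cocycles n p" and g: "g \<in> cocycles n p"
  obtain \<phi> where \<phi>: "f = mk p \<phi>" using cocycleE[OF f] .
  obtain \<psi> where \<psi>: "g = mk p \<psi>" using cocycleE[OF g] .
  have "bK n p (mk p \<phi>) = mk (Suc p) (\<lambda>j xs i L. 0)" "bK n p (mk p \<psi>) = mk (Suc p) (\<lambda>j xs i L. 0)"
    using f g by (simp_all add: cocycles_def \<phi> \<psi> zero_cochain)
  then show "f \<oplus>\<^bsub>C p\<^esub> g \<in> cocycles n p"
    unfolding cocycles_def \<phi> \<psi> using bK_add[of p \<phi> \<psi>] by (simp add: mk_add mk_in_Hom zero_cochain)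
next
  fix c and f :: "'f cochain" assume f: "f \<in> cocycles n p"
  obtain \<phi> where \<phi>: "f = mk p \<phi>" using cocycleE[OF f] .
  have "bK n p (mk p \<phi>) = mk (Suc p) (\<lambda>j xs i L. 0)"
    using f by (simp add: cocycles_def \<phi> zero_cochain)
  then show "c \<odot>\<^bsub>C p\<^esub> f \<in> cocycles n p"
    unfolding cocycles_def \<phi> using bK_smult[of p c \<phi>] by (simp add: mk_smult mk_in_Hom zero_cochain)
qed (simp add: cocycles_def zero_cochain bK_zero mk_in_Hom)

lemma lam_add:
  assumes "f \<in> Hom_ke n p" "g \<in> Hom_ke n p" "l \<in> idx p"
  shows "lam p l (f \<oplus>\<^bsub>C p\<^esub> g) = lam p l f + lam p l g"
proof -
  have add: "coeff n ((f \<oplus>\<^bsub>C p\<^esub> g) w) j i L = coeff n (f w) j i L + coeff n (g w) j i L" if "w \<in> W n p" for w j i L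
    using that Hom_closed[OF assms(1) that] Hom_closed[OF assms(2) that] by (simp add: cochains_def coeff_add)
  consider "p = 0" "l < n" | "p = Suc 0" "Suc l < n" | "p = 2" "l < n"
    using assms(3) by (auto simp: idx_def split: if_splits)
  then show ?thesis
  proof cases
    case 2
    then have "Arr l \<in> arrows n" "Star l \<in> arrows n" by (auto simp: arrows_def)
    with add 2 show ?thesis by (simp add: lam_def arrow_vec_in_W)
  next
    case 1
    with add[of "vertex l" l l "2 * l"] show ?thesis by (simp add: lam_def vertex_in_W)
  next
    case 3
    with add[of "sigma n l" l l 0] sigma_in_W show ?thesis by (simp add: lam_def)
  qed
qed

lemma lam_smult:
  assumes "f \<in> Hom_ke n p" "l \<in> idx p"
  shows "lam p l (c \<odot>\<^bsub>C p\<^esub> f) = c * lam p l f"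
proof -
  have smult: "coeff n ((c \<odot>\<^bsub>C p\<^esub> f) w) j i L = c * coeff n (f w) j i L" if "w \<in> W n p" for w j i L
    using that Hom_closed[OF assms(1) that] by (simp add: cochains_def coeff_smult)
  consider "p = 0" "l < n" | "p = Suc 0" "Suc l < n" | "p = 2" "l < n"
    using assms(2) by (auto simp: idx_def split: if_splits)
  then show ?thesis
  proof cases
    case 2
    then have "Arr l \<in> arrows n" "Star l \<in> arrows n" by (auto simp: arrows_def)
    with smult 2 show ?thesis by (simp add: lam_def arrow_vec_in_W distrib_left)
  next
    case 1
    with smult[of "vertex l" l l "2 * l"] show ?thesis by (simp add: lam_def vertex_in_W)
  next
    case 3
    with smult[of "sigma n l" l l 0] sigma_in_W show ?thesis by (simp add: lam_def)
  qed
qed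

end

lemma (in abelian_group) minus_add_cancel:
  "x \<in> carrier G \<Longrightarrow> y \<in> carrier G \<Longrightarrow> (x \<ominus> y) \<oplus> y = x"
  by (simp add: a_minus_def a_assoc l_neg)

context preproj begin

section \<open>Cohomology as a quotient and its coordinates\<close>

abbreviation Z_mod :: "nat \<Rightarrow> ('f, 'f cochain) module" where
  "Z_mod p \<equiv> (C p)\<lparr>carrier := cocycles n p\<rparr>"

abbreviation coset :: "nat \<Rightarrow> 'f cochain \<Rightarrow> 'f cochain set" where
  "coset p f \<equiv> coboundaries n p +>\<^bsub>C p\<^esub> f"

lemma Z_module: "Module.module class_ring (Z_mod p)"
  by (rule LinearCombinations.module.submodule_is_module[OF cochains_module cocycles_submodule])

lemma cocycle_Hom: "f \<in> cocycles n p \<Longrightarrow> f \<in> Hom_ke n p"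
  by (simp add: cocycles_def)

text \<open>The differential squares to zero: a coboundary of degree 1 has opposite values on
  \<open>Arr i\<close> and \<open>Star i\<close>, so its \<open>arrow_coeff\<close> vanishes, and
  from degree 2 on every cochain is a cocycle.\<close>

lemma coboundary_cocycle:
  assumes "(f :: 'f cochain) \<in> coboundaries n p"
  shows "f \<in> cocycles n p"
proof (cases "p = 0")
  case True
  with assms show ?thesis using submodule.zero_closed[OF cocycles_submodule] by (simp add: coboundaries_def)
next
  case False
  then obtain p' where p': "p = Suc p'" by (cases p) auto
  from assms obtain g where g: "g \<in> Hom_ke n p'" "f = bK n p' g" by (auto simp: coboundaries_def p')
  obtain \<phi> where \<phi>: "g = mk p' \<phi>" using Hom_eq_mk[OF g(1)] by blast
  show ?thesis
  proof (cases "p' = 0")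
    case True
    show ?thesis unfolding g(2) \<phi> p' True bK_mk_0 cocycle_1_iff by (simp add: arrow_coeff_def)
  next
    case False
    then show ?thesis unfolding g(2) \<phi> p' bK_mk by (intro cocycle_ge_2) simp
  qed
qed

text \<open>By \<open>coboundary_iff\<close> the coboundaries are the common zeros of linear
  functionals on the cocycles.\<close>

lemma coboundaries_submodule: "submodule class_ring (coboundaries n p :: 'f cochain set) (Z_mod p)"
proof (rule submodule.intro[OF Z_module])
  show "(coboundaries n p :: 'f cochain set) \<subseteq> carrier (Z_mod p)" using coboundary_cocycle by auto
  fix f g :: "'f cochain" assume f: "f \<in> coboundaries n p" and g: "g \<in> coboundaries n p"
  note z = coboundary_cocycle[OF f] coboundary_cocycle[OF g]
  have s: "f \<oplus>\<^bsub>C p\<^esub> g \<in> cocycles n p" by (rule submodule.m_closed[OF cocycles_submodule z])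
  have "\<forall>l\<in>idx p. lam p l (f \<oplus>\<^bsub>C p\<^esub> g) = 0"
    using f g coboundary_iff[OF z(1)] coboundary_iff[OF z(2)]
    by (simp add: lam_add[OF cocycle_Hom[OF z(1)] cocycle_Hom[OF z(2)]])
  then show "f \<oplus>\<^bsub>Z_mod p\<^esub> g \<in> coboundaries n p" using coboundary_iff[OF s] by simp
next
  have z: "\<zero>\<^bsub>C p\<^esub> \<in> cocycles n p" by (rule submodule.zero_closed[OF cocycles_submodule])
  have "\<forall>l\<in>idx p. lam p l (\<zero>\<^bsub>C p\<^esub>) = 0"
  proof
    fix l assume l: "l \<in> idx p"
    have "\<zero>\<^bsub>C p\<^esub> = (0 :: 'f) \<odot>\<^bsub>C p\<^esub> \<zero>\<^bsub>C p\<^esub>" by (simp add: zero_cochain mk_smult)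
    then show "lam p l (\<zero>\<^bsub>C p\<^esub>) = 0" using lam_smult[OF cocycle_Hom[OF z] l, of 0] by simp
  qed
  then show "\<zero>\<^bsub>Z_mod p\<^esub> \<in> coboundaries n p" using coboundary_iff[OF z] by simp
next
  fix c and f :: "'f cochain" assume f: "f \<in> coboundaries n p"
  note z = coboundary_cocycle[OF f]
  have s: "c \<odot>\<^bsub>C p\<^esub> f \<in> cocycles n p" by (rule submodule.smult_closed[OF cocycles_submodule _ z]) simp
  have "\<forall>l\<in>idx p. lam p l (c \<odot>\<^bsub>C p\<^esub> f) = 0"
    using f coboundary_iff[OF z] by (simp add: lam_smult[OF cocycle_Hom[OF z]])
  then show "c \<odot>\<^bsub>Z_mod p\<^esub> f \<in> coboundaries n p" using coboundary_iff[OF s] by simp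
qed

lemmas HK_quot = Z_module coboundaries_submodule

abbreviation D :: "nat \<Rightarrow> ('f, 'f cochain set) module" where "D p \<equiv> HK_deg n p"

lemma coset_Z: "coboundaries n p +>\<^bsub>Z_mod p\<^esub> f = coset p f"
  by (simp add: a_r_coset_def r_coset_def)

lemma D_carrier: "carrier (D p) = coset p ` cocycles n p"
  unfolding HK_deg_def quot_carrier[OF HK_quot] coset_Z by simp

lemma D_rep: "X \<in> carrier (D p) \<Longrightarrow> \<exists>f\<in>cocycles n p. X = coset p f"
  unfolding D_carrier by blast

lemma D_add: "f \<in> cocycles n p \<Longrightarrow> g \<in> cocycles n p \<Longrightarrow> coset p f \<oplus>\<^bsub>D p\<^esub> coset p g = coset p (f \<oplus>\<^bsub>C p\<^esub> g)"
  using quot_add[OF HK_quot, of f p g] unfolding HK_deg_def coset_Z by simp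

lemma D_smult: "f \<in> cocycles n p \<Longrightarrow> c \<odot>\<^bsub>D p\<^esub> coset p f = coset p (c \<odot>\<^bsub>C p\<^esub> f)"
  using quot_smult[OF HK_quot, of c f p] unfolding HK_deg_def coset_Z by simp

lemma D_module: "Module.module class_ring (D p)"
  unfolding HK_deg_def by (rule quot_module_module[OF HK_quot])

lemma coset_eq_iff:
  assumes f: "f \<in> cocycles n p" and g: "g \<in> cocycles n p"
  shows "coset p f = coset p g \<longleftrightarrow> (\<forall>l\<in>idx p. lam p l f = lam p l g)"
proof -
  interpret Z: Module.module class_ring "Z_mod p" by (rule Z_module)
  let ?d = "f \<ominus>\<^bsub>Z_mod p\<^esub> g"
  have fg: "f \<in> carrier (Z_mod p)" "g \<in> carrier (Z_mod p)" using f g by simp_all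
  then have d: "?d \<in> cocycles n p" using Z.minus_closed by simp
  have "?d \<oplus>\<^bsub>Z_mod p\<^esub> g = f" by (rule Z.minus_add_cancel[OF fg])
  then have e: "?d \<oplus>\<^bsub>C p\<^esub> g = f" by simp
  have "lam p l f = lam p l ?d + lam p l g" if "l \<in> idx p" for l
    using lam_add[OF cocycle_Hom[OF d] cocycle_Hom[OF g] that] unfolding e .
  moreover have "coset p f = coset p g \<longleftrightarrow> ?d \<in> coboundaries n p"
    using quot_coset_eq_iff[OF HK_quot fg] unfolding coset_Z .
  ultimately show ?thesis unfolding coboundary_iff[OF d] by simp
qed

lemma mem_coset:
  assumes f: "f \<in> cocycles n p" and g: "g \<in> coset p f"
  shows "g \<in> cocycles n p \<and> coset p g = coset p f"
  using mem_quot_coset_iff[OF HK_quot, of f p g] f g unfolding coset_Z by simp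

lemma coset_self: "f \<in> cocycles n p \<Longrightarrow> f \<in> coset p f"
  using abelian_subgroup.a_rcos_self[OF submodule_abelian_subgroup[OF HK_quot], of f p] unfolding coset_Z by simp

text \<open>Reads a coordinate off an arbitrary representative; for \<open>l \<in> idx p\<close> the
  choice does not matter, by \<open>co_coset\<close>.\<close>

definition co :: "nat \<Rightarrow> nat \<Rightarrow> 'f cochain set \<Rightarrow> 'f" where
  "co p l X = lam p l (SOME f. f \<in> X)"

lemma co_coset:
  assumes f: "f \<in> cocycles n p" and l: "l \<in> idx p"
  shows "co p l (coset p f) = lam p l f"
proof -
  have "(SOME g. g \<in> coset p f) \<in> coset p f" by (rule someI[of "\<lambda>g. g \<in> coset p f", OF coset_self[OF f]])
  from mem_coset[OF f this] have "(SOME g. g \<in> coset p f) \<in> cocycles n p" "coset p (SOME g. g \<in> coset p f) = coset p f"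
    by auto
  with coset_eq_iff[OF this(1) f] l show ?thesis by (simp add: co_def)
qed

lemma D_eqI:
  assumes "X \<in> carrier (D p)" "Y \<in> carrier (D p)" "\<And>l. l \<in> idx p \<Longrightarrow> co p l X = co p l Y"
  shows "X = Y"
proof -
  obtain f where f: "f \<in> cocycles n p" "X = coset p f" using D_rep[OF assms(1)] by blast
  obtain g where g: "g \<in> cocycles n p" "Y = coset p g" using D_rep[OF assms(2)] by blast
  show ?thesis unfolding f(2) g(2) coset_eq_iff[OF f(1) g(1)]
    using assms(3) f g by (simp add: co_coset)
qed

lemma co_add:
  assumes "X \<in> carrier (D p)" "Y \<in> carrier (D p)" "l \<in> idx p"
  shows "co p l (X \<oplus>\<^bsub>D p\<^esub> Y) = co p l X + co p l Y"
proof -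
  obtain f where f: "f \<in> cocycles n p" "X = coset p f" using D_rep[OF assms(1)] by blast
  obtain g where g: "g \<in> cocycles n p" "Y = coset p g" using D_rep[OF assms(2)] by blast
  have "f \<oplus>\<^bsub>C p\<^esub> g \<in> cocycles n p" by (rule submodule.m_closed[OF cocycles_submodule f(1) g(1)])
  then show ?thesis using assms(3) f g
    by (simp add: D_add co_coset lam_add[OF cocycle_Hom cocycle_Hom])
qed

lemma co_smult:
  assumes "X \<in> carrier (D p)" "l \<in> idx p"
  shows "co p l (c \<odot>\<^bsub>D p\<^esub> X) = c * co p l X"
proof -
  obtain f where f: "f \<in> cocycles n p" "X = coset p f" using D_rep[OF assms(1)] by blast
  have "c \<odot>\<^bsub>C p\<^esub> f \<in> cocycles n p" by (rule submodule.smult_closed[OF cocycles_submodule _ f(1)]) simp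
  then show ?thesis using assms(2) f by (simp add: D_smult co_coset lam_smult[OF cocycle_Hom])
qed

lemma D_zero_closed: "\<zero>\<^bsub>D p\<^esub> \<in> carrier (D p)"
  using abelian_group.axioms(1)[OF Module.module.axioms(2)[OF D_module]] by (rule abelian_monoid.zero_closed)

lemma co_zero: "l \<in> idx p \<Longrightarrow> co p l \<zero>\<^bsub>D p\<^esub> = 0"
proof -
  assume l: "l \<in> idx p"
  interpret D: Module.module class_ring "D p" by (rule D_module)
  show ?thesis using co_smult[OF D.M.zero_closed l, of 0] by simp
qed

lemma D_trivial: "3 \<le> p \<Longrightarrow> X \<in> carrier (D p) \<Longrightarrow> X = \<zero>\<^bsub>D p\<^esub>"
  by (rule D_eqI[OF _ D_zero_closed]) (simp_all add: idx_def)

text \<open>\<open>cup\<close> is a union over all pairs of representatives. The coordinates of a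
  product depend only on those of the factors, so all pairs give the same coset.\<close>

lemma cup_coset:
  assumes f: "f \<in> cocycles n p" and g: "g \<in> cocycles n q"
  shows "cup n p q (coset p f) (coset q g) = coset (p + q) (cup_cochain n p q f g)"
proof -
  have eq: "coset (p + q) (cup_cochain n p q f' g') = coset (p + q) (cup_cochain n p q f g)"
    if "f' \<in> coset p f" "g' \<in> coset q g" for f' g'
  proof -
    from mem_coset[OF f that(1)] have f': "f' \<in> cocycles n p" "\<forall>l\<in>idx p. lam p l f' = lam p l f"
      using coset_eq_iff[OF _ f] by auto
    from mem_coset[OF g that(2)] have g': "g' \<in> cocycles n q" "\<forall>l\<in>idx q. lam q l g' = lam q l g"
      using coset_eq_iff[OF _ g] by auto
    show ?thesis
      unfolding coset_eq_iff[OF cup_cocycle(1)[OF f'(1) g'(1)] cup_cocycle(1)[OF f g]]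
    proof
      fix l assume l: "l \<in> idx (p + q)"
      show "lam (p + q) l (cup_cochain n p q f' g') = lam (p + q) l (cup_cochain n p q f g)"
        unfolding cup_cocycle(2)[OF f'(1) g'(1) l] cup_cocycle(2)[OF f g l]
        by (rule lam_mult_cong[OF l]) (use f'(2) g'(2) in auto)
    qed
  qed
  have "(\<Union>g'\<in>coset q g. coset (p + q) (cup_cochain n p q f' g')) = coset (p + q) (cup_cochain n p q f g)"
    if "f' \<in> coset p f" for f'
    by (rule UN_constant_eq[OF coset_self[OF g]]) (use eq[OF that] in blast)
  then show ?thesis
    unfolding cup_def by (intro UN_constant_eq[OF coset_self[OF f]]) blast
qed

lemma cup_closed:
  assumes "X \<in> carrier (D p)" "Y \<in> carrier (D q)"
  shows "cup n p q X Y \<in> carrier (D (p + q))"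
    and "l \<in> idx (p + q) \<Longrightarrow> co (p + q) l (cup n p q X Y) = lam_mult p q (\<lambda>l. co p l X) (\<lambda>l. co q l Y) l"
proof -
  obtain f where f: "f \<in> cocycles n p" "X = coset p f" using D_rep[OF assms(1)] by blast
  obtain g where g: "g \<in> cocycles n q" "Y = coset q g" using D_rep[OF assms(2)] by blast
  note c = cup_cocycle[OF f(1) g(1)]
  show "cup n p q X Y \<in> carrier (D (p + q))"
    unfolding f(2) g(2) cup_coset[OF f(1) g(1)] D_carrier using c(1) by blast
  show "co (p + q) l (cup n p q X Y) = lam_mult p q (\<lambda>l. co p l X) (\<lambda>l. co q l Y) l" if l: "l \<in> idx (p + q)"
    unfolding f(2) g(2) cup_coset[OF f(1) g(1)] co_coset[OF c(1) l] c(2)[OF l]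
    by (rule lam_mult_cong[OF l]) (simp_all add: co_coset f(1) g(1))
qed

lemma finsum_D:
  assumes "finite S" "\<And>t. t \<in> S \<Longrightarrow> X t \<in> carrier (D p)"
  shows "(\<Oplus>\<^bsub>D p\<^esub>t\<in>S. X t) \<in> carrier (D p) \<and> (\<forall>l\<in>idx p. co p l (\<Oplus>\<^bsub>D p\<^esub>t\<in>S. X t) = (\<Sum>t\<in>S. co p l (X t)))"
  using assms
proof (induction S rule: finite_induct)
  interpret D: Module.module class_ring "D p" by (rule D_module)
  case empty
  then show ?case by (simp add: co_zero)
next
  interpret D: Module.module class_ring "D p" by (rule D_module)
  case (insert t S)
  then have t: "X t \<in> carrier (D p)" "X \<in> S \<rightarrow> carrier (D p)" by auto
  have "(\<Oplus>\<^bsub>D p\<^esub>t\<in>insert t S. X t) = X t \<oplus>\<^bsub>D p\<^esub> (\<Oplus>\<^bsub>D p\<^esub>t\<in>S. X t)"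
    by (rule D.M.finsum_insert[OF insert.hyps t(2) t(1)])
  with insert t show ?case by (simp add: co_add)
qed

end

subsection \<open>Dual bases\<close>

text \<open>Duality gives linear independence, and separation gives generation, because a vector and
  its expansion have the same values under all functionals.\<close>

lemma dual_basis:
  fixes V :: "('f::field, 'b) module" and b :: "'i \<Rightarrow> 'b" and \<Lambda> :: "'i \<Rightarrow> 'b \<Rightarrow> 'f"
  assumes V: "vectorspace class_ring V" and I: "finite I" and b: "\<And>x. x \<in> I \<Longrightarrow> b x \<in> carrier V"
    and add: "\<And>x u v. x \<in> I \<Longrightarrow> u \<in> carrier V \<Longrightarrow> v \<in> carrier V \<Longrightarrow> \<Lambda> x (u \<oplus>\<^bsub>V\<^esub> v) = \<Lambda> x u + \<Lambda> x v"
    and smult: "\<And>x c v. x \<in> I \<Longrightarrow> v \<in> carrier V \<Longrightarrow> \<Lambda> x (c \<odot>\<^bsub>V\<^esub> v) = c * \<Lambda> x v"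
    and dual: "\<And>x y. x \<in> I \<Longrightarrow> y \<in> I \<Longrightarrow> \<Lambda> x (b y) = (if x = y then 1 else 0)"
    and separate: "\<And>u v. u \<in> carrier V \<Longrightarrow> v \<in> carrier V \<Longrightarrow> (\<And>x. x \<in> I \<Longrightarrow> \<Lambda> x u = \<Lambda> x v) \<Longrightarrow> u = v"
  shows "inj_on b I" and "vectorspace.basis class_ring V (b ` I)"
proof -
  interpret V: vectorspace class_ring V by (rule V)
  show inj: "inj_on b I"
  proof (rule inj_onI)
    fix x y assume "x \<in> I" "y \<in> I" "b x = b y"
    then show "x = y" using dual[of x x] dual[of x y] by (auto split: if_splits)
  qed
  have zero: "\<Lambda> x \<zero>\<^bsub>V\<^esub> = 0" if "x \<in> I" for x
    using smult[OF that V.M.zero_closed, of 0] by simp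
  have sum: "\<Lambda> x (\<Oplus>\<^bsub>V\<^esub>v\<in>S. c v \<odot>\<^bsub>V\<^esub> v) = (\<Sum>v\<in>S. c v * \<Lambda> x v)"
    if "x \<in> I" "finite S" "S \<subseteq> carrier V" for x c S
    using that(2,3)
  proof (induction S rule: finite_induct)
    case empty
    then show ?case using zero[OF that(1)] by simp
  next
    case (insert v S)
    then have v: "v \<in> carrier V" "S \<subseteq> carrier V" by auto
    have cl: "(\<lambda>v. c v \<odot>\<^bsub>V\<^esub> v) \<in> S \<rightarrow> carrier V" "c v \<odot>\<^bsub>V\<^esub> v \<in> carrier V"
      using v by (auto intro!: V.smult_closed)
    have "(\<Oplus>\<^bsub>V\<^esub>v\<in>insert v S. c v \<odot>\<^bsub>V\<^esub> v) = c v \<odot>\<^bsub>V\<^esub> v \<oplus>\<^bsub>V\<^esub> (\<Oplus>\<^bsub>V\<^esub>v\<in>S. c v \<odot>\<^bsub>V\<^esub> v)"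
      by (rule V.M.finsum_insert[OF insert.hyps cl])
    with insert v show ?case by (simp add: add[OF that(1) cl(2) V.M.finsum_closed[OF cl(1)]] smult[OF that(1)])
  qed
  have B: "b ` I \<subseteq> carrier V" "finite (b ` I)" using b I by auto
  have coord: "\<Lambda> x (V.lincomb c (b ` I)) = c (b x)" if "x \<in> I" for x c
  proof -
    have "\<Lambda> x (V.lincomb c (b ` I)) = (\<Sum>y\<in>I. c (b y) * \<Lambda> x (b y))"
      unfolding V.lincomb_def sum[OF that B(2,1)] by (rule sum.reindex[OF inj, unfolded comp_def])
    also have "\<dots> = (\<Sum>y\<in>I. if y = x then c (b x) else 0)"
      by (intro sum.cong refl) (use that dual in auto)
    finally show ?thesis using that I by simp
  qed
  show "V.basis (b ` I)"
    unfolding V.basis_def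
  proof (intro conjI B)
    show "V.lin_indpt (b ` I)"
    proof (rule V.finite_lin_indpt2[OF B(2,1)])
      fix c assume "V.lincomb c (b ` I) = \<zero>\<^bsub>V\<^esub>"
      then have "c (b x) = 0" if "x \<in> I" for x using coord[OF that, of c] zero[OF that] by simp
      then show "\<forall>v\<in>b ` I. c v = \<zero>\<^bsub>class_ring\<^esub>" by simp
    qed
    show "V.span (b ` I) = carrier V"
    proof (rule antisym)
      show "V.span (b ` I) \<subseteq> carrier V" by (rule V.span_is_subset2[OF B(1)])
      show "carrier V \<subseteq> V.span (b ` I)"
      proof
        fix v assume v: "v \<in> carrier V"
        \<comment> \<open>Linear combinations are indexed by vectors, so the label of
          \<open>u\<close> is recovered through the inverse of \<open>b\<close>.\<close>
        let ?c = "\<lambda>u. \<Lambda> (the_inv_into I b u) v"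
        have lc: "V.lincomb ?c (b ` I) \<in> carrier V" by (rule V.lincomb_closed[OF B(1)]) simp
        have "v = V.lincomb ?c (b ` I)"
          by (rule separate[OF v lc]) (simp add: coord the_inv_into_f_f[OF inj])
        then show "v \<in> V.span (b ` I)" unfolding V.finite_span[OF B(2,1)] by auto
      qed
    qed
  qed
qed

subsection \<open>The graded algebra\<close>

context preproj begin

abbreviation HA :: "('f, nat \<Rightarrow> 'f cochain set) module" where "HA \<equiv> HK n"

text \<open>Finite support is automatic, as the cohomology vanishes from degree 3 on.\<close>

lemma HA_carrier: "X \<in> carrier HA \<longleftrightarrow> (\<forall>p. X p \<in> carrier (D p))"
proof -
  have "finite {p. X p \<noteq> \<zero>\<^bsub>D p\<^esub>}" if "\<forall>p. X p \<in> carrier (D p)"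
  proof (rule finite_subset)
    show "{p. X p \<noteq> \<zero>\<^bsub>D p\<^esub>} \<subseteq> {..<3}"
    proof
      fix p assume "p \<in> {p. X p \<noteq> \<zero>\<^bsub>D p\<^esub>}"
      then show "p \<in> {..<3}" using D_trivial[of p "X p"] that by fastforce
    qed
  qed simp
  then show ?thesis by (auto simp: HK_def)
qed

lemma HA_eqI:
  assumes "X \<in> carrier HA" "Y \<in> carrier HA" "\<And>p l. l \<in> idx p \<Longrightarrow> co p l (X p) = co p l (Y p)"
  shows "X = Y"
proof (rule ext)
  fix p
  have "X p \<in> carrier (D p)" "Y p \<in> carrier (D p)" using assms(1,2) unfolding HA_carrier by blast+
  then show "X p = Y p" by (rule D_eqI) (rule assms(3))
qed

lemma HA_simps:
  "X \<oplus>\<^bsub>HA\<^esub> Y = (\<lambda>p. X p \<oplus>\<^bsub>D p\<^esub> Y p)" "\<zero>\<^bsub>HA\<^esub> = (\<lambda>p. \<zero>\<^bsub>D p\<^esub>)" "c \<odot>\<^bsub>HA\<^esub> X = (\<lambda>p. c \<odot>\<^bsub>D p\<^esub> X p)"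
  by (simp_all add: HK_def)

lemma D_closed:
  "X \<in> carrier (D p) \<Longrightarrow> Y \<in> carrier (D p) \<Longrightarrow> X \<oplus>\<^bsub>D p\<^esub> Y \<in> carrier (D p)"
  "X \<in> carrier (D p) \<Longrightarrow> c \<odot>\<^bsub>D p\<^esub> X \<in> carrier (D p)"
proof -
  interpret D: Module.module class_ring "D p" by (rule D_module)
  show "X \<in> carrier (D p) \<Longrightarrow> Y \<in> carrier (D p) \<Longrightarrow> X \<oplus>\<^bsub>D p\<^esub> Y \<in> carrier (D p)"
    "X \<in> carrier (D p) \<Longrightarrow> c \<odot>\<^bsub>D p\<^esub> X \<in> carrier (D p)"
    by simp_all
qed

lemma HA_closed:
  "X \<in> carrier HA \<Longrightarrow> Y \<in> carrier HA \<Longrightarrow> X \<oplus>\<^bsub>HA\<^esub> Y \<in> carrier HA"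
  "X \<in> carrier HA \<Longrightarrow> c \<odot>\<^bsub>HA\<^esub> X \<in> carrier HA" "\<zero>\<^bsub>HA\<^esub> \<in> carrier HA"
  unfolding HA_carrier HA_simps by (simp_all add: D_closed D_zero_closed)

lemma co_HA:
  "X \<in> carrier HA \<Longrightarrow> Y \<in> carrier HA \<Longrightarrow> l \<in> idx p \<Longrightarrow> co p l ((X \<oplus>\<^bsub>HA\<^esub> Y) p) = co p l (X p) + co p l (Y p)"
  "X \<in> carrier HA \<Longrightarrow> l \<in> idx p \<Longrightarrow> co p l ((c \<odot>\<^bsub>HA\<^esub> X) p) = c * co p l (X p)"
  "l \<in> idx p \<Longrightarrow> co p l (\<zero>\<^bsub>HA\<^esub> p) = 0"
  unfolding HA_carrier HA_simps by (simp_all add: co_add co_smult co_zero)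

text \<open>The coordinates are jointly injective and linear, so each axiom becomes an identity in
  the field.\<close>

lemma HA_module: "Module.module class_ring HA"
proof (rule moduleI)
  show "cring (class_ring :: 'f ring)" by (rule class_cring.is_cring)
  show "abelian_group HA"
  proof (rule abelian_groupI)
    fix X assume X: "X \<in> carrier HA"
    show "\<exists>Y\<in>carrier HA. Y \<oplus>\<^bsub>HA\<^esub> X = \<zero>\<^bsub>HA\<^esub>"
      by (rule bexI[of _ "(-1) \<odot>\<^bsub>HA\<^esub> X"], rule HA_eqI) (simp_all add: HA_closed co_HA X)
    show "\<zero>\<^bsub>HA\<^esub> \<oplus>\<^bsub>HA\<^esub> X = X" by (rule HA_eqI) (simp_all add: HA_closed co_HA X)
    fix Y assume Y: "Y \<in> carrier HA"
    show "X \<oplus>\<^bsub>HA\<^esub> Y \<in> carrier HA" by (rule HA_closed(1)[OF X Y])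
    show "X \<oplus>\<^bsub>HA\<^esub> Y = Y \<oplus>\<^bsub>HA\<^esub> X" by (rule HA_eqI) (simp_all add: HA_closed co_HA X Y)
    fix V assume V: "V \<in> carrier HA"
    show "X \<oplus>\<^bsub>HA\<^esub> Y \<oplus>\<^bsub>HA\<^esub> V = X \<oplus>\<^bsub>HA\<^esub> (Y \<oplus>\<^bsub>HA\<^esub> V)"
      by (rule HA_eqI) (simp_all add: HA_closed co_HA X Y V)
  qed (rule HA_closed(3))
  fix c X assume X: "X \<in> carrier HA"
  show "c \<odot>\<^bsub>HA\<^esub> X \<in> carrier HA" by (rule HA_closed(2)[OF X])
  show "(c \<oplus>\<^bsub>class_ring\<^esub> d) \<odot>\<^bsub>HA\<^esub> X = c \<odot>\<^bsub>HA\<^esub> X \<oplus>\<^bsub>HA\<^esub> d \<odot>\<^bsub>HA\<^esub> X" for d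
    by (rule HA_eqI) (simp_all add: HA_closed co_HA X distrib_right)
  show "(c \<otimes>\<^bsub>class_ring\<^esub> d) \<odot>\<^bsub>HA\<^esub> X = c \<odot>\<^bsub>HA\<^esub> (d \<odot>\<^bsub>HA\<^esub> X)" for d
    by (rule HA_eqI) (simp_all add: HA_closed co_HA X)
  show "\<one>\<^bsub>class_ring\<^esub> \<odot>\<^bsub>HA\<^esub> X = X" by (rule HA_eqI) (simp_all add: HA_closed co_HA X)
  fix Y assume Y: "Y \<in> carrier HA"
  show "c \<odot>\<^bsub>HA\<^esub> (X \<oplus>\<^bsub>HA\<^esub> Y) = c \<odot>\<^bsub>HA\<^esub> X \<oplus>\<^bsub>HA\<^esub> c \<odot>\<^bsub>HA\<^esub> Y"
    by (rule HA_eqI) (simp_all add: HA_closed co_HA X Y distrib_left)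
qed

lemma HA_vectorspace: "vectorspace class_ring HA"
  by (rule vectorspace.intro[OF HA_module class_field])

section \<open>The product in coordinates\<close>

lemma HA_mult:
  assumes "X \<in> carrier HA" "Y \<in> carrier HA"
  shows "X \<otimes>\<^bsub>HA\<^esub> Y \<in> carrier HA"
    and "l \<in> idx r \<Longrightarrow> co r l ((X \<otimes>\<^bsub>HA\<^esub> Y) r) =
      (\<Sum>p\<le>r. lam_mult p (r - p) (\<lambda>l. co p l (X p)) (\<lambda>l. co (r - p) l (Y (r - p))) l)"
proof -
  have eq: "(X \<otimes>\<^bsub>HA\<^esub> Y) r = (\<Oplus>\<^bsub>D r\<^esub>p\<in>{..r}. cup n p (r - p) (X p) (Y (r - p)))" for r
    by (simp add: HK_def)
  have XY: "X p \<in> carrier (D p)" "Y p \<in> carrier (D p)" for p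
    using assms unfolding HA_carrier by blast+
  have cl: "cup n p (r - p) (X p) (Y (r - p)) \<in> carrier (D r)" if "p \<in> {..r}" for p r
    using cup_closed(1)[OF XY(1)[of p] XY(2)[of "r - p"]] that by simp
  have val: "co r l (cup n p (r - p) (X p) (Y (r - p))) =
      lam_mult p (r - p) (\<lambda>l. co p l (X p)) (\<lambda>l. co (r - p) l (Y (r - p))) l"
    if "p \<in> {..r}" "l \<in> idx r" for p r l
  proof -
    have r: "p + (r - p) = r" using that by simp
    show ?thesis using cup_closed(2)[OF XY(1)[of p] XY(2)[of "r - p"], unfolded r, OF that(2)] .
  qed
  have fs: "(\<Oplus>\<^bsub>D r\<^esub>p\<in>{..r}. cup n p (r - p) (X p) (Y (r - p))) \<in> carrier (D r) \<and>
      (\<forall>l\<in>idx r. co r l (\<Oplus>\<^bsub>D r\<^esub>p\<in>{..r}. cup n p (r - p) (X p) (Y (r - p))) =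
        (\<Sum>p\<le>r. co r l (cup n p (r - p) (X p) (Y (r - p)))))" for r
    by (rule finsum_D[OF finite_atMost]) (rule cl)
  show "X \<otimes>\<^bsub>HA\<^esub> Y \<in> carrier HA" unfolding HA_carrier eq by (rule allI, rule conjunct1[OF fs])
  show "co r l ((X \<otimes>\<^bsub>HA\<^esub> Y) r) =
      (\<Sum>p\<le>r. lam_mult p (r - p) (\<lambda>l. co p l (X p)) (\<lambda>l. co (r - p) l (Y (r - p))) l)" if l: "l \<in> idx r"
  proof -
    have "co r l ((X \<otimes>\<^bsub>HA\<^esub> Y) r) = (\<Sum>p\<le>r. co r l (cup n p (r - p) (X p) (Y (r - p))))"
      unfolding eq by (rule bspec[OF conjunct2[OF fs] l])
    also have "\<dots> = (\<Sum>p\<le>r. lam_mult p (r - p) (\<lambda>l. co p l (X p)) (\<lambda>l. co (r - p) l (Y (r - p))) l)"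
      by (intro sum.cong refl val l)
    finally show ?thesis .
  qed
qed

text \<open>Commutativity holds without signs because \<open>lam_mult\<close> is symmetric.\<close>

lemma HA_commute:
  assumes X: "X \<in> carrier HA" and Y: "Y \<in> carrier HA"
  shows "X \<otimes>\<^bsub>HA\<^esub> Y = Y \<otimes>\<^bsub>HA\<^esub> X"
proof (rule HA_eqI[OF HA_mult(1)[OF X Y] HA_mult(1)[OF Y X]])
  fix r l assume l: "l \<in> idx r"
  show "co r l ((X \<otimes>\<^bsub>HA\<^esub> Y) r) = co r l ((Y \<otimes>\<^bsub>HA\<^esub> X) r)"
    unfolding HA_mult(2)[OF X Y l] HA_mult(2)[OF Y X l]
    using sum_reverse[of "\<lambda>p q. lam_mult p q (\<lambda>l. co p l (X p)) (\<lambda>l. co q l (Y q)) l" r]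
    by (simp only: lam_mult_commute[of "_ - _"])
qed

lemma lam_mult_zero: "lam_mult p q (\<lambda>l. 0) y l = 0" "lam_mult p q x (\<lambda>l. 0) l = 0"
  by (simp_all add: lam_mult_def)

lemma in_degree_closed: "x \<in> carrier (D p) \<Longrightarrow> in_degree n p x \<in> carrier HA"
  by (simp add: HA_carrier in_degree_def D_zero_closed)

lemma in_degree_mult:
  assumes x: "x \<in> carrier (D p)" and y: "y \<in> carrier (D q)" and l: "l \<in> idx r"
  shows "co r l ((in_degree n p x \<otimes>\<^bsub>HA\<^esub> in_degree n q y) r) =
    (if r = p + q then lam_mult p q (\<lambda>l. co p l x) (\<lambda>l. co q l y) l else 0)"
proof -
  let ?t = "\<lambda>p'. lam_mult p' (r - p') (\<lambda>l. co p' l (in_degree n p x p')) (\<lambda>l. co (r - p') l (in_degree n q y (r - p'))) l"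
  \<comment> \<open>In every bidegree other than \<open>(p, q)\<close> one factor has all
    coordinates zero.\<close>
  have z: "?t p' = 0" if "p' \<le> r" "p' \<noteq> p \<or> r - p' \<noteq> q" for p'
    using that(2)
  proof
    have l': "l \<in> idx (p' + (r - p'))" using l that by simp
    assume "p' \<noteq> p"
    then have "?t p' = lam_mult p' (r - p') (\<lambda>l. 0) (\<lambda>l. co (r - p') l (in_degree n q y (r - p'))) l"
      by (intro lam_mult_cong[OF l']) (simp_all add: in_degree_def co_zero)
    then show ?thesis by (simp add: lam_mult_zero)
  next
    have l': "l \<in> idx (p' + (r - p'))" using l that by simp
    assume "r - p' \<noteq> q"
    then have "?t p' = lam_mult p' (r - p') (\<lambda>l. co p' l (in_degree n p x p')) (\<lambda>l. 0) l"
      by (intro lam_mult_cong[OF l']) (simp_all add: in_degree_def co_zero)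
    then show ?thesis by (simp add: lam_mult_zero)
  qed
  have "co r l ((in_degree n p x \<otimes>\<^bsub>HA\<^esub> in_degree n q y) r) = (\<Sum>p'\<le>r. ?t p')"
    by (rule HA_mult(2)[OF in_degree_closed[OF x] in_degree_closed[OF y] l])
  also have "\<dots> = (if r = p + q then lam_mult p q (\<lambda>l. co p l x) (\<lambda>l. co q l y) l else 0)"
  proof (cases "r = p + q")
    case True
    have "(\<Sum>p'\<le>r. ?t p') = (\<Sum>p'\<le>r. if p' = p then ?t p else 0)"
    proof (intro sum.cong refl)
      fix p' assume "p' \<in> {..r}"
      then show "?t p' = (if p' = p then ?t p else 0)" using z[of p'] by (cases "p' = p") simp_all
    qed
    also have "\<dots> = ?t p" using True by simp
    finally show ?thesis using True by (simp add: in_degree_def)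
  next
    case False
    have "?t p' = 0" if "p' \<le> r" for p'
    proof (rule z[OF that])
      show "p' \<noteq> p \<or> r - p' \<noteq> q" using that False by auto
    qed
    then have "(\<Sum>p'\<le>r. ?t p') = 0" by (intro sum.neutral) simp
    with False show ?thesis by simp
  qed
  finally show ?thesis .
qed

text \<open>The sign differs from 1 only when both degrees are odd, and then the product has all
  coordinates zero.\<close>

lemma graded_commutative:
  assumes x: "x \<in> homogeneous n p" and y: "y \<in> homogeneous n q"
  shows "x \<otimes>\<^bsub>HA\<^esub> y = ((- 1) ^ (p * q)) \<odot>\<^bsub>HA\<^esub> (y \<otimes>\<^bsub>HA\<^esub> x)"
proof -
  obtain x' where x': "x' \<in> carrier (D p)" "x = in_degree n p x'" using x by (auto simp: homogeneous_def)
  obtain y' where y': "y' \<in> carrier (D q)" "y = in_degree n q y'" using y by (auto simp: homogeneous_def)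
  have cl: "x \<in> carrier HA" "y \<in> carrier HA" using x' y' in_degree_closed by auto
  have yx: "y \<otimes>\<^bsub>HA\<^esub> x \<in> carrier HA" by (rule HA_mult(1)[OF cl(2,1)])
  show ?thesis
  proof (rule HA_eqI[OF HA_mult(1)[OF cl] HA_closed(2)[OF yx]])
    fix r l assume l: "l \<in> idx r"
    have "co r l ((x \<otimes>\<^bsub>HA\<^esub> y) r) = (- 1) ^ (p * q) * co r l ((x \<otimes>\<^bsub>HA\<^esub> y) r)"
    proof (cases "even (p * q)")
      case False
      then have "odd p" "odd q" by auto
      then have "lam_mult p q u v l = 0" for u v
        by (auto simp: lam_mult_def)
      then have "co r l ((x \<otimes>\<^bsub>HA\<^esub> y) r) = 0"
        unfolding x'(2) y'(2) in_degree_mult[OF x'(1) y'(1) l] by simp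
      then show ?thesis by simp
    qed simp
    then show "co r l ((x \<otimes>\<^bsub>HA\<^esub> y) r) = co r l (((- 1) ^ (p * q) \<odot>\<^bsub>HA\<^esub> (y \<otimes>\<^bsub>HA\<^esub> x)) r)"
      using co_HA(2)[OF yx l] HA_commute[OF cl] by simp
  qed
qed

subsection \<open>The basis elements\<close>

lemma concat_replicate_snoc: "concat (replicate (Suc k) xs) = concat (replicate k xs) @ xs"
  by (induction k) simp_all

text \<open>The prefix \<open>xs\<close> is kept general: it is \<open>[Arr i]\<close> for
  \<open>zeta\<close> and the loop itself for \<open>z\<close>. The path in front also absorbs the
  zeroth power, which is the unit of $A$.\<close>

lemma path_vec_loop:
  assumes "Suc i < n" "is_path n j xs i"
  shows "proj n (path_vec (j, xs, i) :: 'f pvec) \<otimes>\<^bsub>A\<^esub> (a_star n i \<otimes>\<^bsub>A\<^esub> a n i) [^]\<^bsub>A\<^esub> k =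
      proj n (path_vec (j, xs @ concat (replicate k [Star i, Arr i]), i))
    \<and> is_path n j (xs @ concat (replicate k [Star i, Arr i])) i"
proof (induction k)
  case 0
  then show ?case using assms proj_closed[OF path_vec_closed[OF assms(2)]] by simp
next
  case (Suc k)
  have S: "is_path n i [Star i] (Suc i)" and R: "is_path n (Suc i) [Arr i] i" and SA: "is_path n i [Star i, Arr i] i"
    using assms(1) by (simp_all add: arrows_def)
  have x: "a_star n i \<otimes>\<^bsub>A\<^esub> a n i = proj n (path_vec (i, [Star i, Arr i], i))"
    using assms(1) unfolding a_star_def a_def arrow_vec_def
    by (simp add: proj_mult[OF path_vec_closed[OF S] path_vec_closed[OF R], simplified] path_vec_mult)
  have xc: "a_star n i \<otimes>\<^bsub>A\<^esub> a n i \<in> carrier A" unfolding x by (rule proj_closed[OF path_vec_closed[OF SA]])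
  let ?ys = "xs @ concat (replicate k [Star i, Arr i])"
  have rep: "concat (replicate (Suc k) [Star i, Arr i]) = concat (replicate k [Star i, Arr i]) @ [Star i, Arr i]"
    by (rule concat_replicate_snoc)
  have p: "is_path n j ?ys i" using Suc by simp
  have "proj n (path_vec (j, xs, i) :: 'f pvec) \<otimes>\<^bsub>A\<^esub> (a_star n i \<otimes>\<^bsub>A\<^esub> a n i) [^]\<^bsub>A\<^esub> Suc k =
      proj n (path_vec (j, ?ys, i)) \<otimes>\<^bsub>A\<^esub> (a_star n i \<otimes>\<^bsub>A\<^esub> a n i)"
    using Suc xc proj_closed[OF path_vec_closed[OF assms(2)]] by (simp add: A.m_assoc[symmetric])
  also have "\<dots> = proj n (path_vec (j, ?ys @ [Star i, Arr i], i))"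
    unfolding x using assms(1)
    by (simp add: proj_mult[OF path_vec_closed[OF p] path_vec_closed[OF SA]] path_vec_mult)
  finally show ?case using p SA unfolding rep append_assoc[symmetric] is_path_append by blast
qed

lemma length_loop: "length (concat (replicate k [Star i, Arr i])) = 2 * k"
  by (induction k) auto

text \<open>The exponent is positive because the zeroth power is the unit of $A$ and not the
  idempotent at \<open>i\<close>.\<close>

lemma loop_power:
  assumes "Suc i < n" "0 < k"
  shows "(a_star n i \<otimes>\<^bsub>A\<^esub> a n i) [^]\<^bsub>A\<^esub> k \<in> carrier A"
    and "coeff n ((a_star n i \<otimes>\<^bsub>A\<^esub> a n i) [^]\<^bsub>A\<^esub> k) j i' L = (if j = i \<and> i' = i \<and> L = 2 * k \<and> admissible n i i L then 1 else 0 :: 'f)"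
proof -
  have i: "is_path n i [] i" using assms by simp
  let ?ys = "concat (replicate k [Star i, Arr i])"
  have one: "proj n (path_vec (i, [], i)) \<otimes>\<^bsub>A\<^esub> (a_star n i \<otimes>\<^bsub>A\<^esub> a n i) [^]\<^bsub>A\<^esub> k = proj n (path_vec (i, ?ys, i) :: 'f pvec)"
    and p: "is_path n i ?ys i"
    using path_vec_loop[OF assms(1) i, of k] by simp_all
  obtain k' where k': "k = Suc k'" using assms(2) by (cases k) auto
  have SA: "is_path n i [Star i, Arr i] i" and S: "is_path n i [Star i] (Suc i)" and R: "is_path n (Suc i) [Arr i] i"
    using assms(1) by (simp_all add: arrows_def)
  have x: "a_star n i \<otimes>\<^bsub>A\<^esub> a n i = proj n (path_vec (i, [Star i, Arr i], i))"
    using assms(1) unfolding a_star_def a_def arrow_vec_def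
    by (simp add: proj_mult[OF path_vec_closed[OF S] path_vec_closed[OF R], simplified] path_vec_mult)
  have xc: "a_star n i \<otimes>\<^bsub>A\<^esub> a n i \<in> carrier A" unfolding x by (rule proj_closed[OF path_vec_closed[OF SA]])
  \<comment> \<open>One loop is split off as the prefix required by
    \<open>path_vec_loop\<close>.\<close>
  have "(a_star n i \<otimes>\<^bsub>A\<^esub> a n i) [^]\<^bsub>A\<^esub> k = (a_star n i \<otimes>\<^bsub>A\<^esub> a n i) \<otimes>\<^bsub>A\<^esub> (a_star n i \<otimes>\<^bsub>A\<^esub> a n i) [^]\<^bsub>A\<^esub> k'"
    unfolding k' using xc by (rule A.nat_pow_Suc2)
  also have "\<dots> = proj n (path_vec (i, ?ys, i))"
    using path_vec_loop[OF assms(1) SA, of k'] unfolding x[symmetric] by (simp add: k')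
  finally have e: "(a_star n i \<otimes>\<^bsub>A\<^esub> a n i) [^]\<^bsub>A\<^esub> k = proj n (path_vec (i, ?ys, i))" .
  show "(a_star n i \<otimes>\<^bsub>A\<^esub> a n i) [^]\<^bsub>A\<^esub> k \<in> carrier A"
    unfolding e by (rule proj_closed[OF path_vec_closed[OF p]])
  show "coeff n ((a_star n i \<otimes>\<^bsub>A\<^esub> a n i) [^]\<^bsub>A\<^esub> k) j i' L = (if j = i \<and> i' = i \<and> L = 2 * k \<and> admissible n i i L then 1 else 0 :: 'f)"
    unfolding e coeff_vec[OF p] length_loop by auto
qed

lemma z_closed: "z n k \<in> carrier A"
  and coeff_z: "admissible n j i L \<Longrightarrow> coeff n (z n k) j i L = (if j = i \<and> L = 2 * k then 1 else 0 :: 'f)"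
proof -
  have "(z n k :: 'f pvec set) \<in> carrier A \<and>
    (\<forall>j i L. admissible n j i L \<longrightarrow> coeff n (z n k) j i L = (if j = i \<and> L = 2 * k then 1 else 0 :: 'f))"
  proof (cases "k = 0")
    case True
    have "path_coeff n \<one>\<^bsub>P\<^esub> j i L = (if j = i \<and> L = 0 then 1 else 0)" if "admissible n j i L" for j i L
    proof -
      have "path_coeff n \<one>\<^bsub>P\<^esub> j i L = (\<Sum>xs\<in>words n L. if xs = [] then if j = i then 1 else 0 else 0)"
        unfolding path_coeff_def using admissible_less[OF that] by (intro sum.cong refl) (auto simp: path_one_apply)
      moreover have "[] \<in> words n L \<longleftrightarrow> L = 0" by (auto simp: words_def)
      ultimately show ?thesis by simp
    qed
    then show ?thesis using True path_one_closed by (simp add: z_def proj_one proj_closed coeff_proj)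
  next
    case False
    let ?x = "\<lambda>i. (a_star n i \<otimes>\<^bsub>A\<^esub> a n i) [^]\<^bsub>A\<^esub> k"
    have zk: "(z n k :: 'f pvec set) = (\<Oplus>\<^bsub>A\<^esub>i\<in>{1..n - 2}. ?x i)" using False by (simp add: z_def)
    have lt: "i \<in> {1..n - 2} \<Longrightarrow> Suc i < n" for i using n3 by auto
    have cl: "?x \<in> {1..n - 2} \<rightarrow> carrier A" using lt loop_power(1) False by auto
    have "coeff n (z n k) j i L = (if j = i \<and> L = 2 * k then 1 else 0 :: 'f)" if adm: "admissible n j i L" for j i L
    proof -
      have "coeff n (z n k :: 'f pvec set) j i L = (\<Sum>t\<in>{1..n - 2}. coeff n (?x t) j i L)"
        unfolding zk by (rule coeff_finsum[OF cl])
      also have "\<dots> = (\<Sum>t\<in>{1..n - 2}. if t = j then if j = i \<and> L = 2 * k then 1 else 0 else 0)"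
      proof (intro sum.cong refl)
        fix t assume "t \<in> {1..n - 2}"
        from loop_power(2)[OF lt[OF this], of k j i L] False adm
        show "coeff n (?x t) j i L = (if t = j then if j = i \<and> L = 2 * k then 1 else 0 else 0)" by auto
      qed
      \<comment> \<open>A positive length \<open>2 * k\<close> is admissible at
        \<open>(j, j)\<close> only for interior \<open>j\<close>, so the sum over
        \<open>{1..n - 2}\<close> misses no vertex.\<close>
      also have "\<dots> = (if j = i \<and> L = 2 * k then 1 else 0)"
      proof (cases "j = i \<and> L = 2 * k")
        case True
        with adm False have "1 \<le> j" "j \<le> n - 2" by (auto simp: admissible_diag)
        with True show ?thesis by simp
      qed auto
      finally show ?thesis .
    qed
    then show ?thesis unfolding zk using A.finsum_closed[OF cl] by blast
  qed
  then show "z n k \<in> carrier A"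
    and "admissible n j i L \<Longrightarrow> coeff n (z n k) j i L = (if j = i \<and> L = 2 * k then 1 else 0 :: 'f)" by blast+
qed

lemma z_cochain: "(\<lambda>u\<in>W n 0. proj n u \<otimes>\<^bsub>A\<^esub> z n k) = mk 0 (\<lambda>j xs i L. if L = 2 * k then 1 else 0)"
proof (rule ext)
  fix u :: "'f pvec"
  show "(\<lambda>u\<in>W n 0. proj n u \<otimes>\<^bsub>A\<^esub> z n k) u = mk 0 (\<lambda>j xs i L. if L = 2 * k then 1 else 0) u"
  proof (cases "u \<in> W n 0")
    case True
    note u = W_tensor_power[OF True]
    have uc: "proj n u \<in> carrier A" by (rule proj_closed[OF W_closed[OF True]])
    have "proj n u \<otimes>\<^bsub>A\<^esub> z n k = mk 0 (\<lambda>j xs i L. if L = 2 * k then 1 else 0) u"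
    proof (rule mk_apply_eqI[OF True])
      show "proj n u \<otimes>\<^bsub>A\<^esub> z n k \<in> carrier A" using uc z_closed by simp
      fix j i L assume adm: "admissible n j i L"
      \<comment> \<open>The unit on the right brings the product into the form of
        \<open>coeff_bimodule\<close>.\<close>
      have "proj n u \<otimes>\<^bsub>A\<^esub> z n k = proj n u \<otimes>\<^bsub>A\<^esub> z n k \<otimes>\<^bsub>A\<^esub> proj n \<one>\<^bsub>P\<^esub>"
        using uc z_closed by (simp add: proj_one[symmetric])
      then have "coeff n (proj n u \<otimes>\<^bsub>A\<^esub> z n k) j i L = coeff n (proj n u \<otimes>\<^bsub>A\<^esub> z n k \<otimes>\<^bsub>A\<^esub> proj n \<one>\<^bsub>P\<^esub>) j i L"
        by (rule arg_cong)
      also have "\<dots> = u (j, [], j) * coeff n (z n k) j i L"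
        unfolding coeff_bimodule[OF u one_tensor_power z_closed]
        using admissible_less[OF adm] by (simp add: path_one_apply)
      also have "\<dots> = u (j, [], i) * (if L = 2 * k then 1 else 0)"
      proof (cases "j = i")
        case False
        then have "u (j, [], i) = 0" using tensor_power_0_apply[OF u, of j "[]" i] by blast
        with False coeff_z[OF adm, of k] show ?thesis by simp
      qed (use coeff_z[OF adm, of k] in simp)
      finally show "coeff n (proj n u \<otimes>\<^bsub>A\<^esub> z n k) j i L = (\<Sum>xs\<in>words n 0. u (j, xs, i) * (if L = 2 * k then 1 else 0))"
        by simp
    qed
    with True show ?thesis by simp
  next
    case False
    then show ?thesis by (simp add: mk_def)
  qed
qed

text \<open>Values on arrows can be prescribed through \<open>mk\<close> and determine a cochain by
  \<open>Hom_ext_1\<close>, so the description in \<open>zeta\<close> has a unique solution.\<close>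

lemma zeta_mk: "zeta n k = mk (Suc 0) (\<lambda>j xs i L. if xs = [Arr i] \<and> L = Suc (2 * k) then 1 else 0)"
proof -
  let ?f = "mk (Suc 0) (\<lambda>j xs i L. if xs = [Arr i] \<and> L = Suc (2 * k) then 1 else 0)"
  let ?v = "\<lambda>i. a n i \<otimes>\<^bsub>A\<^esub> (a_star n i \<otimes>\<^bsub>A\<^esub> a n i) [^]\<^bsub>A\<^esub> k"
  have v: "?v i \<in> carrier A \<and> (\<forall>j i' L. coeff n (?v i) j i' L =
      (if j = Suc i \<and> i' = i \<and> L = Suc (2 * k) \<and> admissible n (Suc i) i L then 1 else 0 :: 'f))" if i: "Suc i < n" for i
  proof -
    have R: "is_path n (Suc i) [Arr i] i" using i by (simp add: arrows_def)
    let ?ys = "[Arr i] @ concat (replicate k [Star i, Arr i])"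
    have e: "?v i = proj n (path_vec (Suc i, ?ys, i))" and p: "is_path n (Suc i) ?ys i"
      using path_vec_loop[OF i R, of k] unfolding a_def arrow_vec_def by simp_all
    have len: "length ?ys = Suc (2 * k)" using length_loop[of k i] by simp
    show ?thesis unfolding e coeff_vec[OF p] len using proj_closed[OF path_vec_closed[OF p]] by auto
  qed
  have vals: "?f (arrow_vec (Arr i)) = ?v i \<and> ?f (arrow_vec (Star i)) = \<zero>\<^bsub>A\<^esub>" if i: "i < n - 1" for i
  proof -
    from i have i': "Suc i < n" by simp
    have x: "Arr i \<in> arrows n" "Star i \<in> arrows n" using i' by (auto simp: arrows_def)
    have "?f (arrow_vec (Arr i)) = ?v i"
      by (rule coeff_inject) (use v[OF i'] in \<open>auto simp: mk_closed[OF arrow_vec_in_W[OF x(1)]] coeff_mk_arrow[OF x(1)]\<close>)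
    moreover have "?f (arrow_vec (Star i)) = \<zero>\<^bsub>A\<^esub>"
      by (rule coeff_inject) (simp_all add: mk_closed[OF arrow_vec_in_W[OF x(2)]] coeff_mk_arrow[OF x(2)] coeff_zero)
    ultimately show ?thesis ..
  qed
  show ?thesis
    unfolding zeta_def
  proof (rule the_equality)
    show "?f \<in> Hom_ke n 1 \<and> (\<forall>i<n - 1. ?f (arrow_vec (Arr i)) = ?v i \<and> ?f (arrow_vec (Star i)) = \<zero>\<^bsub>A\<^esub>)"
      using mk_in_Hom vals by simp
    fix f :: "'f cochain"
    assume f: "f \<in> Hom_ke n 1 \<and> (\<forall>i<n - 1. f (arrow_vec (Arr i)) = ?v i \<and> f (arrow_vec (Star i)) = \<zero>\<^bsub>A\<^esub>)"
    show "f = ?f"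
    proof (rule Hom_ext_1[OF _ mk_in_Hom])
      show "f \<in> Hom_ke n (Suc 0)" using f by simp
      fix x L assume "x \<in> arrows n"
      then have "f (arrow_vec x) = ?f (arrow_vec x)" using f vals by (auto simp: arrows_def)
      then show "coeff n (f (arrow_vec x)) (tgt x) (src x) L = coeff n (?f (arrow_vec x)) (tgt x) (src x) L" by simp
    qed
  qed
qed

text \<open>As in \<open>Hom_eq_mk\<close>, the value 1 on \<open>sigma n k\<close> is realised by
  -1 on its peak, or by 1 on the dip at the last vertex.\<close>

lemma h_mk:
  assumes k: "k < n"
  shows "h n k = mk 2 (\<lambda>j xs i L. if j = k \<and> L = 0 then if xs = [Star j, Arr j] then - 1 else if j = n - 1 then 1 else 0 else 0)"
    (is "_ = mk 2 ?\<phi>")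
proof -
  have rc: "rel_coeff ?\<phi> l L = (if l = k \<and> L = 0 then 1 else 0)" if "l < n" for l L
    using that n3 by (auto simp: rel_coeff_def)
  have vals: "mk 2 ?\<phi> (sigma n l) = (if k = l then proj n (vertex k) else \<zero>\<^bsub>A\<^esub>)" if l: "l < n" for l
  proof (rule coeff_inject)
    show "mk 2 ?\<phi> (sigma n l) \<in> carrier A" by (rule mk_closed[OF sigma_in_W[OF l]])
    have vertex: "is_path n l [] l" using l by simp
    show "(if k = l then proj n (vertex k) else \<zero>\<^bsub>A\<^esub>) \<in> carrier A"
      using proj_closed[OF path_vec_closed[OF vertex]] by (simp add: vertex_def)
    fix j i L
    show "coeff n (mk 2 ?\<phi> (sigma n l)) j i L = coeff n (if k = l then proj n (vertex k) else \<zero>\<^bsub>A\<^esub>) j i L"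
    proof (cases "k = l")
      case True
      then show ?thesis unfolding coeff_mk_sigma[OF l] rc[OF l] by (auto simp: vertex_def coeff_vec[OF vertex])
    next
      case False
      then show ?thesis unfolding coeff_mk_sigma[OF l] rc[OF l] by (simp add: coeff_zero)
    qed
  qed
  show ?thesis
    unfolding h_def
  proof (rule the_equality)
    show "mk 2 ?\<phi> \<in> Hom_ke n 2 \<and> (\<forall>j<n. mk 2 ?\<phi> (sigma n j) = (if k = j then proj n (vertex k) else \<zero>\<^bsub>A\<^esub>))"
      using mk_in_Hom vals by blast
    fix f :: "'f cochain"
    assume f: "f \<in> Hom_ke n 2 \<and> (\<forall>j<n. f (sigma n j) = (if k = j then proj n (vertex k) else \<zero>\<^bsub>A\<^esub>))"
    show "f = mk 2 ?\<phi>"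
    proof (rule Hom_ext_2[OF _ mk_in_Hom])
      show "f \<in> Hom_ke n 2" using f by blast
      fix l L assume "l < n"
      with f vals have "f (sigma n l) = mk 2 ?\<phi> (sigma n l)" by simp
      then show "coeff n (f (sigma n l)) l l L = coeff n (mk 2 ?\<phi> (sigma n l)) l l L" by simp
    qed
  qed
qed

section \<open>Labels and the coordinates of the basis elements\<close>

fun degree :: "label \<Rightarrow> nat" where
  "degree (Z k) = 0" | "degree (Zeta k) = Suc 0" | "degree (H k) = 2"

fun index :: "label \<Rightarrow> nat" where
  "index (Z k) = k" | "index (Zeta k) = k" | "index (H k) = k"

lemma basis_elt_coset:
  assumes "case x of H k \<Rightarrow> k < n | _ \<Rightarrow> True"
  shows "\<exists>f\<in>cocycles n (degree x). basis_elt n x = in_degree n (degree x) (coset (degree x) f) \<and>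
    (\<forall>l\<in>idx (degree x). lam (degree x) l f = (if l = index x then 1 else 0))"
proof (cases x)
  case (Z k)
  let ?\<phi> = "\<lambda>(j::nat) (xs::arrow list) (i::nat) L. if L = 2 * k then 1 else 0 :: 'f"
  have "mk 0 ?\<phi> \<in> cocycles n 0" unfolding cocycle_0_iff by simp
  moreover have "basis_elt n x = in_degree n 0 (coset 0 (mk 0 ?\<phi>))"
    by (simp add: Z central_class_def coh_class_def z_cochain)
  ultimately show ?thesis using lam_mk_0[of _ ?\<phi>] by (intro bexI[of _ "mk 0 ?\<phi>"]) (auto simp: Z)
next
  case (Zeta k)
  let ?\<phi> = "\<lambda>(j::nat) xs i L. if xs = [Arr i] \<and> L = Suc (2 * k) then 1 else 0 :: 'f"
  have ac: "arrow_coeff ?\<phi> i L = (if L = Suc (2 * k) then 1 else 0)" for i L by (simp add: arrow_coeff_def)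
  have "mk (Suc 0) ?\<phi> \<in> cocycles n (Suc 0)" unfolding cocycle_1_iff ac by simp
  moreover have "basis_elt n x = in_degree n (Suc 0) (coset (Suc 0) (mk (Suc 0) ?\<phi>))"
    by (simp add: Zeta coh_class_def zeta_mk)
  ultimately show ?thesis using lam_mk_1[of _ ?\<phi>] by (intro bexI[of _ "mk (Suc 0) ?\<phi>"]) (auto simp: Zeta ac)
next
  case (H k)
  with assms have k: "k < n" by simp
  let ?\<phi> = "\<lambda>j xs (i::nat) L. if j = k \<and> L = (0::nat) then if xs = [Star j, Arr j] then - 1 else if j = n - 1 then 1 else 0 else 0 :: 'f"
  have rc: "rel_coeff ?\<phi> l 0 = (if l = k then 1 else 0)" if "l < n" for l
    using that n3 by (auto simp: rel_coeff_def)
  have "basis_elt n x = in_degree n 2 (coset 2 (mk 2 ?\<phi>))"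
    by (simp add: H coh_class_def h_mk[OF k])
  moreover have "lam 2 l (mk 2 ?\<phi>) = (if l = k then 1 else 0)" if l: "l \<in> idx 2" for l
    unfolding lam_mk_2[OF l] by (rule rc) (use l in \<open>simp add: idx_def\<close>)
  ultimately show ?thesis using cocycle_ge_2[of 2 ?\<phi>] by (intro bexI[of _ "mk 2 ?\<phi>"]) (simp_all add: H)
qed


text \<open>\<open>z\<close> and \<open>zeta\<close> are described by the same formula for every
  index, an index outside \<open>idx\<close> giving a class with all coordinates zero. Keeping such
  labels valid lets product formulas be proved without range conditions; only \<open>h_mk\<close>
  asks for a vertex of the quiver.\<close>

definition valid :: "label \<Rightarrow> bool" where
  "valid x \<longleftrightarrow> (case x of H k \<Rightarrow> k < n | _ \<Rightarrow> True)"

lemma basis_elt_class: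
  assumes "valid x"
  shows "\<exists>c\<in>carrier (D (degree x)). basis_elt n x = in_degree n (degree x) c \<and>
    (\<forall>l\<in>idx (degree x). co (degree x) l c = (if l = index x then 1 else 0))"
proof -
  obtain f where f: "f \<in> cocycles n (degree x)" "basis_elt n x = in_degree n (degree x) (coset (degree x) f)"
    "\<forall>l\<in>idx (degree x). lam (degree x) l f = (if l = index x then 1 else 0)"
    using basis_elt_coset[of x] assms unfolding valid_def by blast
  show ?thesis
  proof (intro bexI[of _ "coset (degree x) f"] conjI f(2) ballI)
    show "coset (degree x) f \<in> carrier (D (degree x))" unfolding D_carrier using f(1) by blast
    fix l assume "l \<in> idx (degree x)"
    then show "co (degree x) l (coset (degree x) f) = (if l = index x then 1 else 0)"
      using f(3) by (simp add: co_coset[OF f(1)])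
  qed
qed

lemma basis_elt_closed: "valid x \<Longrightarrow> basis_elt n x \<in> carrier HA"
  using basis_elt_class in_degree_closed by metis

lemma co_basis_elt:
  assumes x: "valid x" and l: "l \<in> idx p"
  shows "co p l (basis_elt n x p) = (if p = degree x \<and> l = index x then 1 else 0)"
proof -
  obtain c where c: "basis_elt n x = in_degree n (degree x) c"
    "\<forall>l\<in>idx (degree x). co (degree x) l c = (if l = index x then 1 else 0)"
    using basis_elt_class[OF x] by blast
  show ?thesis
  proof (cases "p = degree x")
    case True
    with c l show ?thesis by (simp add: in_degree_def)
  next
    case False
    with l show ?thesis unfolding c(1) by (simp add: in_degree_def co_zero)
  qed
qed

definition delta :: "nat \<Rightarrow> nat \<Rightarrow> 'f" where
  "delta k l = (if l = k then 1 else 0)"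

lemma co_basis_elt_mult:
  assumes x: "valid x" and y: "valid y" and l: "l \<in> idx r"
  shows "co r l ((basis_elt n x \<otimes>\<^bsub>HA\<^esub> basis_elt n y) r) =
    (if r = degree x + degree y then lam_mult (degree x) (degree y) (delta (index x)) (delta (index y)) l else 0)"
proof -
  obtain c where c: "c \<in> carrier (D (degree x))" "basis_elt n x = in_degree n (degree x) c"
    "\<forall>l\<in>idx (degree x). co (degree x) l c = (if l = index x then 1 else 0)"
    using basis_elt_class[OF x] by blast
  obtain d where d: "d \<in> carrier (D (degree y))" "basis_elt n y = in_degree n (degree y) d"
    "\<forall>l\<in>idx (degree y). co (degree y) l d = (if l = index y then 1 else 0)"
    using basis_elt_class[OF y] by blast
  show ?thesis
  proof (cases "r = degree x + degree y")
    case True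
    have "lam_mult (degree x) (degree y) (\<lambda>l. co (degree x) l c) (\<lambda>l. co (degree y) l d) l =
        lam_mult (degree x) (degree y) (delta (index x)) (delta (index y)) l"
      by (rule lam_mult_cong) (use l True c(3) d(3) in \<open>simp_all add: delta_def\<close>)
    with True show ?thesis unfolding c(2) d(2) in_degree_mult[OF c(1) d(1) l] by simp
  next
    case False
    then show ?thesis unfolding c(2) d(2) in_degree_mult[OF c(1) d(1) l] by simp
  qed
qed

lemma delta_convolution: "(\<Sum>k\<le>l. delta i k * delta j (l - k)) = delta (i + j) l"
proof -
  have "(\<Sum>k\<le>l. delta i k * delta j (l - k)) = (\<Sum>k\<le>l. if k = i then delta j (l - i) else 0)"
    by (intro sum.cong refl) (simp add: delta_def)
  also have "\<dots> = delta (i + j) l" by (auto simp: delta_def)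
  finally show ?thesis .
qed

lemma lam_mult_delta:
  "lam_mult p q (delta i) (delta j) l =
    (if p = 0 \<and> q \<le> 1 \<or> p = 1 \<and> q = 0 then delta (i + j) l
     else if p = 0 \<and> q = 2 then delta i 0 * delta j l
     else if p = 2 \<and> q = 0 then delta j 0 * delta i l else 0)"
  by (simp add: lam_mult_def delta_convolution add.commute)

text \<open>The bounds \<open>m\<close> and \<open>n - m - 2\<close> solve
  \<open>2 * l + 1 \<le> n\<close> and \<open>2 * l + 2 \<le> n\<close>; the second is
  \<open>m - 1\<close> for \<open>n = 2 * m + 1\<close> and \<open>m\<close> for
  \<open>n = 2 * m + 2\<close>.\<close>

lemma labels_idx: "m = (n - 1) div 2 \<Longrightarrow> x \<in> labels n m \<longleftrightarrow> index x \<in> idx (degree x)"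
  using n3 by (cases x) (auto simp: labels_def idx_def)

lemma labels_valid: "index x \<in> idx (degree x) \<Longrightarrow> valid x"
  by (cases x) (auto simp: valid_def idx_def)

lemma label_of_idx: "l \<in> idx p \<Longrightarrow> \<exists>x. degree x = p \<and> index x = l"
proof -
  assume "l \<in> idx p"
  then consider "p = 0" | "p = Suc 0" | "p = 2" by (auto simp: idx_def split: if_splits)
  then show ?thesis
    by cases (rule exI[of _ "Z l"], simp, rule exI[of _ "Zeta l"], simp, rule exI[of _ "H l"], simp)
qed

lemma degree_index_inject: "degree x = degree y \<Longrightarrow> index x = index y \<Longrightarrow> x = y"
  by (cases x; cases y) simp_all

section \<open>The basis and its multiplication table\<close>

lemma HK_basis:
  assumes m: "m = (n - 1) div 2"
  shows "inj_on (basis_elt n :: label \<Rightarrow> nat \<Rightarrow> 'f cochain set) (labels n m)"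
    and "vectorspace.basis class_ring HA (basis_elt n ` labels n m)"
proof -
  let ?L = "\<lambda>x X. co (degree x) (index x) (X (degree x))"
  note idx = labels_idx[OF m]
  have fin: "finite (labels n m)" by (simp add: labels_def)
  have cl: "basis_elt n x \<in> carrier HA" if "x \<in> labels n m" for x
    using that basis_elt_closed labels_valid by (simp add: idx)
  have dual: "?L x (basis_elt n y) = (if x = y then 1 else 0)" if "x \<in> labels n m" "y \<in> labels n m" for x y
    using that co_basis_elt[of y "index x" "degree x"] labels_valid[of y] degree_index_inject[of x y]
    by (auto simp: idx)
  have separate: "u = v" if "u \<in> carrier HA" "v \<in> carrier HA" "\<And>x. x \<in> labels n m \<Longrightarrow> ?L x u = ?L x v" for u v
  proof (rule HA_eqI[OF that(1,2)])
    fix p l assume l: "l \<in> idx p"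
    then obtain x where "degree x = p" "index x = l" using label_of_idx by blast
    with that(3)[of x] l show "co p l (u p) = co p l (v p)" by (simp add: idx)
  qed
  have add: "?L x (u \<oplus>\<^bsub>HA\<^esub> v) = ?L x u + ?L x v" if "x \<in> labels n m" "u \<in> carrier HA" "v \<in> carrier HA" for x u v
    using that by (simp add: idx co_HA)
  have smult: "?L x (c \<odot>\<^bsub>HA\<^esub> v) = c * ?L x v" if "x \<in> labels n m" "v \<in> carrier HA" for x c v
    using that by (simp add: idx co_HA)
  show "inj_on (basis_elt n :: label \<Rightarrow> nat \<Rightarrow> 'f cochain set) (labels n m)"
    by (rule dual_basis(1)[where \<Lambda> = ?L, OF HA_vectorspace fin cl add smult dual separate])
  show "vectorspace.basis class_ring HA (basis_elt n ` labels n m)"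
    by (rule dual_basis(2)[where \<Lambda> = ?L, OF HA_vectorspace fin cl add smult dual separate])
qed

lemma valid_simps [simp]: "valid (Z k)" "valid (Zeta k)"
  by (simp_all add: valid_def)

text \<open>The class of 1 has coordinates \<open>delta 0\<close> in degree 0: the unit for
  polynomial multiplication, with constant coefficient 1 for the action on degree 2.\<close>

lemma HK_unit:
  assumes X: "X \<in> carrier HA"
  shows "basis_elt n (Z 0) \<otimes>\<^bsub>HA\<^esub> X = X"
proof -
  note B = basis_elt_closed[OF valid_simps(1)]
  show ?thesis
  proof (rule HA_eqI[OF HA_mult(1)[OF B X] X])
    fix r l assume l: "l \<in> idx r"
    let ?x = "\<lambda>p l. co p l (basis_elt n (Z 0) p)" and ?y = "\<lambda>p l. co p l (X p)"
    have "lam_mult p (r - p) (?x p) (?y (r - p)) l = (if p = 0 then ?y r l else 0)" if p: "p \<le> r" for p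
    proof (cases "p = 0")
      case True
      have "lam_mult 0 r (?x 0) (?y r) l = lam_mult 0 r (delta 0) (?y r) l"
        by (rule lam_mult_cong) (use l in \<open>simp_all add: co_basis_elt delta_def del: basis_elt.simps\<close>)
      also have "\<dots> = ?y r l"
      proof -
        have "(\<Sum>k\<le>l. delta 0 k * ?y r (l - k)) = (\<Sum>k\<le>l. if k = 0 then ?y r l else 0)"
          by (intro sum.cong refl) (simp add: delta_def)
        \<comment> \<open>An inhabited \<open>idx r\<close> excludes higher degrees, where
          \<open>lam_mult 0 r\<close> is zero by definition.\<close>
        moreover have "r \<le> 2" using l by (auto simp: idx_def split: if_splits)
        then have "r \<le> 1 \<or> r = 2" by linarith
        ultimately show ?thesis by (auto simp: lam_mult_def delta_def)
      qed
      finally show ?thesis using True by simp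
    next
      case False
      have "lam_mult p (r - p) (?x p) (?y (r - p)) l = lam_mult p (r - p) (\<lambda>l. 0) (?y (r - p)) l"
        by (rule lam_mult_cong) (use l p False in \<open>simp_all add: co_basis_elt del: basis_elt.simps\<close>)
      then show ?thesis using False by (simp add: lam_mult_zero)
    qed
    then have "(\<Sum>p\<le>r. lam_mult p (r - p) (?x p) (?y (r - p)) l) = (\<Sum>p\<le>r. if p = 0 then ?y r l else 0)"
      by (intro sum.cong refl) simp
    then show "co r l ((basis_elt n (Z 0) \<otimes>\<^bsub>HA\<^esub> X) r) = co r l (X r)"
      unfolding HA_mult(2)[OF B X l] by simp
  qed
qed

text \<open>Convolution of \<open>delta\<close> functions adds indices. If the index of
  \<open>w\<close> leaves \<open>idx\<close>, both sides are zero in all coordinates.\<close>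

lemma HK_product:
  assumes x: "valid x" and y: "valid y" and w: "valid w"
    and "degree w = degree x + degree y" "index w = index x + index y" "degree x = 0" "degree y \<le> 1"
  shows "basis_elt n x \<otimes>\<^bsub>HA\<^esub> basis_elt n y = basis_elt n w"
proof (rule HA_eqI[OF HA_mult(1)[OF basis_elt_closed[OF x] basis_elt_closed[OF y]] basis_elt_closed[OF w]])
  fix r l assume l: "l \<in> idx r"
  show "co r l ((basis_elt n x \<otimes>\<^bsub>HA\<^esub> basis_elt n y) r) = co r l (basis_elt n w r)"
    unfolding co_basis_elt_mult[OF x y l] co_basis_elt[OF w l] lam_mult_delta
    using assms(4-7) by (simp add: delta_def)
qed

lemma HK_product_nonzero:
  assumes x: "valid x" and y: "valid y"
  shows "basis_elt n x \<otimes>\<^bsub>HA\<^esub> basis_elt n y \<noteq> \<zero>\<^bsub>HA\<^esub> \<longleftrightarrow>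
    (\<exists>l\<in>idx (degree x + degree y). lam_mult (degree x) (degree y) (delta (index x)) (delta (index y)) l \<noteq> 0)"
proof
  assume nz: "basis_elt n x \<otimes>\<^bsub>HA\<^esub> basis_elt n y \<noteq> \<zero>\<^bsub>HA\<^esub>"
  show "\<exists>l\<in>idx (degree x + degree y). lam_mult (degree x) (degree y) (delta (index x)) (delta (index y)) l \<noteq> 0"
  proof (rule ccontr)
    assume no: "\<not> ?thesis"
    have "basis_elt n x \<otimes>\<^bsub>HA\<^esub> basis_elt n y = \<zero>\<^bsub>HA\<^esub>"
    proof (rule HA_eqI[OF HA_mult(1)[OF basis_elt_closed[OF x] basis_elt_closed[OF y]] HA_closed(3)])
      fix r l assume l: "l \<in> idx r"
      show "co r l ((basis_elt n x \<otimes>\<^bsub>HA\<^esub> basis_elt n y) r) = co r l (\<zero>\<^bsub>HA\<^esub> r)"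
        unfolding co_basis_elt_mult[OF x y l] co_HA(3)[OF l] using no l by auto
    qed
    with nz show False by contradiction
  qed
next
  assume "\<exists>l\<in>idx (degree x + degree y). lam_mult (degree x) (degree y) (delta (index x)) (delta (index y)) l \<noteq> 0"
  then obtain l where l: "l \<in> idx (degree x + degree y)"
    "lam_mult (degree x) (degree y) (delta (index x)) (delta (index y)) l \<noteq> 0" by blast
  then have "co (degree x + degree y) l ((basis_elt n x \<otimes>\<^bsub>HA\<^esub> basis_elt n y) (degree x + degree y)) \<noteq> 0"
    by (simp add: co_basis_elt_mult[OF x y l(1)])
  with co_HA(3)[OF l(1)] show "basis_elt n x \<otimes>\<^bsub>HA\<^esub> basis_elt n y \<noteq> \<zero>\<^bsub>HA\<^esub>" by auto
qed

text \<open>For total degree at most 1 the product is the \<open>delta\<close> function at the sum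
  of the indices, nonzero exactly when the sum stays in \<open>idx\<close>. Against degree 2 a
  factor of degree 0 acts by \<open>delta\<close> at 0, so only \<open>Z 0\<close> survives.\<close>

lemma HK_listed:
  assumes m: "m = (n - 1) div 2" and x: "x \<in> labels n m" and y: "y \<in> labels n m"
  shows "basis_elt n x \<otimes>\<^bsub>HA\<^esub> basis_elt n y \<noteq> \<zero>\<^bsub>HA\<^esub> \<longleftrightarrow> listed n m x y \<or> listed n m y x"
proof -
  have idx: "index x \<in> idx (degree x)" "index y \<in> idx (degree y)" using x y by (simp_all add: labels_idx[OF m])
  note v = labels_valid[OF idx(1)] labels_valid[OF idx(2)]
  have idx0: "k \<in> idx 0 \<longleftrightarrow> k \<le> m" and idx1: "k \<in> idx (Suc 0) \<longleftrightarrow> k \<le> n - m - 2" for k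
    using m n3 by (auto simp: idx_def)
  show ?thesis
    unfolding HK_product_nonzero[OF v] lam_mult_delta
    by (cases x; cases y) (use idx in \<open>auto simp: listed_def delta_def idx0 idx1 numeral_2_eq_2 add.commute\<close>)
qed

end

theorem proposition6p3:
  fixes n m :: nat
    and HKA :: "('f::field, nat \<Rightarrow> 'f cochain set) module"
  assumes "n \<ge> 3"
    and "m = (n - 1) div 2"
    and "HKA = HK n"
  shows
    "vectorspace class_ring HKA \<and>
     inj_on (basis_elt n :: label \<Rightarrow> nat \<Rightarrow> 'f cochain set) (labels n m) \<and>
     vectorspace.basis class_ring HKA (basis_elt n ` labels n m) \<and>
     (\<forall>p q. \<forall>x\<in>homogeneous n p. \<forall>y\<in>homogeneous n q.
        x \<otimes>\<^bsub>HKA\<^esub> y = ((- 1) ^ (p * q)) \<odot>\<^bsub>HKA\<^esub> (y \<otimes>\<^bsub>HKA\<^esub> x)) \<and>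
     (\<forall>x\<in>carrier HKA. basis_elt n (Z 0) \<otimes>\<^bsub>HKA\<^esub> x = x) \<and>
     (\<forall>l1 l2. l1 + l2 \<le> m \<longrightarrow>
        basis_elt n (Z l1) \<otimes>\<^bsub>HKA\<^esub> basis_elt n (Z l2) = basis_elt n (Z (l1 + l2))) \<and>
     (\<forall>l1 l2. l1 \<le> m \<longrightarrow> l1 + l2 \<le> n - m - 2 \<longrightarrow>
        basis_elt n (Z l1) \<otimes>\<^bsub>HKA\<^esub> basis_elt n (Zeta l2) = basis_elt n (Zeta (l1 + l2))) \<and>
     (\<forall>x\<in>labels n m. \<forall>y\<in>labels n m.
        basis_elt n x \<otimes>\<^bsub>HKA\<^esub> basis_elt n y \<noteq> \<zero>\<^bsub>HKA\<^esub> \<longleftrightarrow> listed n m x y \<or> listed n m y x)"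
proof -
  interpret preproj n "TYPE('f)" by unfold_locales (rule assms(1))
  show ?thesis
    unfolding assms(3)
  proof (intro conjI allI impI ballI)
    show "vectorspace class_ring HA" by (rule HA_vectorspace)
    show "inj_on (basis_elt n :: label \<Rightarrow> nat \<Rightarrow> 'f cochain set) (labels n m)"
      and "vectorspace.basis class_ring HA (basis_elt n ` labels n m)"
      by (rule HK_basis[OF assms(2)])+
  next
    fix p q and x y :: "nat \<Rightarrow> 'f cochain set" assume "x \<in> homogeneous n p" "y \<in> homogeneous n q"
    then show "x \<otimes>\<^bsub>HA\<^esub> y = ((- 1) ^ (p * q)) \<odot>\<^bsub>HA\<^esub> (y \<otimes>\<^bsub>HA\<^esub> x)" by (rule graded_commutative)
  next
    fix x assume "x \<in> carrier HA"
    then show "basis_elt n (Z 0) \<otimes>\<^bsub>HA\<^esub> x = x" by (rule HK_unit)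
  next
    fix l1 l2
    show "basis_elt n (Z l1) \<otimes>\<^bsub>HA\<^esub> basis_elt n (Z l2) = basis_elt n (Z (l1 + l2))"
      by (rule HK_product) simp_all
  next
    fix l1 l2
    show "basis_elt n (Z l1) \<otimes>\<^bsub>HA\<^esub> basis_elt n (Zeta l2) = basis_elt n (Zeta (l1 + l2))"
      by (rule HK_product) simp_all
  next
    fix x y assume "x \<in> labels n m" "y \<in> labels n m"
    then show "basis_elt n x \<otimes>\<^bsub>HA\<^esub> basis_elt n y \<noteq> \<zero>\<^bsub>HA\<^esub> \<longleftrightarrow> listed n m x y \<or> listed n m y x"
      by (rule HK_listed[OF assms(2)])
  qed
qed

end
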